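(* Let $A\in\mathrm{Sym}(n,\mathbb{R})$ be a sufficiently generic real symmetric matrix. Then the $\binom n2$ real critical points $C^T\Lambda_{i,j}C$ ($1\le i<j\le n$) of $d_A:\mathscr{C}(\Delta_{\mathrm{sm}})\to\mathbb{R}$ are the only ED critical points of $A$ with respect to $\mathscr{C}(\Delta)$, and the Euclidean distance degree satisfies $\mathrm{EDdeg}(\mathscr{C}(\Delta))=\binom n2$.
   Context: $\mathrm{Sym}(n,\mathbb{R})$ (resp. $\mathrm{Sym}(n,\mathbb{C})$) is the space of real (resp. complex) symmetric $n\times n$ matrices, with the bilinear form $(A_1,A_2)\mapsto\mathrm{tr}(A_1^TA_2)$ and norm $\|Q\|=\sqrt{\mathrm{tr}(Q^2)}$ on the real space. $\mathscr{C}(\Delta)\subset\mathrm{Sym}(n,\mathbb{R})$ is the real algebraic variety of real symmetric matrices with a repeated eigenvalue, $\mathscr{C}(\Delta_{\mathrm{sm}})$ the set of those with exactly one double eigenvalue and all other eigenvalues simple, and $X^{\mathbb{C}}\subset\mathrm{Sym}(n,\mathbb{C})$ the Zariski closure of $\mathscr{C}(\Delta)$, with smooth locus $X^{\mathbb{C}}_{\mathrm{sm}}$. For $A=C^T\Lambda C$ a spectral decomposition with $\Lambda=\mathrm{diag}(\lambda_1,\dots,\lambda_n)$, $\Lambda_{i,j}$ is $\Lambda$ with its $i$-th and $j$-th diagonal entries replaced by $\frac{\lambda_i+\lambda_j}2$. An ED critical point of $A$ with respect to $\mathscr{C}(\Delta)$ is a point $x\in X^{\mathbb{C}}_{\mathrm{sm}}$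 with $A-x$ orthogonal to $T_xX^{\mathbb{C}}_{\mathrm{sm}}$ with respect to the bilinear form above; $\mathrm{EDdeg}(\mathscr{C}(\Delta))$ is the number of such points for generic $A$. *)

theory Defs
  imports "HOL-Analysis.Analysis" "HOL-Computational_Algebra.Polynomial"
begin

definition rsym :: "(real^'n^'n) set" where
  "rsym = {A. transpose A = A}"

definition csym :: "(complex^'n^'n) set" where
  "csym = {A. transpose A = A}"

definition cembed :: "real^'n^'n \<Rightarrow> complex^'n^'n" where
  "cembed A = (\<chi> i j. complex_of_real (A$i$j))"

definition cscale :: "complex \<Rightarrow> complex^'n^'n \<Rightarrow> complex^'n^'n" where
  "cscale t M = (\<chi> i j. t * M$i$j)"

text \<open>The bilinear form (A1,A2) |-> tr(A1^T A2) (no complex conjugation).\<close>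
definition bilin :: "complex^'n^'n \<Rightarrow> complex^'n^'n \<Rightarrow> complex" where
  "bilin A1 A2 = (\<Sum>i\<in>UNIV. \<Sum>j\<in>UNIV. A1$j$i * A2$j$i)"

inductive_set cpolys :: "(complex^'n^'n \<Rightarrow> complex) set" where
  cconst: "(\<lambda>x. c) \<in> cpolys"
| ccoord: "(\<lambda>x. x$i$j) \<in> cpolys"
| cadd: "p \<in> cpolys \<Longrightarrow> q \<in> cpolys \<Longrightarrow> (\<lambda>x. p x + q x) \<in> cpolys"
| cmult: "p \<in> cpolys \<Longrightarrow> q \<in> cpolys \<Longrightarrow> (\<lambda>x. p x * q x) \<in> cpolys"

inductive_set rpolys :: "(real^'n^'n \<Rightarrow> real) set" where
  rconst: "(\<lambda>x. c) \<in> rpolys"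
| rcoord: "(\<lambda>x. x$i$j) \<in> rpolys"
| radd: "p \<in> rpolys \<Longrightarrow> q \<in> rpolys \<Longrightarrow> (\<lambda>x. p x + q x) \<in> rpolys"
| rmult: "p \<in> rpolys \<Longrightarrow> q \<in> rpolys \<Longrightarrow> (\<lambda>x. p x * q x) \<in> rpolys"

definition charpoly :: "real^'n^'n \<Rightarrow> real poly" where
  "charpoly A = det (\<chi> i j. (if i = j then [:0, 1:] else 0) - [:A$i$j:])"

definition has_repeated_eigenvalue :: "real^'n^'n \<Rightarrow> bool" where
  "has_repeated_eigenvalue A \<longleftrightarrow> (\<exists>c. [:-c, 1:]^2 dvd charpoly A)"

definition CDelta :: "(real^'n^'n) set" where
  "CDelta = {A \<in> rsym. has_repeated_eigenvalue A}"

definition zclosed :: "(complex^'n^'n) set \<Rightarrow> bool" where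
  "zclosed S \<longleftrightarrow> (\<exists>P \<subseteq> cpolys. S = {x \<in> csym. \<forall>p\<in>P. p x = 0})"

definition zclosure :: "(complex^'n^'n) set \<Rightarrow> (complex^'n^'n) set" where
  "zclosure S = {x \<in> csym. \<forall>p\<in>cpolys. (\<forall>y\<in>S. p y = 0) \<longrightarrow> p x = 0}"

definition zirreducible :: "(complex^'n^'n) set \<Rightarrow> bool" where
  "zirreducible Z \<longleftrightarrow> zclosed Z \<and> Z \<noteq> {} \<and>
     (\<forall>Z1 Z2. zclosed Z1 \<and> zclosed Z2 \<and> Z = Z1 \<union> Z2 \<longrightarrow> Z = Z1 \<or> Z = Z2)"

definition zdim :: "(complex^'n^'n) set \<Rightarrow> nat" where
  "zdim Z = Sup {k. \<exists>c :: nat \<Rightarrow> (complex^'n^'n) set.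
       (\<forall>i\<le>k. zirreducible (c i) \<and> c i \<subseteq> Z) \<and> (\<forall>i<k. c i \<subset> c (Suc i))}"

definition zlocdim :: "(complex^'n^'n) set \<Rightarrow> complex^'n^'n \<Rightarrow> nat" where
  "zlocdim X x = Sup {zdim Z | Z. zirreducible Z \<and> Z \<subseteq> X \<and> x \<in> Z}"

definition ztangent :: "(complex^'n^'n) set \<Rightarrow> complex^'n^'n \<Rightarrow> (complex^'n^'n) set" where
  "ztangent X x = {v \<in> csym. \<forall>p\<in>cpolys. (\<forall>y\<in>X. p y = 0) \<longrightarrow>
       ((\<lambda>t. p (x + cscale t v)) has_field_derivative 0) (at 0)}"

text \<open>Smooth points: the (complex) dimension of the tangent space equals the local
  dimension.  The tangent space is a complex subspace; its real dimension is twice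
  its complex dimension.\<close>
definition zsmooth :: "(complex^'n^'n) set \<Rightarrow> (complex^'n^'n) set" where
  "zsmooth X = {x \<in> X. dim (ztangent X x) = 2 * zlocdim X x}"

definition XC :: "(complex^'n^'n) set" where
  "XC = zclosure (cembed ` CDelta)"

definition ED_critical :: "complex^'n^'n \<Rightarrow> (complex^'n^'n) set" where
  "ED_critical A = {x \<in> zsmooth XC. \<forall>v\<in>ztangent XC x. bilin (A - x) v = 0}"

text \<open>EDdeg: the number of ED critical points of a generic (complex symmetric) A,
  i.e. the constant count on a nonempty Zariski open subset of Sym(n,C).\<close>
definition EDdeg_CDelta :: "'n::finite itself \<Rightarrow> nat" where
  "EDdeg_CDelta _ = (THE d. \<exists>q\<in>(cpolys :: (complex^'n^'n \<Rightarrow> complex) set).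
      (\<exists>B\<in>csym. q B \<noteq> 0) \<and>
      (\<forall>A\<in>csym. q A \<noteq> 0 \<longrightarrow> finite (ED_critical A) \<and> card (ED_critical A) = d))"

definition diag_mat :: "real^'n \<Rightarrow> real^'n^'n" where
  "diag_mat l = (\<chi> i j. if i = j then l$i else 0)"

definition Lam_ij :: "(real^'n) \<Rightarrow> 'n \<Rightarrow> 'n \<Rightarrow> real^'n^'n" where
  "Lam_ij l i j = diag_mat (\<chi> k. if k = i \<or> k = j then (l$i + l$j) / 2 else l$k)"

end

theory Submission
  imports Defs "HOL-Computational_Algebra.Fundamental_Theorem_Algebra"
begin

text \<open>A real symmetric matrix has a repeated eigenvalue iff some eigenspace is at least
  two-dimensional, iff up to the choice of two indices \<open>i \<noteq> j\<close> it is the value of a polynomial map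
  \<open>phi i j\<close> in \<open>dim Sym(n) - 2\<close> parameters.  Hence the variety is the Zariski closure of the set \<open>derog\<close> of
  complex symmetric matrices with a two-dimensional eigenspace, and this description makes
  everything explicit.

  Dimension: a chain of irreducible closed sets of length \<open>k\<close> yields \<open>k\<close> algebraically independent
  polynomials, and counting monomials in the parameters of \<open>phi i j\<close> gives \<open>k \<le> dim Sym(n) - 2\<close>; turning
  on the parameters one at a time gives a chain of exactly this length through every point of \<open>derog\<close>.

  Tangent spaces: for every vector \<open>z\<close> the determinant of columns \<open>g\<^sub>k(y) z\<close>, with \<open>g\<^sub>k\<close> polynomials in
  one variable, vanishes on the variety.  At a diagonal matrix with a single coincidence
  \<open>m\<^sub>i = m\<^sub>j\<close> these equations cut out \<open>v\<^sub>i\<^sub>i = v\<^sub>j\<^sub>j\<close>, \<open>v\<^sub>i\<^sub>j = 0\<close>, which is a space of the right dimension.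

  Critical points: the tangent space at \<open>x\<close> contains the directions \<open>x S - S x\<close> with \<open>S\<close> skew, so a
  critical point commutes with \<open>A\<close> and is diagonal in the eigenbasis of \<open>A\<close>; the diagonal
  directions then determine it.\<close>

section \<open>Linear algebra over a field\<close>

text \<open>The closure, its tangent spaces and its dimension are defined through all vanishing
  polynomials, and no generators of the ideal are at hand. So a claim about arbitrary points of the
  closure is phrased as a polynomial condition and checked on \<open>derog\<close>, while dimensions
  are computed only at points of \<open>derog\<close>, where the charts supply curves and chains. A
  second obstacle is that the degree counts critical points of generic complex \<open>A\<close>: a
  complex symmetric matrix may have isotropic eigenvectors or Jordan blocks, so the spectral theorem
  fails. One polynomial, \<open>gen_poly\<close>, excludes all bad cases. Its nonvanishing forbids
  l_i + l_j = 2 l_k for distinct i, j and every k, also in the degenerate form of a Jordan block.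
  With k = i this makes eigenvalues distinct and eigenvectors non-isotropic, hence gives a complex
  orthogonal diagonalisation. With the other k it keeps the average of two eigenvalues away from the
  rest, so that the candidate critical points have exactly one coincidence and are smooth.\<close>

lemma det_eq_0_iff_kernel:
  fixes A :: "'a::field^'n^'n"
  shows "det A = 0 \<longleftrightarrow> (\<exists>v. v \<noteq> 0 \<and> A *v v = 0)"
  by (metis invertible_det_nz invertible_left_inverse matrix_left_invertible_ker)

lemma det_eq_0_if_left_kernel:
  fixes A :: "'a::field^'n^'n"
  assumes "a \<noteq> 0" "\<And>k. (\<Sum>l\<in>UNIV. a$l * A$l$k) = 0"
  shows "det A = 0"
proof -
  have "transpose A *v a = 0"
    using assms(2) by (simp add: vec_eq_iff vector_matrix_mult_def mult.commute)
  then show ?thesis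
    using assms(1) det_eq_0_iff_kernel[of "transpose A"] by auto
qed

lemma mat_mult_vec: "mat c *v x = c *s (x::'a::semiring_1^'n)"
  by (simp add: vec_eq_iff matrix_vector_mult_def mat_def if_distrib [where f="\<lambda>x. x * _"] cong: if_cong)

lemma matrix_matrix_mult_nth: "(A ** B)$i$j = (\<Sum>k\<in>UNIV. A$i$k * B$k$j)"
  by (simp add: matrix_matrix_mult_def)

lemma matrix_vector_mult_nth: "(A *v x)$i = (\<Sum>k\<in>UNIV. A$i$k * x$k)"
  by (simp add: matrix_vector_mult_def)

lemma transpose_nth [simp]: "transpose A $ i $ j = A $ j $ i"
  by (simp add: transpose_def)

lemma transpose_add: "transpose (A + B) = transpose A + transpose B"
  by (simp add: vec_eq_iff)

lemma transpose_diff: "transpose (A - B) = transpose A - transpose B"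
  by (simp add: vec_eq_iff)

text \<open>Replacing column \<open>i\<close> of \<open>B\<close> by a kernel vector \<open>v\<close> with \<open>v $ i \<noteq> 0\<close> gives a matrix whose
  kernel detects a further vector of the generalised kernel.\<close>

lemma column_replace_kernel:
  fixes B :: "'a::field^'n^'n"
  assumes "(\<chi> a b. if b = i then v$a else B$a$b) *v z = 0"
  shows "B *v (\<chi> b. if b = i then 0 else z$b) = - (z$i) *s v"
proof -
  have "(\<Sum>b\<in>UNIV. B$a$b * (if b = i then 0 else z$b)) = - (z$i * v$a)" for a
  proof -
    have "0 = (\<Sum>b\<in>UNIV. (if b = i then v$a else B$a$b) * z$b)"
      using assms by (simp add: vec_eq_iff matrix_vector_mult_nth)
    also have "\<dots> = v$a * z$i + (\<Sum>b\<in>UNIV-{i}. B$a$b * z$b)"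
      by (subst sum.remove[of _ i]) auto
    also have "(\<Sum>b\<in>UNIV-{i}. B$a$b * z$b) = (\<Sum>b\<in>UNIV. B$a$b * (if b = i then 0 else z$b))"
      by (rule sum.mono_neutral_cong_left) auto
    finally show ?thesis by (simp add: algebra_simps eq_neg_iff_add_eq_0)
  qed
  then show ?thesis by (simp add: vec_eq_iff matrix_vector_mult_nth)
qed

lemma sum_symmetric_swap:
  fixes B :: "'a::comm_semiring_1^'n^'n"
  assumes "transpose B = B"
  shows "(\<Sum>a\<in>UNIV. x$a * (B *v y)$a) = (\<Sum>a\<in>UNIV. y$a * (B *v x)$a)"
proof -
  have sym: "B$a$b = B$b$a" for a b
    using assms by (metis transpose_nth)
  have "(\<Sum>a\<in>UNIV. x$a * (B *v y)$a) = (\<Sum>a\<in>UNIV. \<Sum>b\<in>UNIV. x$a * B$a$b * y$b)"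
    by (simp add: matrix_vector_mult_nth sum_distrib_left mult.assoc)
  also have "\<dots> = (\<Sum>b\<in>UNIV. \<Sum>a\<in>UNIV. x$a * B$a$b * y$b)"
    by (rule sum.swap)
  also have "\<dots> = (\<Sum>a\<in>UNIV. y$a * (B *v x)$a)"
    by (simp add: matrix_vector_mult_nth sum_distrib_left mult_ac sym)
  finally show ?thesis .
qed

section \<open>Polynomial functions\<close>

lemma range_polyE:
  assumes "f \<in> range poly" obtains q where "\<And>t. f t = poly q t"
  using assms by auto

lemma range_poly_const: "(\<lambda>t. c) \<in> range poly"
  by (rule image_eqI[where x = "[:c:]"]) (auto simp: fun_eq_iff)

lemma range_poly_id: "(\<lambda>t::'a::comm_ring_1. t) \<in> range poly"
  by (rule image_eqI[where x = "[:0,1:]"]) (auto simp: fun_eq_iff)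

lemma range_poly_add:
  "f \<in> range poly \<Longrightarrow> g \<in> range poly \<Longrightarrow> (\<lambda>t. f t + g t :: 'a::comm_ring_1) \<in> range poly"
  by (clarsimp, rule_tac x="x+xa" in range_eqI) (simp add: fun_eq_iff)

lemma range_poly_mult:
  "f \<in> range poly \<Longrightarrow> g \<in> range poly \<Longrightarrow> (\<lambda>t. f t * g t :: 'a::comm_ring_1) \<in> range poly"
  by (clarsimp, rule_tac x="x*xa" in range_eqI) (simp add: fun_eq_iff)

lemma range_poly_diff:
  "f \<in> range poly \<Longrightarrow> g \<in> range poly \<Longrightarrow> (\<lambda>t. f t - g t :: 'a::comm_ring_1) \<in> range poly"
  by (clarsimp, rule_tac x="x-xa" in range_eqI) (simp add: fun_eq_iff)

lemma range_poly_sum: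
  "(\<And>a. a \<in> A \<Longrightarrow> f a \<in> range poly) \<Longrightarrow> (\<lambda>t. \<Sum>a\<in>A. f a t :: 'a::comm_ring_1) \<in> range poly"
  by (induction A rule: infinite_finite_induct) (auto intro!: range_poly_const range_poly_add)

lemma range_poly_prod:
  "(\<And>a. a \<in> A \<Longrightarrow> f a \<in> range poly) \<Longrightarrow> (\<lambda>t. \<Prod>a\<in>A. f a t :: 'a::comm_ring_1) \<in> range poly"
  by (induction A rule: infinite_finite_induct) (auto intro!: range_poly_const range_poly_mult)

lemma range_poly_if:
  "(P \<Longrightarrow> f \<in> range poly) \<Longrightarrow> (\<not> P \<Longrightarrow> g \<in> range poly) \<Longrightarrow> (\<lambda>t. if P then f t else g t) \<in> range poly"
  by (cases P) auto

lemmas range_poly_intros = range_poly_const range_poly_id range_poly_add range_poly_mult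
  range_poly_diff range_poly_sum range_poly_prod range_poly_if

lemma range_poly_det:
  "(\<And>a b. (\<lambda>t. G t $ a $ b) \<in> range poly) \<Longrightarrow> (\<lambda>t. det (G t) :: 'a::comm_ring_1) \<in> range poly"
  unfolding det_def by (intro range_poly_intros)

lemma range_poly_eq_0:
  fixes g :: "'a::idom \<Rightarrow> 'a"
  assumes "g \<in> range poly" "infinite {t. g t = 0}"
  shows "g t = 0"
proof -
  obtain p where p: "g = poly p" using assms(1) by auto
  then have "p = 0" using assms(2) poly_roots_finite[of p] by auto
  then show ?thesis using p by simp
qed

lemma range_poly_mult_eq_0:
  fixes f g :: "complex \<Rightarrow> complex"
  assumes "f \<in> range poly" "g \<in> range poly" "\<And>t. f t * g t = 0"
  shows "f = (\<lambda>t. 0) \<or> g = (\<lambda>t. 0)"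
proof -
  obtain p q where pq: "f = poly p" "g = poly q" using assms by auto
  have "poly (p * q) = poly 0" using assms(3) pq by (auto simp: fun_eq_iff)
  then have "p * q = 0" by (simp only: poly_eq_poly_eq_iff)
  then show ?thesis using pq by auto
qed

lemma range_poly_real_zeros:
  fixes g :: "complex \<Rightarrow> complex"
  assumes "g \<in> range poly" "\<And>r. g (complex_of_real r) = 0"
  shows "g t = 0"
proof (rule range_poly_eq_0[OF assms(1)])
  have "range complex_of_real \<subseteq> {t. g t = 0}" using assms(2) by auto
  moreover have "infinite (range complex_of_real)"
    by (simp add: finite_image_iff inj_of_real infinite_UNIV_char_0)
  ultimately show "infinite {t. g t = 0}" using finite_subset by blast
qed

lemma range_poly_factor_root:
  fixes g :: "'a::idom \<Rightarrow> 'a"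
  assumes "g \<in> range poly" "g 0 = 0"
  obtains h where "h \<in> range poly" "\<And>t. g t = t * h t"
proof -
  obtain p where p: "g = poly p" using assms by auto
  then have "[:0, 1:] dvd p" using assms(2) by (simp add: poly_eq_0_iff_dvd)
  then obtain q where "p = [:0,1:] * q" by blast
  then show ?thesis using that[of "poly q"] p by simp
qed

lemma range_poly_continuous: "g \<in> range poly \<Longrightarrow> isCont (g :: complex \<Rightarrow> complex) t"
  by auto

lemma range_poly_eventually_nz:
  fixes g :: "complex \<Rightarrow> complex"
  assumes "g \<in> range poly" "g 0 \<noteq> 0"
  shows "eventually (\<lambda>t. g t \<noteq> 0) (nhds 0)"
proof -
  have "(g \<longlongrightarrow> g 0) (nhds 0)"
    using range_poly_continuous[OF assms(1), of 0] by (simp add: isCont_def tendsto_at_iff_tendsto_nhds)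
  then show ?thesis by (rule tendsto_imp_eventually_ne) (use assms in auto)
qed

section \<open>Polynomial functions of the matrix entries, and their gradients\<close>

lemma cpolys_uminus: "p \<in> cpolys \<Longrightarrow> (\<lambda>x. - p x) \<in> cpolys"
  using cmult[OF cconst[of "-1"], of p] by simp

lemma cpolys_diff: "p \<in> cpolys \<Longrightarrow> q \<in> cpolys \<Longrightarrow> (\<lambda>x. p x - q x) \<in> cpolys"
  using cadd[OF _ cpolys_uminus, of p q] by simp

lemma cpolys_sum: "(\<And>a. a \<in> A \<Longrightarrow> f a \<in> cpolys) \<Longrightarrow> (\<lambda>x. \<Sum>a\<in>A. f a x) \<in> cpolys"
  by (induction A rule: infinite_finite_induct) (auto intro!: cconst cadd)

lemma cpolys_prod: "(\<And>a. a \<in> A \<Longrightarrow> f a \<in> cpolys) \<Longrightarrow> (\<lambda>x. \<Prod>a\<in>A. f a x) \<in> cpolys"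
  by (induction A rule: infinite_finite_induct) (auto intro!: cconst cmult)

lemma cpolys_if: "(P \<Longrightarrow> f \<in> cpolys) \<Longrightarrow> (\<not> P \<Longrightarrow> g \<in> cpolys) \<Longrightarrow> (\<lambda>x. if P then f x else g x) \<in> cpolys"
  by (cases P) auto

lemmas cpolys_intros = cconst ccoord cadd cmult cpolys_diff cpolys_uminus cpolys_sum cpolys_prod cpolys_if

lemma cpolys_det:
  "(\<And>a b. (\<lambda>x. G x $ a $ b) \<in> cpolys) \<Longrightarrow> (\<lambda>x. det (G x)) \<in> cpolys"
  unfolding det_def by (intro cpolys_intros)

lemma cpolys_curve:
  assumes "f \<in> cpolys" "\<And>a b. (\<lambda>t. \<gamma> t $ a $ b) \<in> range poly"
  shows "(\<lambda>t. f (\<gamma> t)) \<in> range poly"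
  using assms(1) by induction (auto intro!: range_poly_intros assms(2))

lemma cpolys_compose:
  assumes "f \<in> cpolys" "\<And>a b. (\<lambda>x. h x $ a $ b) \<in> cpolys"
  shows "(\<lambda>x. f (h x)) \<in> cpolys"
  using assms(1) by induction (auto intro!: cpolys_intros assms(2))

text \<open>The derivative is taken along any curve that is entrywise differentiable at 0, and its
  coefficients must be polynomial. The latter turns tangency into a polynomial condition on the base
  point, which extends from \<open>derog\<close> to its closure in
  \<open>ztangent_commutator\<close>.\<close>

definition has_gradient ::
  "(complex^'n^'n \<Rightarrow> complex) \<Rightarrow> ('n \<Rightarrow> 'n \<Rightarrow> complex^'n^'n \<Rightarrow> complex) \<Rightarrow> bool" where
  "has_gradient f G \<longleftrightarrow> (\<forall>a b. G a b \<in> cpolys) \<and>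
     (\<forall>\<gamma> v. (\<forall>a b. ((\<lambda>t. \<gamma> t $ a $ b) has_field_derivative v$a$b) (at 0)) \<longrightarrow>
       ((\<lambda>t. f (\<gamma> t)) has_field_derivative (\<Sum>a\<in>UNIV. \<Sum>b\<in>UNIV. G a b (\<gamma> 0) * v$a$b)) (at (0::complex)))"

lemma has_gradientI:
  assumes "\<And>a b. G a b \<in> cpolys"
    and "\<And>\<gamma> v. (\<And>a b. ((\<lambda>t. \<gamma> t $ a $ b) has_field_derivative v$a$b) (at 0)) \<Longrightarrow>
       ((\<lambda>t. f (\<gamma> t)) has_field_derivative (\<Sum>a\<in>UNIV. \<Sum>b\<in>UNIV. G a b (\<gamma> 0) * v$a$b)) (at (0::complex))"
  shows "has_gradient f G"
  using assms unfolding has_gradient_def by blast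

lemma has_gradientD:
  assumes "has_gradient f G"
  shows "G a b \<in> cpolys"
    and "(\<And>a b. ((\<lambda>t. \<gamma> t $ a $ b) has_field_derivative v$a$b) (at 0)) \<Longrightarrow>
       ((\<lambda>t. f (\<gamma> t)) has_field_derivative (\<Sum>a\<in>UNIV. \<Sum>b\<in>UNIV. G a b (\<gamma> 0) * v$a$b)) (at (0::complex))"
  using assms unfolding has_gradient_def by blast+

lemma cpolys_gradient:
  fixes f :: "complex^'n^'n \<Rightarrow> complex"
  assumes "f \<in> cpolys"
  shows "\<exists>G. has_gradient f G"
  using assms
proof induction
  case (cconst c)
  show ?case by (rule exI[of _ "\<lambda>a b x. 0"], rule has_gradientI) (auto intro!: cpolys_intros)
next
  case (ccoord i j)
  have *: "(\<Sum>a\<in>UNIV. \<Sum>b\<in>UNIV. (if a = i \<and> b = j then 1 else 0) * v$a$b) = v$i$j" for v :: "complex^'n^'n"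
  proof -
    have "(\<Sum>b\<in>UNIV. (if a = i \<and> b = j then 1 else 0) * v$a$b) = (if a = i then v$i$j else 0)" for a
      by (simp add: if_distrib [where f="\<lambda>x. x * _"] cong: if_cong)
    then show ?thesis by simp
  qed
  show ?case
  proof (rule exI[of _ "\<lambda>a b x. if a = i \<and> b = j then 1 else 0"], rule has_gradientI)
    fix a b show "(\<lambda>x. if a = i \<and> b = j then 1 else 0) \<in> cpolys" by (intro cpolys_intros)
  qed (simp only: *)
next
  case (cadd p q)
  then obtain G H where G: "has_gradient p G" and H: "has_gradient q H" by auto
  show ?case
  proof (rule exI[of _ "\<lambda>a b x. G a b x + H a b x"], rule has_gradientI)
    fix a b show "(\<lambda>x. G a b x + H a b x) \<in> cpolys"
      using has_gradientD(1)[OF G] has_gradientD(1)[OF H] by (intro cpolys_intros)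
  next
    fix \<gamma> :: "complex \<Rightarrow> complex^'n^'n" and v :: "complex^'n^'n"
    assume *: "\<And>a b. ((\<lambda>t. \<gamma> t $ a $ b) has_field_derivative v$a$b) (at 0)"
    show "((\<lambda>t. p (\<gamma> t) + q (\<gamma> t)) has_field_derivative
        (\<Sum>a\<in>UNIV. \<Sum>b\<in>UNIV. (G a b (\<gamma> 0) + H a b (\<gamma> 0)) * v$a$b)) (at 0)"
      using DERIV_add[OF has_gradientD(2)[OF G *] has_gradientD(2)[OF H *]]
      by (simp add: sum.distrib distrib_right)
  qed
next
  case (cmult p q)
  then obtain G H where G: "has_gradient p G" and H: "has_gradient q H" by auto
  show ?case
  proof (rule exI[of _ "\<lambda>a b x. G a b x * q x + p x * H a b x"], rule has_gradientI)
    fix a b show "(\<lambda>x. G a b x * q x + p x * H a b x) \<in> cpolys"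
      using has_gradientD(1)[OF G] has_gradientD(1)[OF H] cmult by (intro cpolys_intros)
  next
    fix \<gamma> :: "complex \<Rightarrow> complex^'n^'n" and v :: "complex^'n^'n"
    assume *: "\<And>a b. ((\<lambda>t. \<gamma> t $ a $ b) has_field_derivative v$a$b) (at 0)"
    have "(\<Sum>a\<in>UNIV. \<Sum>b\<in>UNIV. (G a b (\<gamma> 0) * q (\<gamma> 0) + p (\<gamma> 0) * H a b (\<gamma> 0)) * v$a$b)
      = (\<Sum>a\<in>UNIV. \<Sum>b\<in>UNIV. G a b (\<gamma> 0) * v$a$b) * q (\<gamma> 0)
        + (\<Sum>a\<in>UNIV. \<Sum>b\<in>UNIV. H a b (\<gamma> 0) * v$a$b) * p (\<gamma> 0)"
      unfolding sum_distrib_right sum.distrib[symmetric] by (intro sum.cong refl) (simp add: algebra_simps)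
    then show "((\<lambda>t. p (\<gamma> t) * q (\<gamma> t)) has_field_derivative
        (\<Sum>a\<in>UNIV. \<Sum>b\<in>UNIV. (G a b (\<gamma> 0) * q (\<gamma> 0) + p (\<gamma> 0) * H a b (\<gamma> 0)) * v$a$b)) (at 0)"
      using DERIV_mult[OF has_gradientD(2)[OF G *] has_gradientD(2)[OF H *]] by simp
  qed
qed

section \<open>Symmetric matrices with a two-dimensional eigenspace\<close>

definition double_kernel :: "'a::field^'n^'n \<Rightarrow> bool" where
  "double_kernel K \<longleftrightarrow> (\<exists>u w. K *v u = 0 \<and> K *v w = 0 \<and> u \<noteq> 0 \<and> (\<forall>c. w \<noteq> c *s u))"

definition derog :: "('a::field^'n^'n) set" where
  "derog = {y. transpose y = y \<and> (\<exists>c. double_kernel (y - mat c))}"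

text \<open>Off the rows \<open>i\<close>, \<open>j\<close>, the \<open>i\<close>-th and \<open>j\<close>-th rows of \<open>S\<close> are the coordinates of two kernel
  vectors of \<open>phi i j S - mat (S $ i $ i)\<close>.  The entries \<open>(i,j)\<close> and \<open>(j,j)\<close> of \<open>S\<close> do not occur,
  which leaves \<open>dim Sym(n) - 2\<close> parameters.\<close>

definition Pi_mat :: "'n \<Rightarrow> 'n \<Rightarrow> 'a::field^'n^'n \<Rightarrow> 'a^'n^'n" where
  "Pi_mat i j S = (\<chi> a b. if a = i \<or> a = j then 0 else if b = i then S$i$a
     else if b = j then S$j$a else if a = b then 1 else 0)"

definition phi :: "'n \<Rightarrow> 'n \<Rightarrow> 'a::field^'n^'n \<Rightarrow> 'a^'n^'n" where
  "phi i j S = mat (S$i$i) + transpose (Pi_mat i j S) ** S ** Pi_mat i j S"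

lemma phi_nth:
  "phi i j S $ a $ b = (if a = b then S$i$i else 0)
     + (\<Sum>l\<in>UNIV. \<Sum>k\<in>UNIV. Pi_mat i j S $ k $ a * S$k$l * Pi_mat i j S $ l $ b)"
  by (simp add: phi_def matrix_matrix_mult_nth mat_def sum_distrib_right)

lemma transpose_phi:
  assumes "transpose S = S" shows "transpose (phi i j S) = phi i j S"
  using assms by (simp add: phi_def transpose_add matrix_transpose_mul matrix_mul_assoc)

lemma range_poly_phi:
  assumes "\<And>a b. (\<lambda>t. S t $ a $ b) \<in> range poly"
  shows "(\<lambda>t. phi i j (S t) $ a $ b) \<in> range poly"
  unfolding phi_nth Pi_mat_def
  by (simp only: vec_lambda_beta) (intro range_poly_intros assms)

text \<open>Reduced echelon form of a basis of a plane: some 2 by 2 minor, on the coordinates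
  \<open>i\<close> and \<open>j\<close>, is nonzero and can be made the identity. This pair later
  selects the chart \<open>phi i j\<close>.\<close>

lemma double_kernel_normalized:
  assumes "double_kernel K"
  obtains i j u w where "i \<noteq> j" "K *v u = 0" "K *v w = 0" "u$i = 1" "u$j = 0" "w$i = 0" "w$j = 1"
proof -
  obtain u w where u: "K *v u = 0" "K *v w = 0" "u \<noteq> 0" and ind: "\<And>c. w \<noteq> c *s u"
    using assms unfolding double_kernel_def by blast
  obtain i where i: "u$i \<noteq> 0" using u(3) by (auto simp: vec_eq_iff)
  define w' where "w' = w - (w$i / u$i) *s u"
  have "w' \<noteq> 0" using ind[of "w$i / u$i"] by (simp add: w'_def)
  then obtain j where j: "w'$j \<noteq> 0" by (auto simp: vec_eq_iff)
  have w'i: "w'$i = 0" using i by (simp add: w'_def)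
  have ij: "i \<noteq> j" using w'i j by auto
  have Kw': "K *v w' = 0"
    using u by (simp add: w'_def matrix_vector_mult_diff_distrib vector_scalar_commute)
  define w2 where "w2 = (1 / w'$j) *s w'"
  define u2 where "u2 = (1 / u$i) *s u - (u$j / u$i) *s w2"
  show ?thesis
  proof (rule that[OF ij, of u2 w2])
    show "K *v w2 = 0" using Kw' by (simp add: w2_def vector_scalar_commute)
    then show "K *v u2 = 0"
      using u by (simp add: u2_def matrix_vector_mult_diff_distrib vector_scalar_commute)
  qed (use i j w'i in \<open>auto simp: u2_def w2_def\<close>)
qed

text \<open>\<open>Pi_mat i j S\<close> is the projection onto the coordinates off \<open>i\<close>,
  \<open>j\<close> along the two vectors \<open>?u\<close> and \<open>?w\<close>, so both are killed
  by the congruence term of \<open>phi\<close>.\<close>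

lemma double_kernel_phi:
  assumes "i \<noteq> j"
  shows "double_kernel (phi i j S - mat (S$i$i))"
proof -
  have P: "Pi_mat i j S *v x = 0" if "\<And>a. a \<notin> {i,j} \<Longrightarrow> x$a = - (S$i$a * x$i + S$j$a * x$j)" for x
  proof -
    have "(\<Sum>b\<in>UNIV. Pi_mat i j S $ a $ b * x$b) = 0" for a
    proof (cases "a \<in> {i,j}")
      case False
      have "(\<Sum>b\<in>UNIV. Pi_mat i j S $ a $ b * x$b) = (\<Sum>b\<in>{i,j,a}. Pi_mat i j S $ a $ b * x$b)"
        using False by (intro sum.mono_neutral_right) (auto simp: Pi_mat_def)
      also have "\<dots> = 0" using False assms that[of a] by (auto simp: Pi_mat_def)
      finally show ?thesis .
    qed (auto simp: Pi_mat_def)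
    then show ?thesis by (simp add: vec_eq_iff matrix_vector_mult_nth)
  qed
  have K: "(phi i j S - mat (S$i$i)) *v x = 0"
    if "\<And>a. a \<notin> {i,j} \<Longrightarrow> x$a = - (S$i$a * x$i + S$j$a * x$j)" for x
    using P[OF that] by (simp add: phi_def flip: matrix_vector_mul_assoc)
  show ?thesis unfolding double_kernel_def
  proof (intro exI conjI allI)
    let ?u = "\<chi> a. if a = i then 1 else if a = j then 0 else - S$i$a"
    let ?w = "\<chi> a. if a = i then 0 else if a = j then 1 else - S$j$a"
    show "(phi i j S - mat (S$i$i)) *v ?u = 0" by (rule K) (use assms in auto)
    show "(phi i j S - mat (S$i$i)) *v ?w = 0" by (rule K) (use assms in auto)
    show "?u \<noteq> 0" by (simp add: vec_eq_iff exI[of _ i])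
    fix c show "?w \<noteq> c *s ?u"
    proof
      assume *: "?w = c *s ?u"
      have "?w $ j = (c *s ?u) $ j" by (simp only: *)
      then show False using assms by simp
    qed
  qed
qed

lemma derog_phi: "i \<noteq> j \<Longrightarrow> transpose S = S \<Longrightarrow> phi i j S \<in> derog"
  unfolding derog_def using double_kernel_phi[of i j S] transpose_phi[of S i j] by auto

text \<open>The projection P along a normalised kernel basis of K = y - c satisfies K P = K, hence K
  = P^T K P by symmetry. Only the block of K off \<open>i\<close>, \<open>j\<close> enters the
  right-hand side, so the rows \<open>i\<close> and \<open>j\<close> of \<open>S\<close> are free to
  hold \<open>c\<close> and the kernel vectors.\<close>

lemma derog_phi_exhaust:
  assumes "y \<in> derog"
  obtains i j S where "i \<noteq> j" "transpose S = S" "y = phi i j S"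
proof -
  obtain c where sym: "transpose y = y" and dk: "double_kernel (y - mat c)"
    using assms unfolding derog_def by auto
  define K where "K = y - mat c"
  have Ks: "K$a$b = K$b$a" for a b
  proof -
    have "transpose K = K" using sym by (simp add: K_def transpose_diff)
    then show ?thesis by (metis transpose_nth)
  qed
  obtain i j u w where ij: "i \<noteq> j" and ker: "K *v u = 0" "K *v w = 0"
    and uw: "u$i = 1" "u$j = 0" "w$i = 0" "w$j = 1"
    using double_kernel_normalized[OF dk[folded K_def]] by metis
  \<comment> \<open>The minus signs make \<open>Pi_mat i j S\<close> send \<open>u\<close> and
    \<open>w\<close> to 0.\<close>
  define S where "S = (\<chi> a b. if a = i \<and> b = i then c else if a = i then - u$b else if b = i then - u$a
     else if a = j then - w$b else if b = j then - w$a else K$a$b)"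
  have Ssym: "transpose S = S" using Ks uw by (auto simp: vec_eq_iff S_def)
  have KP: "K ** Pi_mat i j S = K"
  proof -
    have "(\<Sum>a\<in>UNIV. K$x$a * Pi_mat i j S $ a $ b) = K$x$b" for x b
    proof -
      have sp: "(\<Sum>a\<in>UNIV. K$x$a * v$a) = K$x$i * v$i + K$x$j * v$j + (\<Sum>a\<in>UNIV-{i,j}. K$x$a * v$a)" for v
        using ij by (simp add: sum.remove[of UNIV i] sum.remove[of "UNIV - {i}" j] add.assoc Diff_insert2[symmetric] insert_commute)
      have "(\<Sum>a\<in>UNIV-{i,j}. K$x$a * - u$a) = K$x$i"
        using sp[of u] ker(1) uw by (simp add: vec_eq_iff matrix_vector_mult_nth sum_negf neg_eq_iff_add_eq_0 add.commute)
      moreover have "(\<Sum>a\<in>UNIV-{i,j}. K$x$a * - w$a) = K$x$j"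
        using sp[of w] ker(2) uw by (simp add: vec_eq_iff matrix_vector_mult_nth sum_negf neg_eq_iff_add_eq_0 add.commute)
      moreover have "(\<Sum>a\<in>UNIV. K$x$a * Pi_mat i j S $ a $ b)
          = (\<Sum>a\<in>UNIV-{i,j}. K$x$a * (if b = i then - u$a else if b = j then - w$a else if a = b then 1 else 0))"
        using ij by (intro sum.mono_neutral_cong_right) (auto simp: Pi_mat_def S_def uw)
      moreover have "(\<Sum>a\<in>UNIV-{i,j}. K$x$a * (if a = b then 1 else 0)) = K$x$b" if "b \<notin> {i,j}"
        using that by (subst sum.mono_neutral_right[of _ "{b}"]) auto
      ultimately show ?thesis
        by (cases "b = i"; cases "b = j") (use ij in auto)
    qed
    then show ?thesis by (simp add: vec_eq_iff matrix_matrix_mult_nth)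
  qed
  \<comment> \<open>\<open>K\<close> may replace \<open>S\<close> because the rows \<open>i\<close>
    and \<open>j\<close> of \<open>Pi_mat\<close> are zero and the two matrices agree off these rows
    and columns.\<close>
  have "transpose (Pi_mat i j S) ** S ** Pi_mat i j S = transpose (Pi_mat i j S) ** K ** Pi_mat i j S"
  proof -
    have "Pi_mat i j S $ k $ a * S$k$l * Pi_mat i j S $ l $ b = Pi_mat i j S $ k $ a * K$k$l * Pi_mat i j S $ l $ b"
      for a b k l by (auto simp: Pi_mat_def S_def)
    then show ?thesis
      unfolding vec_eq_iff matrix_matrix_mult_nth transpose_nth sum_distrib_right by (auto intro!: sum.cong)
  qed
  also have "\<dots> = transpose (Pi_mat i j S) ** K" by (simp add: KP flip: matrix_mul_assoc)
  also have "\<dots> = transpose (K ** Pi_mat i j S)"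
    using Ks by (simp add: matrix_transpose_mul) (simp add: vec_eq_iff matrix_matrix_mult_nth)
  also have "\<dots> = K" unfolding KP using Ks by (simp add: vec_eq_iff)
  finally have "y = phi i j S" by (simp add: phi_def S_def K_def)
  then show ?thesis using that ij Ssym by blast
qed

text \<open>Congruence moves the kernel by the inverse of \<open>Q\<close> and keeps symmetry, for
  any invertible \<open>Q\<close>. With \<open>Q\<close> = 1 + t S this supplies the curves in
  \<open>derog\<close> that produce tangent vectors.\<close>

lemma derog_congruence:
  fixes K Q :: "'a::field^'n^'n"
  assumes "transpose K = K" "double_kernel K" "det Q \<noteq> 0"
  shows "mat c + transpose Q ** K ** Q \<in> derog"
proof -
  obtain u w where u: "K *v u = 0" "K *v w = 0" "u \<noteq> 0" and ind: "\<And>c. w \<noteq> c *s u"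
    using assms(2) unfolding double_kernel_def by blast
  obtain R where R: "Q ** R = mat 1"
    using assms(3) invertible_det_nz invertible_right_inverse by blast
  have QR: "Q *v (R *v x) = x" for x
    by (simp add: matrix_vector_mul_assoc R)
  have K: "(transpose Q ** K ** Q) *v (R *v x) = 0" if "K *v x = 0" for x
    using that by (simp add: QR flip: matrix_vector_mul_assoc del: transpose_matrix_vector)
  have "double_kernel (transpose Q ** K ** Q)" unfolding double_kernel_def
  proof (intro exI conjI allI)
    show "R *v u \<noteq> 0" using QR[of u] u(3) by auto
    fix c show "R *v w \<noteq> c *s (R *v u)"
      using QR[of u] QR[of w] ind[of c] by (metis vector_scalar_commute)
  qed (use K u in auto)
  moreover have "transpose (transpose Q ** K ** Q) = transpose Q ** K ** Q"
    using assms(1) by (simp add: matrix_transpose_mul matrix_mul_assoc)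
  ultimately show ?thesis unfolding derog_def
    by (auto simp: transpose_add intro!: exI[of _ c])
qed

section \<open>The real variety\<close>

lemma det_col_mul:
  fixes A :: "'a::comm_ring_1^'n^'n"
  shows "det (\<chi> a b. if b = i then c * f a else A$a$b) = c * det (\<chi> a b. if b = i then f a else A$a$b)"
proof -
  have "det (\<chi> a b. if b = i then c * f a else A$a$b) = det (\<chi> b. if b = i then c *s (\<chi> a. f a) else (\<chi> a. A$a$b))"
    by (subst det_transpose[symmetric], rule arg_cong[where f=det]) (simp add: vec_eq_iff)
  also have "\<dots> = c * det (\<chi> b. if b = i then (\<chi> a. f a) else (\<chi> a. A$a$b))"
    by (rule det_row_mul)
  also have "det (\<chi> b. if b = i then (\<chi> a. f a) else (\<chi> a. A$a$b)) = det (\<chi> a b. if b = i then f a else A$a$b)"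
    by (subst det_transpose[symmetric], rule arg_cong[where f=det]) (simp add: vec_eq_iff)
  finally show ?thesis .
qed

text \<open>Cramer's rule for M u = s u. With s = t - c it splits a linear factor off a
  characteristic polynomial.\<close>

lemma det_eigen_column:
  fixes M :: "'a::field^'n^'n"
  assumes "M *v u = s *s u"
  shows "u$i * det M = s * det (\<chi> a b. if b = i then u$a else M$a$b)"
proof -
  have "u$i * det M = det (\<chi> a b. if b = i then s * u$a else M$a$b)"
    unfolding cramer_lemma[symmetric] assms by (simp only: vector_smult_component)
  then show ?thesis by (simp only: det_col_mul)
qed

lemma poly_charpoly: "poly (charpoly y) t = det (mat t - y)"
proof -
  have "poly (of_int k) t = of_int k" for k :: int and t :: real by (cases k) auto
  then show ?thesis
    unfolding charpoly_def det_def
    by (auto simp: poly_sum poly_prod mat_def intro!: sum.cong prod.cong)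
qed

lemma shift_mult_vec:
  assumes "(y - mat c) *v u = (0::'a::field^'n)"
  shows "(mat t - y) *v u = (t - c) *s u"
  using assms by (simp add: matrix_vector_mult_diff_rdistrib mat_mult_vec vector_sub_rdistrib)

lemma range_poly_shift: "(\<lambda>t. (mat t - y) $ a $ b :: 'a::comm_ring_1) \<in> range poly"
  by (simp add: mat_def) (intro range_poly_intros)

text \<open>Algebraic and geometric multiplicity agree for real symmetric matrices. Replacing a
  column by an eigenvector divides the characteristic polynomial by t - c; after one division a
  double root still leaves a singular matrix, whose kernel yields a second eigenvector. Conversely,
  two kernel vectors allow two divisions.\<close>

lemma CDelta_eq_derog: "CDelta = derog"
proof (rule set_eqI, rule iffI)
  fix y :: "real^'n^'n" assume "y \<in> CDelta"
  then obtain c where sym: "transpose y = y" and dvd: "[:-c, 1:]^2 dvd charpoly y"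
    by (auto simp: CDelta_def rsym_def has_repeated_eigenvalue_def)
  obtain r where r: "charpoly y = [:-c, 1:]^2 * r" using dvd by blast
  have "det (y - mat c) = 0"
  proof -
    have "det (mat c - y) = 0" by (simp add: r flip: poly_charpoly)
    then obtain u where u: "u \<noteq> 0" "(mat c - y) *v u = 0" using det_eq_0_iff_kernel by blast
    then have "(y - mat c) *v u = 0" by (simp add: matrix_vector_mult_diff_rdistrib)
    then show ?thesis using u(1) det_eq_0_iff_kernel by blast
  qed
  then obtain u where u: "u \<noteq> 0" "(y - mat c) *v u = 0" using det_eq_0_iff_kernel by blast
  then obtain i where i: "u$i \<noteq> 0" by (auto simp: vec_eq_iff)
  let ?M = "\<lambda>t. (\<chi> a b. if b = i then u$a else (mat t - y)$a$b)"
  have "(\<lambda>t. det (?M t)) \<in> range poly"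
    by (rule range_poly_det) (simp only: vec_lambda_beta, intro range_poly_intros range_poly_shift)
  then obtain q where q: "\<And>t. det (?M t) = poly q t" by (rule range_polyE) blast
  have "poly (smult (u$i) (charpoly y)) t = poly ([:-c, 1:] * q) t" for t
    using det_eigen_column[OF shift_mult_vec[OF u(2)], of i t] by (simp add: poly_charpoly q algebra_simps)
  then have "smult (u$i) (charpoly y) = [:-c, 1:] * q" using poly_eq_poly_eq_iff by blast
  then have "[:-c, 1:] * ([:-c, 1:] * smult (u$i) r) = [:-c, 1:] * q"
    by (simp only: r power2_eq_square mult.assoc mult_smult_right)
  then have "q = [:-c, 1:] * smult (u$i) r"
    unfolding mult_cancel_left by simp
  then have "det (?M c) = 0" by (simp only: q) simp
  then obtain z where z: "z \<noteq> 0" "?M c *v z = 0" using det_eq_0_iff_kernel by blast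
  define z' where "z' = (\<chi> b. if b = i then 0 else z$b)"
  have Bz: "(mat c - y) *v z' = - (z$i) *s u"
    unfolding z'_def by (rule column_replace_kernel[OF z(2)])
  have Bu: "(mat c - y) *v u = 0" using shift_mult_vec[OF u(2), of c] by simp
  have "transpose (mat c - y) = mat c - y" using sym by (simp add: transpose_diff)
  \<comment> \<open>The image of a symmetric matrix is orthogonal to its kernel, so z_i times the
    sum of the squares of \<open>u\<close> is 0. Positivity of that sum is where real entries
    matter.\<close>
  from sum_symmetric_swap[OF this, of u z'] have "(\<Sum>a\<in>UNIV. u$a * (- (z$i) *s u)$a) = 0"
    unfolding Bz Bu by simp
  then have "z$i * (\<Sum>a\<in>UNIV. u$a * u$a) = 0"
    by (simp add: sum_negf sum_distrib_left mult_ac)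
  moreover have "(\<Sum>a\<in>UNIV. u$a * u$a) > 0" using i by (intro sum_pos2[of _ i]) (auto simp: zero_less_mult_iff linorder_neq_iff)
  ultimately have zi: "z$i = 0" by simp
  have z'0: "z' \<noteq> 0" using z(1) zi by (auto simp: z'_def vec_eq_iff)
  have "double_kernel (y - mat c)" unfolding double_kernel_def
  proof (intro exI conjI allI)
    show "(y - mat c) *v u = 0" by (rule u)
    show "(y - mat c) *v z' = 0" using Bz zi by (simp add: matrix_vector_mult_diff_rdistrib)
    fix d show "z' \<noteq> d *s u"
    proof
      assume *: "z' = d *s u"
      then have "z'$i = d * u$i" by simp
      then have "d = 0" using i by (simp add: z'_def)
      then show False using * z'0 by simp
    qed
  qed (rule u)
  then show "y \<in> derog" using sym by (auto simp: derog_def)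
next
  fix y :: "real^'n^'n" assume "y \<in> derog"
  then obtain c where sym: "transpose y = y" and dk: "double_kernel (y - mat c)"
    by (auto simp: derog_def)
  obtain i j u w where ij: "i \<noteq> j" and ker: "(y - mat c) *v u = 0" "(y - mat c) *v w = 0"
    and uw: "u$i = 1" "u$j = 0" "w$i = 0" "w$j = 1"
    using double_kernel_normalized[OF dk] by metis
  let ?M = "\<lambda>t. (\<chi> a b. if b = i then u$a else (mat t - y)$a$b)"
  let ?N = "\<lambda>t. (\<chi> a b. if b = j then w$a else ?M t$a$b)"
  have "?M t *v w = (t - c) *s w" for t
  proof -
    have "?M t *v w = (mat t - y) *v w"
      using uw by (auto simp: vec_eq_iff matrix_vector_mult_nth intro!: sum.cong)
    then show ?thesis by (simp add: shift_mult_vec[OF ker(2)])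
  qed
  then have N: "det (?M t) = (t - c) * det (?N t)" for t
    using det_eigen_column[of "?M t" w "t - c" j] uw by simp
  have "(\<lambda>t. det (?N t)) \<in> range poly"
    by (rule range_poly_det) (simp only: vec_lambda_beta, intro range_poly_intros range_poly_shift)
  then obtain q where q: "\<And>t. det (?N t) = poly q t" by (rule range_polyE) blast
  have "poly (charpoly y) t = poly ([:-c, 1:]^2 * q) t" for t
    using det_eigen_column[OF shift_mult_vec[OF ker(1)], of i t] uw
    by (simp add: poly_charpoly N q power2_eq_square algebra_simps)
  then have "charpoly y = [:-c, 1:]^2 * q" using poly_eq_poly_eq_iff by blast
  then have "[:-c, 1:]^2 dvd charpoly y" by (rule dvdI)
  then show "y \<in> CDelta" using sym by (auto simp: CDelta_def rsym_def has_repeated_eigenvalue_def)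
qed

section \<open>The complex variety\<close>

lemma cembed_phi: "cembed (phi i j S) = phi i j (cembed S)"
proof -
  have P: "of_real (Pi_mat i j S $ a $ b) = Pi_mat i j (cembed S) $ a $ b" for a b
    by (simp add: Pi_mat_def cembed_def)
  show ?thesis unfolding vec_eq_iff
    by (simp add: cembed_def phi_nth P[unfolded cembed_def])
qed

lemma zclosureI: "x \<in> csym \<Longrightarrow> (\<And>p. p \<in> cpolys \<Longrightarrow> (\<And>y. y \<in> S \<Longrightarrow> p y = 0) \<Longrightarrow> p x = 0) \<Longrightarrow> x \<in> zclosure S"
  by (auto simp: zclosure_def)

lemma zclosureD: "x \<in> zclosure S \<Longrightarrow> p \<in> cpolys \<Longrightarrow> (\<And>y. y \<in> S \<Longrightarrow> p y = 0) \<Longrightarrow> p x = 0"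
  by (auto simp: zclosure_def)

lemma zclosure_sym: "x \<in> zclosure S \<Longrightarrow> transpose x = x"
  by (auto simp: zclosure_def csym_def)

lemma subset_zclosure: "S \<subseteq> csym \<Longrightarrow> S \<subseteq> zclosure S"
  by (auto simp: zclosure_def)

lemma zclosure_mono: "S \<subseteq> T \<Longrightarrow> zclosure S \<subseteq> zclosure T"
  by (auto simp: zclosure_def)

lemma derog_csym: "derog \<subseteq> csym"
  by (auto simp: derog_def csym_def)

lemma cembed_CDelta_subset: "cembed ` CDelta \<subseteq> derog"
proof
  fix x :: "complex^'n^'n" assume "x \<in> cembed ` CDelta"
  then obtain y :: "real^'n^'n" where y: "y \<in> derog" "x = cembed y" by (auto simp: CDelta_eq_derog)
  then obtain i j S where "i \<noteq> j" "transpose S = S" "y = phi i j S" using derog_phi_exhaust by blast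
  moreover have "transpose (cembed S) = cembed S"
    using \<open>transpose S = S\<close> by (simp add: vec_eq_iff cembed_def)
  ultimately show "x \<in> derog" using y by (simp add: cembed_phi derog_phi)
qed

text \<open>Zariski density of the real points, seen in a chart: Re S + t Im S is a real parameter
  matrix for real t and equals S when t is the imaginary unit, and a polynomial in t vanishing on
  the real line is 0.\<close>

lemma vanish_derog:
  fixes f :: "complex^'n^'n \<Rightarrow> complex"
  assumes "f \<in> cpolys" "\<And>y. y \<in> CDelta \<Longrightarrow> f (cembed y) = 0" "x \<in> derog"
  shows "f x = 0"
proof -
  obtain i j S where ij: "i \<noteq> j" and S: "transpose S = S" "x = phi i j S"
    using derog_phi_exhaust[OF assms(3)] by blast
  have Ss: "S$a$b = S$b$a" for a b using S(1) by (metis transpose_nth)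
  define \<gamma> :: "complex \<Rightarrow> complex^'n^'n" where "\<gamma> t = (\<chi> a b. of_real (Re (S$a$b)) + t * of_real (Im (S$a$b)))" for t
  have "(\<lambda>t. f (phi i j (\<gamma> t))) \<in> range poly"
    by (intro cpolys_curve[OF assms(1)] range_poly_phi) (simp add: \<gamma>_def, intro range_poly_intros)
  moreover have "f (phi i j (\<gamma> (of_real r))) = 0" for r
  proof -
    define T where "T = (\<chi> a b. Re (S$a$b) + r * Im (S$a$b))"
    have "\<gamma> (of_real r) = cembed T" by (simp add: vec_eq_iff \<gamma>_def cembed_def T_def)
    moreover have "transpose T = T" using Ss by (simp add: vec_eq_iff T_def)
    then have "phi i j T \<in> CDelta" unfolding CDelta_eq_derog by (rule derog_phi[OF ij])
    ultimately show ?thesis using assms(2) by (simp flip: cembed_phi)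
  qed
  ultimately have "f (phi i j (\<gamma> \<i>)) = 0" by (rule range_poly_real_zeros)
  moreover have "\<gamma> \<i> = S" by (simp add: vec_eq_iff \<gamma>_def complex_eq_iff)
  ultimately show ?thesis using S by simp
qed

lemma XC_eq: "XC = zclosure derog"
proof
  show "XC \<subseteq> zclosure derog" unfolding XC_def by (rule zclosure_mono[OF cembed_CDelta_subset])
  show "zclosure derog \<subseteq> XC"
  proof
    fix x :: "complex^'n^'n" assume x: "x \<in> zclosure derog"
    show "x \<in> XC" unfolding XC_def
    proof (rule zclosureI)
      show "x \<in> csym" using zclosure_sym[OF x] by (simp add: csym_def)
      fix p :: "complex^'n^'n \<Rightarrow> complex" assume p: "p \<in> cpolys" and v: "\<And>y. y \<in> cembed ` CDelta \<Longrightarrow> p y = 0"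
      show "p x = 0" by (rule zclosureD[OF x p], rule vanish_derog[OF p v]) auto
    qed
  qed
qed

lemma derog_subset_XC: "derog \<subseteq> XC"
  unfolding XC_eq by (rule subset_zclosure[OF derog_csym])

section \<open>Equations of the variety\<close>

text \<open>This is g(y) z for the monic polynomial g with root list \<open>rs\<close>. Listing the
  roots makes the values of g at eigenvalues explicit products.\<close>

primrec facprod :: "'a::field list \<Rightarrow> 'a^'n^'n \<Rightarrow> 'a^'n \<Rightarrow> 'a^'n" where
  "facprod [] y z = z"
| "facprod (r # rs) y z = (y - mat r) *v facprod rs y z"

definition dmat :: "'a::field^'n \<Rightarrow> 'a^'n^'n" where
  "dmat m = (\<chi> i j. if i = j then m$i else 0)"

lemma dmat_nth: "dmat m $ i $ j = (if i = j then m$i else 0)"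
  by (simp add: dmat_def)

lemma transpose_dmat: "transpose (dmat m) = dmat m"
  by (simp add: vec_eq_iff dmat_nth)

lemma dmat_mult_nth: "(dmat m ** B) $ i $ j = m$i * B$i$j"
  by (simp add: matrix_matrix_mult_nth dmat_nth if_distrib [where f="\<lambda>x. x * _"] cong: if_cong)

lemma mult_dmat_nth: "(B ** dmat m) $ i $ j = B$i$j * m$j"
  by (simp add: matrix_matrix_mult_nth dmat_nth if_distrib [where f="\<lambda>x. _ * x"] cong: if_cong)

lemma dmat_mult_vec_nth: "(dmat m *v x) $ i = m$i * x$i"
  by (simp add: matrix_vector_mult_nth dmat_nth if_distrib [where f="\<lambda>x. x * _"] cong: if_cong)

lemma cpolys_facprod: "(\<lambda>y. facprod rs y z $ a) \<in> cpolys"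
proof (induction rs arbitrary: a)
  case (Cons r rs)
  then show ?case
    by (simp add: matrix_vector_mult_nth) (intro cpolys_intros)
qed (auto intro: cconst)

lemma facprod_eigenvector:
  assumes "transpose y = y" "y *v u = c *s u"
  shows "(\<Sum>l\<in>UNIV. u$l * facprod rs y z $ l) = (\<Prod>r\<leftarrow>rs. c - r) * (\<Sum>l\<in>UNIV. u$l * z$l)"
proof (induction rs)
  case (Cons r rs)
  have "transpose (y - mat r) = y - mat r" using assms by (simp add: transpose_diff)
  then have "(\<Sum>l\<in>UNIV. u$l * facprod (r # rs) y z $ l)
      = (\<Sum>l\<in>UNIV. facprod rs y z $ l * ((y - mat r) *v u)$l)"
    unfolding facprod.simps by (rule sum_symmetric_swap)
  also have "(y - mat r) *v u = (c - r) *s u"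
    using assms by (simp add: matrix_vector_mult_diff_rdistrib mat_mult_vec vector_sub_rdistrib)
  also have "(\<Sum>l\<in>UNIV. facprod rs y z $ l * ((c - r) *s u)$l) = (c - r) * (\<Sum>l\<in>UNIV. u$l * facprod rs y z $ l)"
    unfolding sum_distrib_left by (simp only: vector_smult_component mult_ac)
  finally show ?case using Cons by (simp add: mult.assoc)
qed simp

lemma facprod_dmat: "facprod rs (dmat m) z $ a = (\<Prod>r\<leftarrow>rs. m$a - r) * z$a"
proof (induction rs)
  case (Cons r rs)
  then show ?case
    by (simp add: matrix_vector_mult_diff_rdistrib mat_mult_vec dmat_mult_vec_nth algebra_simps)
qed simp

text \<open>A two-dimensional eigenspace contains a nonzero vector orthogonal to \<open>z\<close>, which annihilates
  every column \<open>g y z\<close> with \<open>g\<close> a polynomial.\<close>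

lemma facprod_det_derog:
  fixes y :: "'a::field^'n^'n"
  assumes "y \<in> derog"
  shows "det (\<chi> l k. facprod (rs k) y z $ l) = 0"
proof -
  obtain c u w where sym: "transpose y = y" and ker: "(y - mat c) *v u = 0" "(y - mat c) *v w = 0"
    and u: "u \<noteq> 0" and ind: "\<And>d. w \<noteq> d *s u"
    using assms unfolding derog_def double_kernel_def by blast
  define s where "s x = (\<Sum>l\<in>UNIV. x$l * z$l)" for x :: "'a^'n"
  obtain a where a: "a \<noteq> 0" "(y - mat c) *v a = 0" "s a = 0"
  proof (cases "s u = 0")
    case True
    then show ?thesis using that u ker by blast
  next
    case False
    define a where "a = w - (s w / s u) *s u"
    have "s a = s w - (s w / s u) * s u"
      by (simp add: s_def a_def sum_subtractf left_diff_distrib sum_distrib_left mult.assoc)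
    then have "s a = 0" using False by simp
    moreover have "(y - mat c) *v a = 0"
      using ker by (simp add: a_def matrix_vector_mult_diff_distrib vector_scalar_commute)
    moreover have "a \<noteq> 0" using ind by (simp add: a_def)
    ultimately show ?thesis using that by blast
  qed
  have "y *v a = c *s a" using a(2) by (simp add: matrix_vector_mult_diff_rdistrib mat_mult_vec)
  from facprod_eigenvector[OF sym this] a(3)
  have "(\<Sum>l\<in>UNIV. a$l * facprod (rs k) y z $ l) = 0" for k by (simp add: s_def)
  then show ?thesis by (intro det_eq_0_if_left_kernel[OF a(1)]) simp
qed

lemma cpolys_facprod_det: "(\<lambda>y. det (\<chi> l k. facprod (rs k) y z $ l)) \<in> cpolys"
  by (rule cpolys_det) (simp add: cpolys_facprod)

lemma facprod_det_XC: "y \<in> XC \<Longrightarrow> det (\<chi> l k. facprod (rs k) y z $ l) = 0"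
  unfolding XC_eq by (erule zclosureD[OF _ cpolys_facprod_det facprod_det_derog])

text \<open>Interpolation: if the m_k are distinct, let g_k have all of them except m_k as roots.
  With z the all-ones vector the matrix with columns g_k(y) z is diagonal with nonzero diagonal,
  although its determinant vanishes on \<open>XC\<close>.\<close>

lemma XC_diag_repeated:
  fixes m :: "complex^'n"
  assumes "dmat m \<in> XC"
  shows "\<exists>i j. i \<noteq> j \<and> m$i = m$j"
proof (rule ccontr)
  assume "\<not> ?thesis"
  then have inj: "m$k \<noteq> m$l" if "k \<noteq> l" for k l using that by blast
  have "\<exists>ls. set ls = UNIV - {k}" for k :: 'n by (intro finite_list) simp
  then obtain ls where ls: "\<And>k::'n. set (ls k) = UNIV - {k}" by metis
  define F where "F = (\<chi> l k. facprod (map (($) m) (ls k)) (dmat m) (\<chi> a. 1) $ l)"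
  have F: "F$l$k = (\<Prod>r\<leftarrow>ls k. m$l - m$r)" for l k
    by (simp add: F_def facprod_dmat comp_def)
  have "det F = (\<Prod>k\<in>UNIV. F$k$k)"
  proof (rule det_diagonal)
    fix l k :: 'n assume "l \<noteq> k"
    then show "F$l$k = 0" unfolding F by (auto simp: prod_list_zero_iff ls)
  qed
  also have "\<dots> \<noteq> 0" unfolding F by (use inj in \<open>force simp: prod_list_zero_iff ls\<close>)
  finally show False using facprod_det_XC[OF assms] by (simp add: F_def)
qed

section \<open>Tangent spaces\<close>

lemma cscale_nth [simp]: "cscale t M $ a $ b = t * M$a$b"
  by (simp add: cscale_def)

lemma cscale_0 [simp]: "cscale 0 v = 0" and cscale_zero [simp]: "cscale t 0 = 0"
  by (simp_all add: vec_eq_iff)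

lemma ztangentD:
  assumes "v \<in> ztangent X x" "p \<in> cpolys" "\<And>y. y \<in> X \<Longrightarrow> p y = 0"
  shows "((\<lambda>t. p (x + cscale t v)) has_field_derivative 0) (at 0)"
  using assms by (simp add: ztangent_def)

lemma ztangent_det_derivative:
  assumes "v \<in> ztangent XC x"
    "\<And>t. det (\<chi> l k. facprod (rs k) (x + cscale t v) z $ l) = t * D t" "D \<in> range poly"
  shows "D 0 = 0"
proof -
  have "((\<lambda>t. t * D t) has_field_derivative 0) (at 0)"
    unfolding assms(2)[symmetric] by (rule ztangentD[OF assms(1) cpolys_facprod_det facprod_det_XC])
  moreover obtain q where "\<And>t. D t = poly q t" using range_polyE[OF assms(3)] by blast
  then have "((\<lambda>t. t * D t) has_field_derivative D 0) (at 0)"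
    by (auto intro!: derivative_eq_intros)
  ultimately show ?thesis using DERIV_unique by blast
qed

text \<open>For k other than j let g_k have the roots m_l with l outside {k, j}, and let g_j be g_i
  times the factor with root m_i. At t = 0 column j is then 0, the columns off i and j are diagonal,
  and column i lives in rows i and j. After division of column j by t, the determinant at 0 is, up
  to a nonzero factor, the 2 by 2 minor in rows and columns i, j; its vanishing is the
  relation.\<close>

lemma ztangent_diag_relation:
  assumes ij: "i \<noteq> j" "m$i = m$j"
    and simple: "\<And>k l. k \<noteq> l \<Longrightarrow> m$k = m$l \<Longrightarrow> {k,l} = {i,j}"
    and v: "v \<in> ztangent XC (dmat m)" and z: "\<And>a. z$a \<noteq> 0"
  shows "z$j * (v$i$i * z$i + v$i$j * z$j) = z$i * (v$j$i * z$i + v$j$j * z$j)"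
proof -
  have "\<exists>ls. set ls = UNIV - {k,j}" for k by (intro finite_list) simp
  then obtain ls where ls: "\<And>k. set (ls k) = UNIV - {k,j}" by metis
  \<comment> \<open>The extra root stands at the head, so its factor is applied last and column j is
    y - m_i applied to column i.\<close>
  define rs where "rs k = (if k = j then m$i # map (($) m) (ls i) else map (($) m) (ls k))" for k
  define G where "G t = (\<chi> a k. facprod (rs k) (dmat m + cscale t v) z $ a)" for t
  define r where "r t = facprod (map (($) m) (ls i)) (dmat m + cscale t v) z" for t
  have line: "(\<lambda>t. (dmat m + cscale t v) $ a $ b) \<in> range poly" for a b
    by (simp, intro range_poly_intros)
  have G_poly: "(\<lambda>t. G t $ a $ k) \<in> range poly" for a k
    unfolding G_def by (simp only: vec_lambda_beta, rule cpolys_curve[OF cpolys_facprod line])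
  have r_poly: "(\<lambda>t. r t $ a) \<in> range poly" for a
    unfolding r_def by (rule cpolys_curve[OF cpolys_facprod line])
  define c where "c a k = (\<Prod>l\<leftarrow>ls k. m$a - m$l)" for a k
  have c_0: "c a k = 0 \<longleftrightarrow> (\<exists>l. l \<noteq> k \<and> l \<noteq> j \<and> m$a = m$l)" for a k
    by (auto simp: c_def prod_list_zero_iff ls)
  have c_zero: "c a k = 0" if "k \<noteq> j" "a \<noteq> k" "\<not> (k = i \<and> a = j)" for a k
    unfolding c_0 using that ij by (cases "a = j") auto
  have c_nz: "c k k \<noteq> 0" if "k \<noteq> j" for k
    unfolding c_0 using simple that by (metis doubleton_eq_iff)
  have c_eq: "c j i = c i i" using ij by (simp add: c_def)
  have dm0: "dmat m + cscale 0 v = dmat m" by (simp add: vec_eq_iff)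
  have G0: "G 0 $ a $ k = c a k * z$a" if "k \<noteq> j" for a k
    using that unfolding G_def dm0 by (simp add: rs_def facprod_dmat c_def comp_def)
  have r0: "r 0 $ a = c a i * z$a" for a
    unfolding r_def dm0 by (simp add: facprod_dmat c_def comp_def)
  have Gj: "G t $ a $ j = (m$a - m$i) * r t $ a + t * (\<Sum>b\<in>UNIV. v$a$b * r t $ b)" for a t
  proof -
    have "G t $ a $ j = ((dmat m + cscale t v - mat (m$i)) *v r t) $ a"
      by (simp add: G_def rs_def r_def)
    moreover have "(cscale t v *v r t) $ a = t * (\<Sum>b\<in>UNIV. v$a$b * r t $ b)"
      by (simp add: matrix_vector_mult_nth sum_distrib_left mult.assoc)
    ultimately show ?thesis
      by (simp add: matrix_vector_mult_diff_rdistrib matrix_vector_mult_add_rdistrib mat_mult_vec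
          dmat_mult_vec_nth algebra_simps)
  qed
  \<comment> \<open>In rows i and j the factor m_a - m_i is 0 and the quotient by t is explicit; in
    the other rows the value at 0 is 0, and a root can be factored out.\<close>
  have "\<exists>h. h \<in> range poly \<and> (\<forall>t. G t $ a $ j = t * h t) \<and>
      (a \<in> {i,j} \<longrightarrow> h = (\<lambda>t. \<Sum>b\<in>UNIV. v$a$b * r t $ b))" for a
  proof (cases "a \<in> {i,j}")
    case True
    have "(\<lambda>t. \<Sum>b\<in>UNIV. v$a$b * r t $ b) \<in> range poly" by (intro range_poly_intros r_poly)
    then show ?thesis using Gj[of _ a] True ij
      by (intro exI[of _ "\<lambda>t. \<Sum>b\<in>UNIV. v$a$b * r t $ b"] conjI) auto
  next
    case False
    have "G 0 $ a $ j = 0" using Gj[of 0 a] r0[of a] c_zero[of i a] False ij by simp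
    then obtain h where "h \<in> range poly" "\<And>t. G t $ a $ j = t * h t"
      using range_poly_factor_root[OF G_poly[of a j]] by blast
    then show ?thesis using False by blast
  qed
  from choice[OF allI[OF this]] obtain h where
    "\<forall>a. h a \<in> range poly \<and> (\<forall>t. G t $ a $ j = t * h a t) \<and>
      (a \<in> {i,j} \<longrightarrow> h a = (\<lambda>t. \<Sum>b\<in>UNIV. v$a$b * r t $ b))" ..
  then have h: "\<And>a. h a \<in> range poly" "\<And>a t. G t $ a $ j = t * h a t"
    and hij: "\<And>a. a \<in> {i,j} \<Longrightarrow> h a = (\<lambda>t. \<Sum>b\<in>UNIV. v$a$b * r t $ b)"
    by (simp, simp, blast)
  define N where "N t = (\<chi> a k. if k = j then h a t else G t $ a $ k)" for t
  have "det (\<chi> l k. facprod (rs k) (dmat m + cscale t v) z $ l) = t * det (N t)" for t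
  proof -
    have "G t = (\<chi> a k. if k = j then t * h a t else G t $ a $ k)"
      unfolding vec_eq_iff by (simp add: h(2))
    then have "det (G t) = det (\<chi> a k. if k = j then t * h a t else G t $ a $ k)" by simp
    then show ?thesis unfolding det_col_mul N_def by (simp add: G_def)
  qed
  moreover have "(\<lambda>t. det (N t)) \<in> range poly"
    unfolding N_def by (rule range_poly_det) (simp only: vec_lambda_beta, intro range_poly_intros h G_poly)
  ultimately have "det (N 0) = 0" by (rule ztangent_det_derivative[OF v])
  \<comment> \<open>A kernel vector replaces the expansion of the determinant: rows other than j
    force w = 0 once w_j = 0, and rows i and j then give the minor by elimination of w_i.\<close>
  then obtain w where w: "w \<noteq> 0" "N 0 *v w = 0" using det_eq_0_iff_kernel by blast
  have row: "(if a = j then c j i * z$j * w$i else c a a * z$a * w$a) + h a 0 * w$j = 0" for a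
  proof -
    have "0 = (\<Sum>k\<in>UNIV. N 0 $ a $ k * w$k)"
      using w(2) by (simp add: vec_eq_iff matrix_vector_mult_nth)
    also have "\<dots> = (\<Sum>k\<in>UNIV-{j}. G 0 $ a $ k * w$k) + h a 0 * w$j"
      by (subst sum.remove[of UNIV j]) (auto simp: N_def)
    also have "(\<Sum>k\<in>UNIV-{j}. G 0 $ a $ k * w$k) = (\<Sum>k\<in>UNIV-{j}. c a k * z$a * w$k)"
      by (intro sum.cong) (auto simp: G0)
    also have "\<dots> = (\<Sum>k\<in>{if a = j then i else a}. c a k * z$a * w$k)"
      using ij by (intro sum.mono_neutral_right) (auto simp: c_zero split: if_splits)
    finally show ?thesis by auto
  qed
  have wj: "w$j \<noteq> 0"
  proof
    assume "w$j = 0"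
    then have "w$a = 0" for a using row[of a] c_nz[of a] z[of a] by (cases "a = j") auto
    then show False using w(1) by (simp add: vec_eq_iff)
  qed
  have hval: "h a 0 = c i i * (v$a$i * z$i + v$a$j * z$j)" if "a \<in> {i,j}" for a
  proof -
    have "h a 0 = (\<Sum>b\<in>UNIV. v$a$b * (c b i * z$b))" using hij[OF that] r0 by simp
    also have "\<dots> = (\<Sum>b\<in>{i,j}. v$a$b * (c b i * z$b))"
      using ij by (intro sum.mono_neutral_right) (auto simp: c_zero)
    also have "\<dots> = c i i * (v$a$i * z$i + v$a$j * z$j)"
      using ij by (simp add: c_eq algebra_simps)
    finally show ?thesis .
  qed
  have "c i i * z$i * w$i + h i 0 * w$j = 0" "c i i * z$j * w$i + h j 0 * w$j = 0"
    using row[of i] row[of j] ij c_eq by auto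
  then have "z$j * (c i i * z$i * w$i + h i 0 * w$j) - z$i * (c i i * z$j * w$i + h j 0 * w$j) = 0"
    by simp
  then have "(z$j * h i 0 - z$i * h j 0) * w$j = 0" by (simp add: algebra_simps)
  then have "z$j * h i 0 = z$i * h j 0" using wj by simp
  then have "c i i * (z$j * (v$i$i * z$i + v$i$j * z$j)) = c i i * (z$i * (v$j$i * z$i + v$j$j * z$j))"
    by (simp add: hval mult_ac)
  then show ?thesis using c_nz[of i] ij by simp
qed

text \<open>For symmetric v the relation reads z_i z_j (v_ii - v_jj) + (z_j^2 - z_i^2) v_ij = 0. The
  all-ones z gives the first equation, and z_i = 2 then isolates v_ij.\<close>

lemma ztangent_diag_subset:
  assumes "i \<noteq> j" "m$i = m$j" "\<And>k l. k \<noteq> l \<Longrightarrow> m$k = m$l \<Longrightarrow> {k,l} = {i,j}"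
    and v: "v \<in> ztangent XC (dmat m)"
  shows "v$i$i = v$j$j \<and> v$i$j = 0"
proof -
  have sym: "v$j$i = v$i$j" using v by (auto simp: ztangent_def csym_def) (metis transpose_nth)
  have "v$i$i = v$j$j"
    using ztangent_diag_relation[OF assms, of "\<chi> a. 1"] sym by (simp add: add.commute)
  moreover have "v$i$i * 2 + v$i$j = 2 * (v$j$i * 2 + v$j$j)"
    using ztangent_diag_relation[OF assms, of "\<chi> a. if a = i then 2 else 1"] assms(1) by simp
  ultimately show ?thesis using sym by simp
qed

section \<open>Velocities of matrix curves, and the tangent vectors they give\<close>

definition has_mderiv :: "(complex \<Rightarrow> complex^'n^'n) \<Rightarrow> complex^'n^'n \<Rightarrow> bool" where
  "has_mderiv \<gamma> v \<longleftrightarrow> (\<forall>a b. ((\<lambda>t. \<gamma> t $ a $ b) has_field_derivative v$a$b) (at 0))"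

lemma has_mderiv_mult:
  assumes "has_mderiv \<gamma> v" "has_mderiv \<delta> w"
  shows "has_mderiv (\<lambda>t. \<gamma> t ** \<delta> t) (v ** \<delta> 0 + \<gamma> 0 ** w)"
  unfolding has_mderiv_def
proof (intro allI)
  fix a b
  have "((\<lambda>t. \<Sum>k\<in>UNIV. \<gamma> t $ a $ k * \<delta> t $ k $ b) has_field_derivative
     (\<Sum>k\<in>UNIV. v$a$k * \<delta> 0 $ k $ b + w$k$b * \<gamma> 0 $ a $ k)) (at 0)"
    by (intro DERIV_sum DERIV_mult) (use assms in \<open>auto simp: has_mderiv_def\<close>)
  then show "((\<lambda>t. (\<gamma> t ** \<delta> t) $ a $ b) has_field_derivative (v ** \<delta> 0 + \<gamma> 0 ** w) $ a $ b) (at 0)"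
    by (simp add: matrix_matrix_mult_nth sum.distrib mult.commute)
qed

lemma has_mderiv_transpose: "has_mderiv \<gamma> v \<Longrightarrow> has_mderiv (\<lambda>t. transpose (\<gamma> t)) (transpose v)"
  by (simp add: has_mderiv_def)

lemma has_mderiv_add: "has_mderiv \<gamma> v \<Longrightarrow> has_mderiv \<delta> w \<Longrightarrow> has_mderiv (\<lambda>t. \<gamma> t + \<delta> t) (v + w)"
  by (simp add: has_mderiv_def DERIV_add)

lemma has_mderiv_line: "has_mderiv (\<lambda>t. x + cscale t v) v"
  by (auto simp: has_mderiv_def intro!: derivative_eq_intros)

lemma matrix_add_rdistrib: "(A + B) ** C = A ** C + B ** (C :: 'a::comm_ring_1^'n^'m)"
  by (simp add: vec_eq_iff matrix_matrix_mult_nth distrib_right sum.distrib)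

lemma matrix_sub_ldistrib: "A ** (B - C) = A ** B - A ** (C :: 'a::comm_ring_1^'n^'m)"
  by (simp add: vec_eq_iff matrix_matrix_mult_nth right_diff_distrib sum_subtractf)

lemma matrix_sub_rdistrib: "(A - B) ** C = A ** C - B ** (C :: 'a::comm_ring_1^'n^'m)"
  by (simp add: vec_eq_iff matrix_matrix_mult_nth left_diff_distrib sum_subtractf)

lemma gradient_curve_0:
  assumes "has_gradient p G" "has_mderiv \<gamma> v" "eventually (\<lambda>t. p (\<gamma> t) = 0) (nhds 0)"
  shows "(\<Sum>a\<in>UNIV. \<Sum>b\<in>UNIV. G a b (\<gamma> 0) * v$a$b) = 0"
proof -
  have "((\<lambda>t. p (\<gamma> t)) has_field_derivative (\<Sum>a\<in>UNIV. \<Sum>b\<in>UNIV. G a b (\<gamma> 0) * v$a$b)) (at 0)"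
    by (rule has_gradientD(2)[OF assms(1)]) (use assms(2) in \<open>simp add: has_mderiv_def\<close>)
  moreover have "((\<lambda>t. p (\<gamma> t)) has_field_derivative 0) (at 0)"
    using DERIV_cong_ev[OF refl assms(3) refl, of 0] by simp
  ultimately show ?thesis by (rule DERIV_unique)
qed

lemma ztangentI:
  fixes v :: "complex^'n^'n"
  assumes "v \<in> csym"
    "\<And>p G. p \<in> cpolys \<Longrightarrow> (\<And>y. y \<in> X \<Longrightarrow> p y = 0) \<Longrightarrow> has_gradient p G \<Longrightarrow>
       (\<Sum>a\<in>UNIV. \<Sum>b\<in>UNIV. G a b x * v$a$b) = 0"
  shows "v \<in> ztangent X x"
  unfolding ztangent_def
proof (intro CollectI conjI ballI impI)
  fix p :: "complex^'n^'n \<Rightarrow> complex" assume p: "p \<in> cpolys" "\<forall>y\<in>X. p y = 0"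
  obtain G where G: "has_gradient p G" using cpolys_gradient[OF p(1)] by blast
  have "((\<lambda>t. p (x + cscale t v)) has_field_derivative
     (\<Sum>a\<in>UNIV. \<Sum>b\<in>UNIV. G a b (x + cscale 0 v) * v$a$b)) (at 0)"
    by (rule has_gradientD(2)[OF G]) (use has_mderiv_line[of x v] in \<open>simp add: has_mderiv_def\<close>)
  then show "((\<lambda>t. p (x + cscale t v)) has_field_derivative 0) (at 0)"
    using assms(2)[OF p(1) _ G] p(2) by simp
qed (rule assms(1))

lemma ztangent_curve:
  assumes "v \<in> csym" "has_mderiv \<gamma> v" "eventually (\<lambda>t. \<gamma> t \<in> X) (nhds 0)"
  shows "v \<in> ztangent X (\<gamma> 0)"
proof (rule ztangentI[OF assms(1)])
  fix p G assume p: "\<And>y. y \<in> X \<Longrightarrow> p y = 0" and G: "has_gradient p G"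
  have "eventually (\<lambda>t. p (\<gamma> t) = 0) (nhds 0)"
    using assms(3) by (rule eventually_mono) (rule p)
  then show "(\<Sum>a\<in>UNIV. \<Sum>b\<in>UNIV. G a b (\<gamma> 0) * v$a$b) = 0"
    by (rule gradient_curve_0[OF G assms(2)])
qed

lemma det_line_nonzero:
  "eventually (\<lambda>t. det (mat 1 + cscale t S) \<noteq> 0) (nhds 0)"
proof -
  have "(\<lambda>t. det (mat 1 + cscale t S)) \<in> range poly"
    by (rule range_poly_det) (simp, intro range_poly_intros)
  then show ?thesis by (rule range_poly_eventually_nz) simp
qed

lemma double_kernel_zero_rows:
  fixes K :: "'a::field^'n^'n"
  assumes "i \<noteq> j" "\<And>k l. l \<in> {i,j} \<Longrightarrow> K$k$l = 0"
  shows "double_kernel K"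
  unfolding double_kernel_def
proof (intro exI conjI allI)
  have ax: "K *v axis l 1 = 0" if "l \<in> {i,j}" for l
    using assms(2)[OF that]
    by (simp add: vec_eq_iff matrix_vector_mult_nth axis_def if_distrib [where f="\<lambda>x. _ * x"] cong: if_cong)
  show "K *v axis i 1 = 0" "K *v axis j 1 = 0" by (simp_all add: ax)
  show "axis i 1 \<noteq> (0::'a^'n)" by (simp add: axis_eq_0_iff)
  fix c show "axis j 1 \<noteq> c *s (axis i 1 :: 'a^'n)"
  proof
    assume "axis j 1 = c *s (axis i 1 :: 'a^'n)"
    then have "(axis j 1 :: 'a^'n) $ j = (c *s axis i 1) $ j" by simp
    then show False using assms(1) by (simp add: axis_def)
  qed
qed

lemma dmat_derog:
  assumes "i \<noteq> j" "m$i = m$j" shows "dmat m \<in> derog"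
proof -
  have "double_kernel (dmat m - mat (m$i))"
    by (rule double_kernel_zero_rows[OF assms(1)]) (use assms(2) in \<open>auto simp: dmat_nth mat_def\<close>)
  then show ?thesis by (auto simp: derog_def transpose_dmat)
qed

text \<open>From right to left, v is the velocity of a curve c(t) + Q^T (K + t K') Q in
  \<open>derog\<close> with Q = 1 + t S: the scalar part carries v_ii, K' the block of v off i and
  j, and the congruence the mixed block.\<close>

lemma ztangent_diag:
  fixes m :: "complex^'n"
  assumes ij: "i \<noteq> j" "m$i = m$j"
    and simple: "\<And>k l. k \<noteq> l \<Longrightarrow> m$k = m$l \<Longrightarrow> {k,l} = {i,j}"
  shows "ztangent XC (dmat m) = {v \<in> csym. v$i$i = v$j$j \<and> v$i$j = 0}"
proof (rule set_eqI, rule iffI)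
  fix v assume "v \<in> ztangent XC (dmat m)"
  then show "v \<in> {v \<in> csym. v$i$i = v$j$j \<and> v$i$j = 0}"
    using ztangent_diag_subset[OF assms] by (auto simp: ztangent_def)
next
  fix v :: "complex^'n^'n" assume v: "v \<in> {v \<in> csym. v$i$i = v$j$j \<and> v$i$j = 0}"
  have vs: "v$a$b = v$b$a" for a b using v by (auto simp: csym_def) (metis transpose_nth)
  have nz: "m$k - m$i \<noteq> 0" if "k \<notin> {i,j}" for k
    using simple[of k i] that by (auto simp: doubleton_eq_iff)
  define K where "K = dmat m - mat (m$i)"
  \<comment> \<open>The scalar part contributes v_ii on the whole diagonal, hence the
    subtraction.\<close>
  define K' where "K' = (\<chi> k l. if k \<in> {i,j} \<or> l \<in> {i,j} then 0 else v$k$l - (if k = l then v$i$i else 0))"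
  \<comment> \<open>Solves the mixed block of S^T K + K S = v, where K is diagonal with entries m_k
    - m_i, nonzero off i and j by \<open>simple\<close>.\<close>
  define S where "S = (\<chi> k b. if k \<notin> {i,j} \<and> b \<in> {i,j} then v$k$b / (m$k - m$i) else 0)"
  define \<gamma> where "\<gamma> t = (mat (m$i) + cscale t (mat (v$i$i)))
     + transpose (mat 1 + cscale t S) ** (K + cscale t K') ** (mat 1 + cscale t S)" for t
  have Kd: "K = dmat (m - (\<chi> k. m$i))" by (simp add: K_def vec_eq_iff dmat_nth mat_def)
  have "has_mderiv \<gamma> (mat (v$i$i) + (((transpose S ** (K + cscale 0 K') + transpose (mat 1 + cscale 0 S) ** K') ** (mat 1 + cscale 0 S))
      + (transpose (mat 1 + cscale 0 S) ** (K + cscale 0 K')) ** S))"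
    unfolding \<gamma>_def
    by (intro has_mderiv_add has_mderiv_mult has_mderiv_transpose has_mderiv_line)
  also have "mat (v$i$i) + (((transpose S ** (K + cscale 0 K') + transpose (mat 1 + cscale 0 S) ** K') ** (mat 1 + cscale 0 S))
      + (transpose (mat 1 + cscale 0 S) ** (K + cscale 0 K')) ** S) = mat (v$i$i) + (transpose S ** K + K' + K ** S)"
    by simp
  also have "\<dots> = v"
  proof -
    have "(mat (v$i$i) + (transpose S ** K + K' + K ** S)) $ k $ l = v$k$l" for k l
    proof -
      have "(mat (v$i$i) + (transpose S ** K + K' + K ** S)) $ k $ l
        = (if k = l then v$i$i else 0) + (S$l$k * (m$l - m$i) + K'$k$l + (m$k - m$i) * S$k$l)"
        unfolding Kd by (simp add: mat_def dmat_mult_nth mult_dmat_nth)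
      also have "\<dots> = v$k$l"
        using nz[of k] nz[of l] v vs[of k l] vs[of j i] ij by (auto simp: S_def K'_def)
      finally show ?thesis .
    qed
    then show ?thesis by (simp add: vec_eq_iff)
  qed
  finally have deriv: "has_mderiv \<gamma> v" .
  have \<gamma>0: "\<gamma> 0 = dmat m" by (simp add: \<gamma>_def K_def)
  have "\<gamma> t \<in> derog" if "det (mat 1 + cscale t S) \<noteq> 0" for t
  proof -
    have "transpose (K + cscale t K') = K + cscale t K'"
      using vs by (auto simp: vec_eq_iff Kd dmat_nth K'_def)
    moreover have "double_kernel (K + cscale t K')"
      by (rule double_kernel_zero_rows[OF ij(1)]) (use ij in \<open>auto simp: Kd dmat_nth K'_def\<close>)
    moreover have c: "mat (m$i) + cscale t (mat (v$i$i)) = mat (m$i + t * v$i$i)"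
      by (simp add: vec_eq_iff mat_def)
    ultimately show ?thesis unfolding \<gamma>_def c by (intro derog_congruence that)
  qed
  then have "eventually (\<lambda>t. \<gamma> t \<in> XC) (nhds 0)"
    using det_line_nonzero[of S] derog_subset_XC by (auto elim!: eventually_mono)
  from ztangent_curve[OF _ deriv this] v show "v \<in> ztangent XC (dmat m)" by (simp add: \<gamma>0)
qed

text \<open>At a point c + K of \<open>derog\<close>, congruence by 1 + t S stays in
  \<open>derog\<close> for small t and has velocity S^T K + K S, the commutator since S is skew. For
  fixed p the pairing with the gradient is polynomial in the base point, so its vanishing passes
  from \<open>derog\<close> to \<open>XC\<close>.\<close>

lemma ztangent_commutator:
  fixes x :: "complex^'n^'n"
  assumes x: "x \<in> XC" and S: "transpose S = - S"
  shows "x ** S - S ** x \<in> ztangent XC x"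
proof (rule ztangentI)
  have "transpose x = x" using x unfolding XC_eq by (rule zclosure_sym)
  then show "x ** S - S ** x \<in> csym"
    by (simp add: csym_def transpose_diff matrix_transpose_mul S)
       (simp add: vec_eq_iff matrix_matrix_mult_nth sum_negf)
next
  fix p :: "complex^'n^'n \<Rightarrow> complex" and G
  assume p: "\<And>y. y \<in> XC \<Longrightarrow> p y = 0" and G: "has_gradient p G"
  have "(\<lambda>y::complex^'n^'n. \<Sum>a\<in>UNIV. \<Sum>b\<in>UNIV. G a b y * (y ** S - S ** y)$a$b) \<in> cpolys"
    by (simp add: matrix_matrix_mult_nth) (intro cpolys_intros has_gradientD(1)[OF G])
  then show "(\<Sum>a\<in>UNIV. \<Sum>b\<in>UNIV. G a b x * (x ** S - S ** x)$a$b) = 0"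
  proof (rule zclosureD[OF x[unfolded XC_eq]])
    fix y :: "complex^'n^'n" assume "y \<in> derog"
    then obtain c where sym: "transpose y = y" and dk: "double_kernel (y - mat c)"
      by (auto simp: derog_def)
    define K where "K = y - mat c"
    have Ks: "transpose K = K" using sym by (simp add: K_def transpose_diff)
    define \<gamma> where "\<gamma> t = (mat c + cscale t 0) + transpose (mat 1 + cscale t S) ** (K + cscale t 0) ** (mat 1 + cscale t S)" for t
    have "has_mderiv \<gamma> (0 + (((transpose S ** (K + cscale 0 0) + transpose (mat 1 + cscale 0 S) ** 0) ** (mat 1 + cscale 0 S))
      + (transpose (mat 1 + cscale 0 S) ** (K + cscale 0 0)) ** S))"
      unfolding \<gamma>_def
      by (intro has_mderiv_add has_mderiv_mult has_mderiv_transpose has_mderiv_line)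
    then have "has_mderiv \<gamma> (transpose S ** K + K ** S)" by simp
    also have "transpose S ** K + K ** S = y ** S - S ** y"
      by (simp add: S K_def vec_eq_iff matrix_matrix_mult_nth sum_negf left_diff_distrib right_diff_distrib
          sum_subtractf mat_def if_distrib [where f="\<lambda>x. x * _"] if_distrib [where f="\<lambda>x. _ * x"] cong: if_cong)
    finally have deriv: "has_mderiv \<gamma> (y ** S - S ** y)" .
    have "\<gamma> t \<in> derog" if "det (mat 1 + cscale t S) \<noteq> 0" for t
    proof -
      show ?thesis using derog_congruence[OF Ks dk[folded K_def] that] by (simp add: \<gamma>_def)
    qed
    then have "eventually (\<lambda>t. p (\<gamma> t) = 0) (nhds 0)"
      using det_line_nonzero[of S] derog_subset_XC p by (auto elim!: eventually_mono)
    from gradient_curve_0[OF G deriv this]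
    show "(\<Sum>a\<in>UNIV. \<Sum>b\<in>UNIV. G a b y * (y ** S - S ** y)$a$b) = 0"
      by (simp add: \<gamma>_def K_def)
  qed
qed

section \<open>Orthogonal invariance\<close>

lemma derog_conj:
  fixes C :: "'a::field^'n^'n"
  assumes C: "transpose C ** C = mat 1" and y: "y \<in> derog"
  shows "transpose C ** y ** C \<in> derog"
proof -
  obtain c where sym: "transpose y = y" and dk: "double_kernel (y - mat c)"
    using y by (auto simp: derog_def)
  have "det C \<noteq> 0"
    by (metis C invertible_det_nz invertible_left_inverse)
  then have "mat c + transpose C ** (y - mat c) ** C \<in> derog"
    using sym dk by (intro derog_congruence) (auto simp: transpose_diff)
  also have "mat c + transpose C ** (y - mat c) ** C = transpose C ** y ** C"
  proof -
    have "transpose C ** mat c ** C = mat c"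
    proof -
      have "transpose C ** mat c = mat c ** transpose C"
        by (simp add: vec_eq_iff matrix_matrix_mult_nth mat_def if_distrib [where f="\<lambda>x. x * _"]
            if_distrib [where f="\<lambda>x. _ * x"] mult.commute cong: if_cong)
      then show ?thesis by (simp add: C flip: matrix_mul_assoc)
    qed
    then show ?thesis by (simp add: matrix_sub_ldistrib matrix_sub_rdistrib)
  qed
  finally show ?thesis .
qed

lemma XC_conj:
  fixes C :: "complex^'n^'n"
  assumes C: "transpose C ** C = mat 1" and x: "x \<in> XC"
  shows "transpose C ** x ** C \<in> XC"
  unfolding XC_eq
proof (rule zclosureI)
  have sym: "transpose x = x" using x unfolding XC_eq by (rule zclosure_sym)
  then show "transpose C ** x ** C \<in> csym"
    by (simp add: csym_def matrix_transpose_mul matrix_mul_assoc)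
  fix p :: "complex^'n^'n \<Rightarrow> complex" assume p: "p \<in> cpolys" "\<And>y. y \<in> derog \<Longrightarrow> p y = 0"
  have "(\<lambda>x. p (transpose C ** x ** C)) \<in> cpolys"
    by (rule cpolys_compose[OF p(1)]) (simp add: matrix_matrix_mult_nth, intro cpolys_intros)
  then show "p (transpose C ** x ** C) = 0"
  proof (rule zclosureD[OF x[unfolded XC_eq]])
    fix y :: "complex^'n^'n" assume "y \<in> derog"
    then show "p (transpose C ** y ** C) = 0" by (intro p(2) derog_conj[OF C])
  qed
qed

lemma ztangent_conj:
  fixes C :: "complex^'n^'n"
  assumes C: "transpose C ** C = mat 1" and v: "v \<in> ztangent XC x"
  shows "transpose C ** v ** C \<in> ztangent XC (transpose C ** x ** C)"
  unfolding ztangent_def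
proof (intro CollectI conjI ballI impI)
  show "transpose C ** v ** C \<in> csym"
    using v by (simp add: ztangent_def csym_def matrix_transpose_mul matrix_mul_assoc)
  fix p :: "complex^'n^'n \<Rightarrow> complex" assume p: "p \<in> cpolys" "\<forall>y\<in>XC. p y = 0"
  have "(\<lambda>x. p (transpose C ** x ** C)) \<in> cpolys"
    by (rule cpolys_compose[OF p(1)]) (simp add: matrix_matrix_mult_nth, intro cpolys_intros)
  then have "((\<lambda>t. p (transpose C ** (x + cscale t v) ** C)) has_field_derivative 0) (at 0)"
    by (rule ztangentD[OF v]) (use XC_conj[OF C] p(2) in blast)
  moreover have "transpose C ** (x + cscale t v) ** C = transpose C ** x ** C + cscale t (transpose C ** v ** C)" for t
  proof -
    have "transpose C ** cscale t v ** C = cscale t (transpose C ** v ** C)"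
      by (simp add: vec_eq_iff matrix_matrix_mult_nth sum_distrib_left sum_distrib_right mult_ac)
    then show ?thesis by (simp add: matrix_add_ldistrib matrix_add_rdistrib)
  qed
  ultimately show "((\<lambda>t. p (transpose C ** x ** C + cscale t (transpose C ** v ** C))) has_field_derivative 0) (at 0)"
    by simp
qed

lemma bilin_trace: "bilin A B = trace (transpose A ** B)"
  by (simp add: bilin_def trace_def matrix_matrix_mult_nth)

lemma bilin_conj:
  fixes C :: "complex^'n^'n"
  assumes "transpose C ** C = mat 1"
  shows "bilin A (transpose C ** B ** C) = bilin (C ** A ** transpose C) B"
proof -
  have "bilin A (transpose C ** B ** C) = trace ((transpose A ** transpose C ** B) ** C)"
    by (simp add: bilin_trace matrix_mul_assoc)
  also have "\<dots> = trace (C ** (transpose A ** transpose C ** B))" by (rule trace_mul_sym)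
  also have "\<dots> = bilin (C ** A ** transpose C) B"
    by (simp add: bilin_trace matrix_transpose_mul matrix_mul_assoc)
  finally show ?thesis .
qed

section \<open>Critical points\<close>

definition lam :: "complex^'n \<Rightarrow> 'n \<Rightarrow> 'n \<Rightarrow> complex^'n" where
  "lam l i j = (\<chi> k. if k = i \<or> k = j then (l$i + l$j) / 2 else l$k)"

lemma bilin_dmat: "bilin (dmat a) (dmat b) = (\<Sum>k\<in>UNIV. a$k * b$k)"
  by (simp add: bilin_trace trace_def transpose_dmat dmat_mult_nth dmat_nth)

lemma ztangent_dmat:
  assumes "i \<noteq> j" "m$i = m$j" "h$i = h$j"
  shows "dmat h \<in> ztangent XC (dmat m)"
proof -
  have "dmat m + cscale t (dmat h) \<in> XC" for t
  proof -
    have "dmat m + cscale t (dmat h) = dmat (\<chi> k. m$k + t * h$k)"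
      by (simp add: vec_eq_iff dmat_nth)
    then show ?thesis using dmat_derog[OF assms(1), of "\<chi> k. m$k + t * h$k"] assms derog_subset_XC by auto
  qed
  then have "dmat h \<in> ztangent XC (dmat m + cscale 0 (dmat h))"
    by (intro ztangent_curve has_mderiv_line) (simp_all add: csym_def transpose_dmat)
  then show ?thesis by simp
qed

lemma critical_diag:
  fixes l :: "complex^'n"
  assumes M: "M \<in> XC" and inj: "\<And>a b. a \<noteq> b \<Longrightarrow> l$a \<noteq> l$b"
    and crit: "\<And>v. v \<in> ztangent XC M \<Longrightarrow> bilin (dmat l - M) v = 0"
  shows "\<exists>i j. i \<noteq> j \<and> M = dmat (lam l i j)"
proof -
  have sym: "transpose M = M" using M unfolding XC_eq by (rule zclosure_sym)
  then have Ms: "M$a$b = M$b$a" for a b by (metis transpose_nth)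
  have off: "M$a$b = 0" if ab: "a \<noteq> b" for a b
  proof -
    \<comment> \<open>For this elementary skew matrix, orthogonality to M S - S M says that the
      commutator Z of W and M has equal entries at (a,b) and (b,a).\<close>
    define S :: "complex^'n^'n" where
      "S = (\<chi> x y. if x = a \<and> y = b then 1 else if x = b \<and> y = a then -1 else 0)"
    define W where "W = dmat l - M"
    define Z where "Z = W ** M - M ** W"
    have "transpose S = - S" using ab by (auto simp: S_def vec_eq_iff)
    from crit[OF ztangent_commutator[OF M this]] have "bilin W (M ** S - S ** M) = 0" by (simp add: W_def)
    moreover have "bilin W (M ** S - S ** M) = trace (W ** M ** S) - trace (W ** S ** M)"
      by (simp add: bilin_trace W_def transpose_diff transpose_dmat sym matrix_sub_ldistrib trace_sub matrix_mul_assoc)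
    moreover have "trace (W ** S ** M) = trace (M ** W ** S)"
      using trace_mul_sym[of "W ** S" M] by (simp add: matrix_mul_assoc)
    ultimately have "trace (Z ** S) = 0" by (simp add: Z_def matrix_sub_rdistrib trace_sub)
    moreover have "trace (Z ** S) = Z$b$a - Z$a$b"
    proof -
      have "Z$x$k * S$k$x = (if k = a then (if x = b then Z$x$k else 0) else 0)
          - (if k = b then (if x = a then Z$x$k else 0) else 0)" for x k
        using ab by (auto simp: S_def)
      then show ?thesis by (simp add: trace_def matrix_matrix_mult_nth sum_subtractf)
    qed
    \<comment> \<open>M commutes with itself, so only \<open>dmat l\<close> survives in Z. As M is
      symmetric, Z is antisymmetric, and equal entries must be 0.\<close>
    moreover have "Z$x$y = (l$x - l$y) * M$x$y" for x y
      by (simp add: Z_def W_def matrix_sub_ldistrib matrix_sub_rdistrib dmat_mult_nth mult_dmat_nth algebra_simps)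
    ultimately have "(l$b - l$a) * M$b$a - (l$a - l$b) * M$a$b = 0" by simp
    then have "2 * ((l$b - l$a) * M$a$b) = 0" using Ms[of b a] by (simp add: algebra_simps)
    then show ?thesis using inj[OF ab] by auto
  qed
  define m where "m = (\<chi> k. M$k$k)"
  have Mm: "M = dmat m" using off by (auto simp: vec_eq_iff dmat_nth m_def)
  obtain i j where ij: "i \<noteq> j" "m$i = m$j" using XC_diag_repeated M Mm by metis
  have rel: "(\<Sum>k\<in>UNIV. (l$k - m$k) * h$k) = 0" if "h$i = h$j" for h :: "complex^'n"
  proof -
    have "dmat l - dmat m = dmat (l - m)" by (simp add: vec_eq_iff dmat_nth)
    then show ?thesis
      using crit[of "dmat h"] ztangent_dmat[of i j m h] ij that by (simp add: Mm bilin_dmat)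
  qed
  \<comment> \<open>Test directions: a unit vector off {i,j} fixes m_k, and the indicator of {i,j}
    gives the average.\<close>
  have "l$k = m$k" if "k \<notin> {i,j}" for k
    using rel[of "\<chi> a. if a = k then 1 else 0"] that
    by (auto simp: if_distrib [where f="\<lambda>x. _ * x"] cong: if_cong)
  moreover have "(l$i - m$i) + (l$j - m$j) = 0"
  proof -
    have "(\<Sum>k\<in>UNIV. (l$k - m$k) * (if k \<in> {i,j} then 1 else 0)) = (\<Sum>k\<in>{i,j}. l$k - m$k)"
      by (intro sum.mono_neutral_cong_right) auto
    then show ?thesis using rel[of "\<chi> k. if k \<in> {i,j} then 1 else 0"] ij by simp
  qed
  then have "m$i = (l$i + l$j) / 2" using ij by (simp add: field_simps)
  ultimately have "m = lam l i j" using ij by (auto simp: vec_eq_iff lam_def)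
  then show ?thesis using ij Mm by blast
qed

lemma ED_critical_subset:
  fixes C :: "complex^'n^'n"
  assumes C: "transpose C ** C = mat 1" and inj: "\<And>a b. a \<noteq> b \<Longrightarrow> l$a \<noteq> l$b"
    and x: "x \<in> ED_critical (transpose C ** dmat l ** C)"
  shows "\<exists>i j. i \<noteq> j \<and> x = transpose C ** dmat (lam l i j) ** C"
proof -
  have C': "C ** transpose C = mat 1" using C matrix_left_right_inverse by blast
  define M where "M = C ** x ** transpose C"
  have xM: "x = transpose C ** M ** C"
    by (metis C M_def matrix_mul_assoc matrix_mul_lid matrix_mul_rid)
  have xX: "x \<in> XC" and crit: "\<And>v. v \<in> ztangent XC x \<Longrightarrow> bilin (transpose C ** dmat l ** C - x) v = 0"
    using x by (auto simp: ED_critical_def zsmooth_def)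
  have M: "M \<in> XC" using XC_conj[of "transpose C" x] C' xX by (simp add: M_def)
  have "bilin (dmat l - M) v = 0" if v: "v \<in> ztangent XC M" for v
  proof -
    have "bilin (transpose C ** dmat l ** C - x) (transpose C ** v ** C) = 0"
      using crit ztangent_conj[OF C v] by (simp add: xM)
    then have "bilin (C ** (transpose C ** (dmat l - M) ** C) ** transpose C) v = 0"
      by (simp add: bilin_conj[OF C] xM matrix_sub_ldistrib matrix_sub_rdistrib)
    moreover have "C ** (transpose C ** (dmat l - M) ** C) ** transpose C = dmat l - M"
      by (metis C' matrix_mul_assoc matrix_mul_lid matrix_mul_rid)
    ultimately show ?thesis by simp
  qed
  from critical_diag[OF M inj this] xM show ?thesis by auto
qed

section \<open>Chains of irreducible closed sets\<close>

text \<open>Elimination of one unknown per equation. Indexed families cover both uses: coefficients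
  of monomials on several charts, and iterates of a matrix on a vector.\<close>

lemma linear_relation:
  fixes B :: "'a \<Rightarrow> 't \<Rightarrow> 'c::field"
  assumes "finite T" "finite A" "card T < card A"
  shows "\<exists>c. (\<exists>a\<in>A. c a \<noteq> 0) \<and> (\<forall>\<tau>\<in>T. (\<Sum>a\<in>A. c a * B a \<tau>) = 0)"
  using assms
proof (induction T arbitrary: A B rule: finite_induct)
  case empty
  then have "A \<noteq> {}" by auto
  then show ?case by (auto intro!: exI[of _ "\<lambda>_. 1"])
next
  case (insert \<tau> T)
  show ?case
  proof (cases "\<forall>a\<in>A. B a \<tau> = 0")
    case True
    from insert.IH[of A B] insert.prems insert.hyps True show ?thesis by auto
  next
    case False
    then obtain a0 where a0: "a0 \<in> A" "B a0 \<tau> \<noteq> 0" by auto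
    define q where "q a = B a \<tau> / B a0 \<tau>" for a
    have "card T < card (A - {a0})" using insert.prems insert.hyps a0 by simp
    with insert.IH[of "A - {a0}" "\<lambda>a t. B a t - q a * B a0 t"] insert.prems
    obtain c where c: "\<exists>a\<in>A - {a0}. c a \<noteq> 0"
      "\<forall>t\<in>T. (\<Sum>a\<in>A - {a0}. c a * (B a t - q a * B a0 t)) = 0" by auto
    define c' where "c' a = (if a = a0 then - (\<Sum>a\<in>A - {a0}. c a * q a) else c a)" for a
    have split: "(\<Sum>a\<in>A. c' a * B a t) = (\<Sum>a\<in>A - {a0}. c a * (B a t - q a * B a0 t))" for t
    proof -
      have "(\<Sum>a\<in>A. c' a * B a t) = c' a0 * B a0 t + (\<Sum>a\<in>A - {a0}. c' a * B a t)"
        using a0 insert.prems by (subst sum.remove[of A a0]) auto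
      also have "(\<Sum>a\<in>A - {a0}. c' a * B a t) = (\<Sum>a\<in>A - {a0}. c a * B a t)"
        by (intro sum.cong) (auto simp: c'_def)
      finally show ?thesis
        by (simp add: c'_def right_diff_distrib sum_subtractf sum_distrib_right mult.assoc)
    qed
    have "\<exists>a\<in>A. c' a \<noteq> 0" using c(1) by (auto simp: c'_def)
    moreover have "(\<Sum>a\<in>A. c' a * B a t) = 0" if "t \<in> insert \<tau> T" for t
      using that c(2) a0 by (auto simp: split q_def)
    ultimately show ?thesis by blast
  qed
qed

text \<open>Bounding the exponent of each variable separately makes the monomials a product set of
  size (E+1)^|I|, and the bound adds up under products.\<close>

definition poly_box :: "'v set \<Rightarrow> nat \<Rightarrow> (('v \<Rightarrow> complex) \<Rightarrow> complex) set" where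
  "poly_box I E = {g. \<exists>b. g = (\<lambda>s. \<Sum>\<alpha>\<in>I \<rightarrow>\<^sub>E {..E}. b \<alpha> * (\<Prod>v\<in>I. s v ^ \<alpha> v))}"

lemma poly_box_monom:
  assumes "finite I" "\<And>v. v \<in> I \<Longrightarrow> \<alpha> v \<le> E"
  shows "(\<lambda>s. c * (\<Prod>v\<in>I. s v ^ \<alpha> v)) \<in> poly_box I E"
proof -
  have mem: "restrict \<alpha> I \<in> I \<rightarrow>\<^sub>E {..E}" using assms by auto
  have fin: "finite (I \<rightarrow>\<^sub>E {..E})" using assms by (intro finite_PiE) auto
  have "(\<Sum>\<beta>\<in>I \<rightarrow>\<^sub>E {..E}. (if \<beta> = restrict \<alpha> I then c else 0) * (\<Prod>v\<in>I. s v ^ \<beta> v))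
     = c * (\<Prod>v\<in>I. s v ^ \<alpha> v)" for s
    using mem fin by (simp add: if_distrib [where f="\<lambda>x. x * _"] cong: if_cong)
  then show ?thesis unfolding poly_box_def by (intro CollectI exI[of _ "\<lambda>\<beta>. if \<beta> = restrict \<alpha> I then c else 0"]) simp
qed

lemma poly_box_add:
  assumes "f \<in> poly_box I E" "g \<in> poly_box I E"
  shows "(\<lambda>s. f s + g s) \<in> poly_box I E"
proof -
  obtain b b' where "f = (\<lambda>s. \<Sum>\<alpha>\<in>I \<rightarrow>\<^sub>E {..E}. b \<alpha> * (\<Prod>v\<in>I. s v ^ \<alpha> v))"
    "g = (\<lambda>s. \<Sum>\<alpha>\<in>I \<rightarrow>\<^sub>E {..E}. b' \<alpha> * (\<Prod>v\<in>I. s v ^ \<alpha> v))"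
    using assms unfolding poly_box_def by blast
  then show ?thesis unfolding poly_box_def
    by (intro CollectI exI[of _ "\<lambda>\<alpha>. b \<alpha> + b' \<alpha>"]) (simp add: distrib_right sum.distrib)
qed

lemma poly_box_const: "finite I \<Longrightarrow> (\<lambda>s. c) \<in> poly_box I E"
  using poly_box_monom[of I "\<lambda>_. 0" E c] by simp

lemma poly_box_sum:
  assumes "finite I" "\<And>a. a \<in> A \<Longrightarrow> f a \<in> poly_box I E"
  shows "(\<lambda>s. \<Sum>a\<in>A. f a s) \<in> poly_box I E"
  using assms by (induction A rule: infinite_finite_induct) (auto intro!: poly_box_const poly_box_add)

lemma poly_box_mult:
  assumes "finite I" "f \<in> poly_box I E" "g \<in> poly_box I E'"
  shows "(\<lambda>s. f s * g s) \<in> poly_box I (E + E')"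
proof -
  obtain b b' where f: "f = (\<lambda>s. \<Sum>\<alpha>\<in>I \<rightarrow>\<^sub>E {..E}. b \<alpha> * (\<Prod>v\<in>I. s v ^ \<alpha> v))"
    and g: "g = (\<lambda>s. \<Sum>\<alpha>\<in>I \<rightarrow>\<^sub>E {..E'}. b' \<alpha> * (\<Prod>v\<in>I. s v ^ \<alpha> v))"
    using assms unfolding poly_box_def by blast
  have "(\<lambda>s. \<Sum>\<alpha>\<in>I \<rightarrow>\<^sub>E {..E}. \<Sum>\<beta>\<in>I \<rightarrow>\<^sub>E {..E'}.
     (b \<alpha> * b' \<beta>) * (\<Prod>v\<in>I. s v ^ (\<alpha> v + \<beta> v))) \<in> poly_box I (E + E')"
  proof (intro poly_box_sum poly_box_monom assms(1))
    fix \<alpha> \<beta> v assume "\<alpha> \<in> I \<rightarrow>\<^sub>E {..E}" "\<beta> \<in> I \<rightarrow>\<^sub>E {..E'}" "v \<in> I"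
    then have "\<alpha> v \<in> {..E}" "\<beta> v \<in> {..E'}" by (auto simp only: PiE_mem)
    then show "\<alpha> v + \<beta> v \<le> E + E'" by simp
  qed
  also have "(\<lambda>s. \<Sum>\<alpha>\<in>I \<rightarrow>\<^sub>E {..E}. \<Sum>\<beta>\<in>I \<rightarrow>\<^sub>E {..E'}.
     (b \<alpha> * b' \<beta>) * (\<Prod>v\<in>I. s v ^ (\<alpha> v + \<beta> v))) = (\<lambda>s. f s * g s)"
    unfolding f g sum_product by (simp add: power_add prod.distrib mult_ac)
  finally show ?thesis .
qed

lemma poly_box_mono:
  assumes "finite I" "f \<in> poly_box I E" "E \<le> E'"
  shows "f \<in> poly_box I E'"
  using poly_box_mult[OF assms(1,2) poly_box_const[OF assms(1), of 1 "E' - E"]] assms(3) by simp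

lemma poly_box_var:
  assumes "finite I" "v \<in> I" shows "(\<lambda>s. s v) \<in> poly_box I 1"
proof -
  have "(\<Prod>w\<in>I. s w ^ (if w = v then 1 else 0)) = s v" for s :: "'a \<Rightarrow> complex"
    using assms by (subst prod.remove[of I v]) (auto intro!: prod.neutral)
  then show ?thesis
    using poly_box_monom[OF assms(1), of "\<lambda>w. if w = v then 1 else 0" 1 1] by simp
qed

lemma poly_box_power:
  assumes "finite I" "f \<in> poly_box I E" shows "(\<lambda>s. f s ^ k) \<in> poly_box I (E * k)"
proof (induction k)
  case (Suc k)
  then show ?case using poly_box_mult[OF assms(1,2) Suc] by simp
qed (simp add: poly_box_const assms)

lemma poly_box_prod:
  assumes "finite I" "finite A" "\<And>a. a \<in> A \<Longrightarrow> f a \<in> poly_box I (e a)"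
  shows "(\<lambda>s. \<Prod>a\<in>A. f a s) \<in> poly_box I (\<Sum>a\<in>A. e a)"
  using assms(2,3)
proof (induction A rule: finite_induct)
  case (insert a A)
  then show ?case using poly_box_mult[OF assms(1), of "f a" "e a"] by simp
qed (simp add: poly_box_const assms)

definition poly_fun :: "'v set \<Rightarrow> (('v \<Rightarrow> complex) \<Rightarrow> complex) set" where
  "poly_fun I = (\<Union>E. poly_box I E)"

lemma poly_fun_const: "finite I \<Longrightarrow> (\<lambda>s. c) \<in> poly_fun I"
  by (auto simp: poly_fun_def poly_box_const)

lemma poly_fun_var: "finite I \<Longrightarrow> v \<in> I \<Longrightarrow> (\<lambda>s. s v) \<in> poly_fun I"
  using poly_box_var by (fastforce simp: poly_fun_def)

lemma poly_fun_if:
  "(P \<Longrightarrow> f \<in> poly_fun I) \<Longrightarrow> (\<not> P \<Longrightarrow> g \<in> poly_fun I) \<Longrightarrow> (\<lambda>s. if P then f s else g s) \<in> poly_fun I"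
  by (cases P) auto

lemma poly_fun_mult: "finite I \<Longrightarrow> f \<in> poly_fun I \<Longrightarrow> g \<in> poly_fun I \<Longrightarrow> (\<lambda>s. f s * g s) \<in> poly_fun I"
  unfolding poly_fun_def using poly_box_mult by blast

lemma poly_fun_add:
  assumes "finite I" "f \<in> poly_fun I" "g \<in> poly_fun I" shows "(\<lambda>s. f s + g s) \<in> poly_fun I"
proof -
  obtain E E' where "f \<in> poly_box I E" "g \<in> poly_box I E'" using assms by (auto simp: poly_fun_def)
  then have "f \<in> poly_box I (max E E')" "g \<in> poly_box I (max E E')"
    using poly_box_mono[OF assms(1)] by simp_all
  then show ?thesis unfolding poly_fun_def using poly_box_add by blast
qed

lemma poly_fun_sum:
  assumes "finite I" "\<And>a. a \<in> A \<Longrightarrow> f a \<in> poly_fun I"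
  shows "(\<lambda>s. \<Sum>a\<in>A. f a s) \<in> poly_fun I"
  using assms by (induction A rule: infinite_finite_induct) (auto intro!: poly_fun_const poly_fun_add)

section \<open>Algebraic independence along a chain\<close>

lemma zirreducible_domain:
  assumes Z: "zirreducible Z" and fg: "f \<in> cpolys" "g \<in> cpolys" "\<And>x. x \<in> Z \<Longrightarrow> f x * g x = 0"
  shows "(\<forall>x\<in>Z. f x = 0) \<or> (\<forall>x\<in>Z. g x = 0)"
proof -
  obtain P where P: "P \<subseteq> cpolys" "Z = {x \<in> csym. \<forall>p\<in>P. p x = 0}"
    using Z unfolding zirreducible_def zclosed_def by blast
  have "zclosed {x \<in> Z. h x = 0}" if "h \<in> cpolys" for h
    unfolding zclosed_def using P that by (intro exI[of _ "insert h P"]) auto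
  then have "zclosed {x \<in> Z. f x = 0}" "zclosed {x \<in> Z. g x = 0}" using fg by auto
  moreover have "Z = {x \<in> Z. f x = 0} \<union> {x \<in> Z. g x = 0}" using fg(3) by fastforce
  ultimately have "Z = {x \<in> Z. f x = 0} \<or> Z = {x \<in> Z. g x = 0}"
    using Z unfolding zirreducible_def by blast
  then show ?thesis by blast
qed

text \<open>On Z', where f = 0, only the constant term of the relation remains, and by
  \<open>lift\<close> it vanishes identically. The rest is f times a shorter relation, and f cancels
  because functions on the irreducible Z form a domain. In the application \<open>lift\<close> is
  the independence already known on Z'.\<close>

lemma power_sum_vanish:
  assumes Z: "zirreducible Z" and f: "f \<in> cpolys" "\<exists>x\<in>Z. f x \<noteq> 0"
    and Z': "Z' \<subseteq> Z" "\<And>x. x \<in> Z' \<Longrightarrow> f x = 0"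
    and G: "\<forall>r. G r \<in> cpolys" "\<forall>x\<in>Z. (\<Sum>r\<le>D. f x ^ r * G r x) = 0"
    and lift: "\<forall>r. (\<forall>x\<in>Z'. G r x = 0) \<longrightarrow> (\<forall>x. G r x = 0)"
  shows "\<forall>r\<le>D. \<forall>x. G r x = 0"
  using G lift
proof (induction D arbitrary: G)
  case 0
  then have "\<forall>x\<in>Z'. G 0 x = 0" using Z'(1) by auto
  then show ?case using 0(3) by simp
next
  case (Suc D)
  have step: "(\<Sum>r\<le>Suc D. f x ^ r * G r x) = G 0 x + f x * (\<Sum>r\<le>D. f x ^ r * G (Suc r) x)" for x
    by (simp add: sum.atMost_Suc_shift sum_distrib_left mult.assoc del: sum.atMost_Suc)
  have "\<forall>x\<in>Z'. G 0 x = 0"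
  proof
    fix x assume x: "x \<in> Z'"
    then have "(\<Sum>r\<le>Suc D. f x ^ r * G r x) = 0" using Suc.prems(2) Z'(1) by (meson subsetD)
    then show "G 0 x = 0" unfolding step using Z'(2)[OF x] by simp
  qed
  then have G0: "G 0 x = 0" for x using Suc.prems(3) by blast
  have "(\<forall>x\<in>Z. f x = 0) \<or> (\<forall>x\<in>Z. (\<Sum>r\<le>D. f x ^ r * G (Suc r) x) = 0)"
  proof (rule zirreducible_domain[OF Z f(1)])
    have "(\<lambda>x. f x ^ r) \<in> cpolys" for r by (induction r) (auto intro: cconst cmult f(1))
    moreover have "G r \<in> cpolys" for r using Suc.prems(1) by blast
    ultimately show "(\<lambda>x. \<Sum>r\<le>D. f x ^ r * G (Suc r) x) \<in> cpolys" by (intro cpolys_intros)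
    fix x assume "x \<in> Z"
    then have "(\<Sum>r\<le>Suc D. f x ^ r * G r x) = 0" using Suc.prems(2) by blast
    then show "f x * (\<Sum>r\<le>D. f x ^ r * G (Suc r) x) = 0" unfolding step G0 by simp
  qed
  then have "\<forall>x\<in>Z. (\<Sum>r\<le>D. f x ^ r * G (Suc r) x) = 0" using f(2) by blast
  then have IH: "\<forall>r\<le>D. \<forall>x. G (Suc r) x = 0"
    using Suc.IH[of "\<lambda>r. G (Suc r)"] Suc.prems(1,3) by blast
  show ?case
  proof (intro allI impI)
    fix r x assume "r \<le> Suc D"
    then show "G r x = 0" using G0 IH by (cases r) auto
  qed
qed

text \<open>Each step of the chain contributes a new variable: a relation on the larger set is
  sorted by powers of the new function, and the coefficients \<open>G r\<close> are polynomials in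
  the earlier functions, which are independent on the smaller set.\<close>

lemma chain_algebraic_independence:
  assumes "\<And>i. i \<le> k \<Longrightarrow> zirreducible (c i)"
    and "\<And>i. i < k \<Longrightarrow> c i \<subseteq> c (Suc i) \<and> f i \<in> cpolys \<and> (\<forall>x\<in>c i. f i x = 0) \<and> (\<exists>x\<in>c (Suc i). f i x \<noteq> 0)"
    and "\<And>x. x \<in> c k \<Longrightarrow> (\<Sum>\<alpha>\<in>{..<k} \<rightarrow>\<^sub>E {..D}. a \<alpha> * (\<Prod>i<k. f i x ^ \<alpha> i)) = 0"
    and "\<alpha> \<in> {..<k} \<rightarrow>\<^sub>E {..D::nat}"
  shows "a \<alpha> = 0"
  using assms
proof (induction k arbitrary: a \<alpha>)
  case 0
  obtain x where "x \<in> c 0" using 0(1)[of 0] by (auto simp: zirreducible_def)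
  from 0(3)[OF this] 0(4) show ?case by simp
next
  case (Suc k)
  define G where "G r x = (\<Sum>\<alpha>\<in>{..<k} \<rightarrow>\<^sub>E {..D}. a (\<alpha>(k := r)) * (\<Prod>i<k. f i x ^ \<alpha> i))" for r x
  have fk: "c k \<subseteq> c (Suc k)" "f k \<in> cpolys" "\<And>x. x \<in> c k \<Longrightarrow> f k x = 0" "\<exists>x\<in>c (Suc k). f k x \<noteq> 0"
    using Suc.prems(2)[of k] by auto
  have split: "(\<Sum>\<alpha>\<in>{..<Suc k} \<rightarrow>\<^sub>E {..D}. a \<alpha> * (\<Prod>i<Suc k. f i x ^ \<alpha> i)) = (\<Sum>r\<le>D. f k x ^ r * G r x)" for x
  proof -
    have "(\<Sum>\<alpha>\<in>{..<Suc k} \<rightarrow>\<^sub>E {..D}. a \<alpha> * (\<Prod>i<Suc k. f i x ^ \<alpha> i))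
      = (\<Sum>(r,\<alpha>)\<in>{..D} \<times> ({..<k} \<rightarrow>\<^sub>E {..D}). a (\<alpha>(k := r)) * (\<Prod>i<Suc k. f i x ^ (\<alpha>(k := r)) i))"
      unfolding lessThan_Suc PiE_insert_eq
      by (subst sum.reindex) (auto intro!: inj_combinator simp: case_prod_beta)
    also have "\<dots> = (\<Sum>r\<le>D. \<Sum>\<alpha>\<in>{..<k} \<rightarrow>\<^sub>E {..D}. a (\<alpha>(k := r)) * (\<Prod>i<Suc k. f i x ^ (\<alpha>(k := r)) i))"
      by (simp add: sum.cartesian_product)
    also have "\<dots> = (\<Sum>r\<le>D. f k x ^ r * G r x)"
    proof -
      have "(\<Prod>i<k. f i x ^ (\<alpha>(k := r)) i) = (\<Prod>i<k. f i x ^ \<alpha> i)" for \<alpha> r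
        by (intro prod.cong) auto
      then show ?thesis by (simp add: G_def sum_distrib_left mult_ac)
    qed
    finally show ?thesis .
  qed
  have coeff: "a (\<alpha>(k := r)) = 0" if "\<And>x. x \<in> c k \<Longrightarrow> G r x = 0" "\<alpha> \<in> {..<k} \<rightarrow>\<^sub>E {..D}" for \<alpha> r
  proof (rule Suc.IH[of "\<lambda>\<alpha>. a (\<alpha>(k := r))"])
    show "zirreducible (c i)" if "i \<le> k" for i by (rule Suc.prems(1)) (use that in simp)
    show "c i \<subseteq> c (Suc i) \<and> f i \<in> cpolys \<and> (\<forall>x\<in>c i. f i x = 0) \<and> (\<exists>x\<in>c (Suc i). f i x \<noteq> 0)"
      if "i < k" for i by (rule Suc.prems(2)) (use that in simp)
    show "(\<Sum>\<alpha>\<in>{..<k} \<rightarrow>\<^sub>E {..D}. a (\<alpha>(k := r)) * (\<Prod>i<k. f i x ^ \<alpha> i)) = 0" if "x \<in> c k" for x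
      using \<open>\<And>x. x \<in> c k \<Longrightarrow> G r x = 0\<close>[OF that] by (simp only: G_def)
  qed (rule that(2))
  have G0: "\<forall>r\<le>D. \<forall>x. G r x = 0"
  proof (rule power_sum_vanish[OF _ fk(2,4,1,3)])
    show "zirreducible (c (Suc k))" using Suc.prems(1) by simp
    have "(\<lambda>x. f i x ^ r) \<in> cpolys" if "i < k" for i r
      using Suc.prems(2)[of i] that by (induction r) (auto intro: cconst cmult)
    then show "\<forall>r. G r \<in> cpolys" unfolding G_def by (intro allI cpolys_intros) auto
    show "\<forall>x\<in>c (Suc k). (\<Sum>r\<le>D. f k x ^ r * G r x) = 0"
      using Suc.prems(3) unfolding split by blast
    show "\<forall>r. (\<forall>x\<in>c k. G r x = 0) \<longrightarrow> (\<forall>x. G r x = 0)"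
    proof (intro allI impI)
      fix r x assume "\<forall>x\<in>c k. G r x = 0"
      then have "a (\<alpha>(k := r)) = 0" if "\<alpha> \<in> {..<k} \<rightarrow>\<^sub>E {..D}" for \<alpha> using coeff that by blast
      then show "G r x = 0" unfolding G_def by (intro sum.neutral) simp
    qed
  qed
  have "\<alpha> k \<le> D" using Suc.prems(4) by auto
  moreover have "restrict \<alpha> {..<k} \<in> {..<k} \<rightarrow>\<^sub>E {..D}"
    unfolding restrict_PiE_iff using PiE_mem[OF Suc.prems(4)] by simp
  ultimately have "a ((restrict \<alpha> {..<k})(k := \<alpha> k)) = 0" using coeff[of "\<alpha> k"] G0 by blast
  moreover have "(restrict \<alpha> {..<k})(k := \<alpha> k) = \<alpha>"
    using Suc.prems(4) by (auto simp: fun_eq_iff PiE_def extensional_def)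
  ultimately show ?case by simp
qed

section \<open>The dimension of the variety\<close>

text \<open>Indexing the entries by the sets \<open>{a,b}\<close> makes symmetry automatic and the coordinates easy to count.\<close>

definition sm :: "('n set \<Rightarrow> 'a) \<Rightarrow> 'a^'n^'n" where
  "sm \<sigma> = (\<chi> a b. \<sigma> {a,b})"

lemma sm_nth [simp]: "sm \<sigma> $ a $ b = \<sigma> {a,b}"
  by (simp add: sm_def)

lemma transpose_sm: "transpose (sm \<sigma>) = sm \<sigma>"
  by (simp add: vec_eq_iff insert_commute)

lemma sm_exhaust:
  assumes "transpose S = S" obtains \<sigma> where "S = sm \<sigma>"
proof -
  define \<sigma> where "\<sigma> e = (let p = SOME p. e = {fst p, snd p} in S $ fst p $ snd p)" for e
  have "\<sigma> {a,b} = S$a$b" for a b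
  proof -
    define p where "p = (SOME p. {a,b} = {fst p, snd p})"
    have "\<exists>p. {a,b} = {fst p, snd p}" by (intro exI[of _ "(a,b)"]) simp
    then have "{a,b} = {fst p, snd p}" unfolding p_def by (rule someI_ex)
    then have "fst p = a \<and> snd p = b \<or> fst p = b \<and> snd p = a" by (auto simp: doubleton_eq_iff)
    moreover have "S$a$b = S$b$a" using assms by (metis transpose_nth)
    ultimately show ?thesis by (auto simp: \<sigma>_def p_def[symmetric])
  qed
  then show ?thesis by (intro that[of \<sigma>]) (simp add: vec_eq_iff)
qed

definition params :: "'n \<Rightarrow> 'n \<Rightarrow> 'n::finite set set" where
  "params i j = {e. \<exists>a b. e = {a,b}} - {{j},{i,j}}"

text \<open>The subtraction truncates for \<open>CARD('n) = 1\<close>, where the variety is empty.\<close>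

definition dimX :: "'n::finite itself \<Rightarrow> nat" where
  "dimX _ = CARD('n) + (CARD('n) choose 2) - 2"

lemma finite_params [simp]: "finite (params i j)"
  by simp

lemma card_params:
  assumes "i \<noteq> (j::'n::finite)"
  shows "card (params i j) = dimX TYPE('n)"
proof -
  have eq: "{e::'n set. \<exists>a b. e = {a,b}} = {e. card e = 1} \<union> {e. card e = 2}"
  proof (rule set_eqI)
    fix e :: "'n set"
    have "(\<exists>a b. e = {a,b}) \<longleftrightarrow> (\<exists>a. e = {a}) \<or> (\<exists>a b. e = {a,b} \<and> a \<noteq> b)"
      by (metis insert_absorb2)
    then show "e \<in> {e. \<exists>a b. e = {a,b}} \<longleftrightarrow> e \<in> {e. card e = 1} \<union> {e. card e = 2}"
      by (auto simp: card_1_singleton_iff card_2_iff)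
  qed
  have "card {e::'n set. \<exists>a b. e = {a,b}} = CARD('n) + (CARD('n) choose 2)"
  proof -
    have "card {e::'n set. card e = k} = CARD('n) choose k" for k
      using n_subsets[of "UNIV::'n set" k] by simp
    then show ?thesis unfolding eq by (subst card_Un_disjoint) auto
  qed
  moreover have "{{j},{i,j}} \<subseteq> {e::'n set. \<exists>a b. e = {a,b}}" by auto
  moreover have "card {{j},{i,j}} = 2" using assms by (auto simp: doubleton_eq_iff)
  ultimately show ?thesis unfolding params_def dimX_def by (subst card_Diff_subset) auto
qed

lemma params_mem:
  assumes "i \<noteq> j"
  shows "{i} \<in> params i j" "a \<notin> {i,j} \<Longrightarrow> {i,a} \<in> params i j" "a \<notin> {i,j} \<Longrightarrow> {j,a} \<in> params i j"
    "a \<notin> {i,j} \<Longrightarrow> b \<notin> {i,j} \<Longrightarrow> {a,b} \<in> params i j"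
  using assms by (auto simp: params_def doubleton_eq_iff)

text \<open>The three roles of a parameter: the eigenvalue, a coordinate of a kernel vector, an
  entry of the block off i and j.\<close>

lemma params_cases:
  assumes "e \<in> params i j"
  shows "e = {i} \<or> (\<exists>a. a \<notin> {i,j} \<and> (e = {i,a} \<or> e = {j,a})) \<or> (\<exists>a b. a \<notin> {i,j} \<and> b \<notin> {i,j} \<and> e = {a,b})"
proof -
  obtain a b where e: "e = {a,b}" "e \<noteq> {j}" "e \<noteq> {i,j}" using assms by (auto simp: params_def)
  consider "a \<notin> {i,j}" "b \<notin> {i,j}" | "a \<in> {i,j}" "b \<notin> {i,j}" | "a \<notin> {i,j}" "b \<in> {i,j}" | "a \<in> {i,j}" "b \<in> {i,j}"
    by blast
  then show ?thesis
  proof cases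
    case 3
    then have "e = {b,a}" using e(1) by (simp add: insert_commute)
    then show ?thesis using 3 by blast
  next
    case 4
    then have "e = {i}" using e by (elim insertE) (simp_all add: insert_commute)
    then show ?thesis by blast
  qed (use e(1) in blast)+
qed

lemma poly_fun_phi:
  assumes ij: "i \<noteq> j" and f: "f \<in> cpolys"
  shows "(\<lambda>\<sigma>. f (phi i j (sm \<sigma>))) \<in> poly_fun (params i j)"
  using f
proof induction
  case (cconst c) then show ?case by (simp add: poly_fun_const)
next
  case (cadd p q) then show ?case by (simp add: poly_fun_add)
next
  case (cmult p q) then show ?case by (simp add: poly_fun_mult)
next
  case (ccoord a b)
  have P: "(\<lambda>\<sigma>. Pi_mat i j (sm \<sigma>) $ k $ a) \<in> poly_fun (params i j)" for k a
    unfolding Pi_mat_def vec_lambda_beta sm_nth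
    by (intro poly_fun_if poly_fun_const poly_fun_var finite_params params_mem[OF ij]) auto
  have entry: "(\<lambda>\<sigma>. Pi_mat i j (sm \<sigma>) $ k $ a * sm \<sigma> $ k $ l * Pi_mat i j (sm \<sigma>) $ l $ b) \<in> poly_fun (params i j)" for k l
  \<comment> \<open>A term with k or l in {i,j} contains an entry of a zero row of
    \<open>Pi_mat\<close>; hence the excluded indices {j} and {i,j} never occur.\<close>
  proof (cases "k \<in> {i,j} \<or> l \<in> {i,j}")
    case True
    then have "(\<lambda>\<sigma>. Pi_mat i j (sm \<sigma>) $ k $ a * sm \<sigma> $ k $ l * Pi_mat i j (sm \<sigma>) $ l $ b) = (\<lambda>\<sigma>. 0)"
      by (auto simp: Pi_mat_def)
    then show ?thesis by (rule ssubst) (rule poly_fun_const[OF finite_params])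
  next
    case False
    then have "(\<lambda>\<sigma>. sm \<sigma> $ k $ l) \<in> poly_fun (params i j)"
      using params_mem(4)[OF ij] by (auto intro!: poly_fun_var)
    then show ?thesis by (intro poly_fun_mult P finite_params)
  qed
  have "(\<lambda>\<sigma>. if a = b then sm \<sigma> $ i $ i else 0) \<in> poly_fun (params i j)"
    unfolding sm_nth
    using params_mem(1)[OF ij] by (intro poly_fun_if poly_fun_const poly_fun_var finite_params) auto
  then show ?case unfolding phi_nth by (intro poly_fun_add poly_fun_sum entry finite_params)
qed

text \<open>Functions separating a chain of length k have (D+1)^k products of powers with exponents
  up to D, independent on \<open>c k\<close>. On each chart they are combinations of at most a
  constant times (D+1)^N monomials, N being \<open>dimX\<close>. If k > N and D is large, one linear
  relation holds on all charts at once, hence on \<open>derog\<close> and on \<open>XC\<close>, a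
  contradiction.\<close>

lemma chain_length_bound:
  fixes c :: "nat \<Rightarrow> (complex^'n^'n) set"
  assumes irr: "\<And>i. i \<le> k \<Longrightarrow> zirreducible (c i)" and sub: "c k \<subseteq> XC"
    and strict: "\<And>i. i < k \<Longrightarrow> c i \<subset> c (Suc i)"
  shows "k \<le> dimX TYPE('n)"
proof (rule ccontr)
  let ?N = "dimX TYPE('n)"
  assume "\<not> k \<le> ?N"
  then have k: "Suc ?N \<le> k" "k > 0" by auto
  have "\<exists>f. f \<in> cpolys \<and> (\<forall>x\<in>c i. f x = 0) \<and> (\<exists>x\<in>c (Suc i). f x \<noteq> 0)" if i: "i < k" for i
  proof -
    obtain P where P: "P \<subseteq> cpolys" "c i = {x \<in> csym. \<forall>p\<in>P. p x = 0}"
      using irr[of i] i unfolding zirreducible_def zclosed_def by auto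
    obtain x where x: "x \<in> c (Suc i)" "x \<notin> c i" using strict[OF i] by blast
    have "x \<in> csym" using irr[of "Suc i"] i x unfolding zirreducible_def zclosed_def by auto
    then obtain p where "p \<in> P" "p x \<noteq> 0" using x P by blast
    then show ?thesis using P x by blast
  qed
  then have "\<forall>i. \<exists>f. i < k \<longrightarrow> f \<in> cpolys \<and> (\<forall>x\<in>c i. f x = 0) \<and> (\<exists>x\<in>c (Suc i). f x \<noteq> 0)" by blast
  from choice[OF this] obtain f where f: "\<And>i. i < k \<Longrightarrow> f i \<in> cpolys"
    "\<And>i. i < k \<Longrightarrow> (\<forall>x\<in>c i. f i x = 0) \<and> (\<exists>x\<in>c (Suc i). f i x \<noteq> 0)" by blast
  define Q where "Q = {p::'n \<times> 'n. fst p \<noteq> snd p}"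
  define \<Phi> where "\<Phi> p \<sigma> = phi (fst p) (snd p) (sm \<sigma> :: complex^'n^'n)" for p :: "'n \<times> 'n" and \<sigma>
  define J where "J p = params (fst p) (snd p)" for p :: "'n \<times> 'n"
  have finJ [simp]: "finite (J p)" for p by (simp add: J_def)
  have "\<exists>E. i < k \<longrightarrow> p \<in> Q \<longrightarrow> (\<lambda>\<sigma>. f i (\<Phi> p \<sigma>)) \<in> poly_box (J p) E" for i p
    using poly_fun_phi[of "fst p" "snd p" "f i"] f(1)[of i] unfolding Q_def \<Phi>_def J_def poly_fun_def by auto
  then have "\<forall>ip. \<exists>E. fst ip < k \<longrightarrow> snd ip \<in> Q \<longrightarrow> (\<lambda>\<sigma>. f (fst ip) (\<Phi> (snd ip) \<sigma>)) \<in> poly_box (J (snd ip)) E"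
    by blast
  from choice[OF this] obtain e where e: "\<And>i p. i < k \<Longrightarrow> p \<in> Q \<Longrightarrow> (\<lambda>\<sigma>. f i (\<Phi> p \<sigma>)) \<in> poly_box (J p) (e (i,p))"
    by auto
  \<comment> \<open>\<open>Suc\<close> keeps E positive, so that E * k is at least 1 in the count
    below.\<close>
  define E where "E = Suc (\<Sum>ip\<in>{..<k} \<times> Q. e ip)"
  have fE: "(\<lambda>\<sigma>. f i (\<Phi> p \<sigma>)) \<in> poly_box (J p) E" if "i < k" "p \<in> Q" for i p
  proof (rule poly_box_mono[OF _ e[OF that]])
    have "e (i,p) \<le> (\<Sum>ip\<in>{..<k} \<times> Q. e ip)" using that by (intro member_le_sum) auto
    then show "e (i,p) \<le> E" by (simp add: E_def)
  qed simp
  \<comment> \<open>F + 1 is at most E k (D+1), so the number of conditions is at most card Q (E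
    k)^N (D+1)^N. With this D it is D (D+1)^N, below (D+1)^(N+1).\<close>
  define D where "D = card Q * (E * k) ^ ?N"
  define A where "A = {..<k} \<rightarrow>\<^sub>E {..D}"
  define F where "F = E * (D * k)"
  define g where "g \<alpha> x = (\<Prod>i<k. f i x ^ \<alpha> i)" for \<alpha> x
  have gF: "(\<lambda>\<sigma>. g \<alpha> (\<Phi> p \<sigma>)) \<in> poly_box (J p) F" if "\<alpha> \<in> A" "p \<in> Q" for \<alpha> p
  proof (rule poly_box_mono)
    show "(\<lambda>\<sigma>. g \<alpha> (\<Phi> p \<sigma>)) \<in> poly_box (J p) (\<Sum>i<k. E * \<alpha> i)"
      unfolding g_def by (intro poly_box_prod poly_box_power fE[OF _ that(2)]) auto
    have "(\<Sum>i<k. E * \<alpha> i) \<le> (\<Sum>i<k. E * D)"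
      using that(1) by (intro sum_mono mult_left_mono) (auto simp: A_def PiE_iff)
    then show "(\<Sum>i<k. E * \<alpha> i) \<le> F" by (simp add: F_def mult_ac)
  qed simp
  then have "\<forall>\<alpha>p. \<exists>b. fst \<alpha>p \<in> A \<longrightarrow> snd \<alpha>p \<in> Q \<longrightarrow> (\<lambda>\<sigma>. g (fst \<alpha>p) (\<Phi> (snd \<alpha>p) \<sigma>))
     = (\<lambda>s. \<Sum>\<beta>\<in>J (snd \<alpha>p) \<rightarrow>\<^sub>E {..F}. b \<beta> * (\<Prod>v\<in>J (snd \<alpha>p). s v ^ \<beta> v))"
    unfolding poly_box_def by blast
  from choice[OF this] obtain b where b: "\<And>\<alpha> p. \<alpha> \<in> A \<Longrightarrow> p \<in> Q \<Longrightarrow> (\<lambda>\<sigma>. g \<alpha> (\<Phi> p \<sigma>))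
     = (\<lambda>s. \<Sum>\<beta>\<in>J p \<rightarrow>\<^sub>E {..F}. b (\<alpha>,p) \<beta> * (\<Prod>v\<in>J p. s v ^ \<beta> v))" by auto
  \<comment> \<open>One linear condition for each chart and each monomial on it.\<close>
  define T where "T = (SIGMA p:Q. J p \<rightarrow>\<^sub>E {..F})"
  have finT: "finite T" unfolding T_def by (intro finite_SigmaI finite_PiE) auto
  have "card T = (\<Sum>p\<in>Q. Suc F ^ ?N)"
    unfolding T_def by (subst card_SigmaI) (auto simp: card_PiE J_def Q_def card_params finite_PiE)
  also have "\<dots> = card Q * Suc F ^ ?N" by simp
  also have "\<dots> \<le> card Q * ((E * k) * Suc D) ^ ?N"
  proof -
    have "1 \<le> E * k" using k by (simp add: E_def)
    moreover have "(E * k) * Suc D = E * k + E * (D * k)" by (simp add: algebra_simps)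
    ultimately have "Suc F \<le> (E * k) * Suc D" unfolding F_def by linarith
    then show ?thesis by (intro mult_left_mono power_mono) auto
  qed
  also have "\<dots> = card Q * (E * k) ^ ?N * Suc D ^ ?N" by (simp only: power_mult_distrib mult.assoc)
  also have "\<dots> = D * Suc D ^ ?N" by (simp only: D_def[symmetric])
  also have "\<dots> < Suc D ^ Suc ?N" by simp
  also have "\<dots> \<le> Suc D ^ k" using k by (intro power_increasing) auto
  also have "\<dots> = card A" by (simp add: A_def card_PiE)
  finally have less: "card T < card A" .
  have "finite A" unfolding A_def by (intro finite_PiE) auto
  from linear_relation[OF finT this less, of "\<lambda>\<alpha> t. b (\<alpha>, fst t) (snd t)"]
  obtain a where a: "\<exists>\<alpha>\<in>A. a \<alpha> \<noteq> 0"
    "\<And>p \<beta>. (p,\<beta>) \<in> T \<Longrightarrow> (\<Sum>\<alpha>\<in>A. a \<alpha> * b (\<alpha>,p) \<beta>) = 0" by fastforce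
  have "(\<Sum>\<alpha>\<in>A. a \<alpha> * g \<alpha> x) = 0" if "x \<in> XC" for x
  proof (rule zclosureD[OF that[unfolded XC_eq]])
    have "(\<lambda>x. f i x ^ r) \<in> cpolys" if "i < k" for i r
      using f(1)[OF that] by (induction r) (auto intro: cconst cmult)
    then show "(\<lambda>x. \<Sum>\<alpha>\<in>A. a \<alpha> * g \<alpha> x) \<in> cpolys" unfolding g_def by (intro cpolys_intros) auto
    fix y :: "complex^'n^'n" assume "y \<in> derog"
    then obtain i j S where "i \<noteq> j" "transpose S = S" "y = phi i j S" by (rule derog_phi_exhaust)
    then obtain \<sigma> where y: "(i,j) \<in> Q" "y = \<Phi> (i,j) \<sigma>" unfolding Q_def \<Phi>_def by (auto elim: sm_exhaust)
    have "(\<Sum>\<alpha>\<in>A. a \<alpha> * g \<alpha> y)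
      = (\<Sum>\<alpha>\<in>A. a \<alpha> * (\<Sum>\<beta>\<in>J (i,j) \<rightarrow>\<^sub>E {..F}. b (\<alpha>,(i,j)) \<beta> * (\<Prod>v\<in>J (i,j). \<sigma> v ^ \<beta> v)))"
      using b[OF _ y(1), THEN fun_cong, of _ \<sigma>] by (intro sum.cong) (simp_all add: y(2))
    also have "\<dots> = (\<Sum>\<beta>\<in>J (i,j) \<rightarrow>\<^sub>E {..F}. (\<Sum>\<alpha>\<in>A. a \<alpha> * b (\<alpha>,(i,j)) \<beta>) * (\<Prod>v\<in>J (i,j). \<sigma> v ^ \<beta> v))"
      unfolding sum_distrib_left sum_distrib_right by (subst sum.swap) (simp add: mult.assoc)
    also have "\<dots> = 0" using a(2) y(1) by (intro sum.neutral) (simp add: T_def)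
    finally show "(\<Sum>\<alpha>\<in>A. a \<alpha> * g \<alpha> y) = 0" .
  qed
  then have zero: "(\<Sum>\<alpha>\<in>A. a \<alpha> * g \<alpha> x) = 0" if "x \<in> c k" for x using sub that by blast
  have "a \<alpha> = 0" if "\<alpha> \<in> A" for \<alpha>
  proof (rule chain_algebraic_independence[where k = k and c = c and f = f and D = D and a = a])
    show "c i \<subseteq> c (Suc i) \<and> f i \<in> cpolys \<and> (\<forall>x\<in>c i. f i x = 0) \<and> (\<exists>x\<in>c (Suc i). f i x \<noteq> 0)"
      if "i < k" for i using strict[OF that] f[OF that] by auto
  qed (use irr zero that in \<open>auto simp: A_def g_def\<close>)
  then show False using a(1) by blast
qed

section \<open>Irreducible slices of a chart, and a chain of full length\<close>

lemma zclosed_zclosure: "zclosed (zclosure S)"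
  unfolding zclosed_def
  by (intro exI[of _ "{p \<in> cpolys. \<forall>y\<in>S. p y = 0}"]) (auto simp: zclosure_def)

lemma zclosed_separate:
  assumes "zclosed Z" "x \<notin> Z" "x \<in> csym"
  obtains p where "p \<in> cpolys" "\<And>z. z \<in> Z \<Longrightarrow> p z = 0" "p x \<noteq> 0"
  using assms unfolding zclosed_def by blast

text \<open>If two closed pieces were proper, polynomials p and q vanishing on them would be nonzero
  at points a and b of Y. Along a polynomial curve in Y from a to b their product is 0, but
  one-variable polynomials have no zero divisors.\<close>

lemma zirreducible_zclosure:
  assumes ne: "Y \<noteq> {}" and sym: "Y \<subseteq> csym"
    and conn: "\<And>a b. a \<in> Y \<Longrightarrow> b \<in> Y \<Longrightarrow> \<exists>\<gamma>. (\<forall>k l. (\<lambda>t. \<gamma> t $ k $ l) \<in> range poly) \<and>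
       (\<forall>t. \<gamma> t \<in> Y) \<and> \<gamma> 0 = a \<and> \<gamma> 1 = b"
  shows "zirreducible (zclosure Y)"
  unfolding zirreducible_def
proof (intro conjI allI impI)
  show "zclosed (zclosure Y)" by (rule zclosed_zclosure)
  show "zclosure Y \<noteq> {}" using subset_zclosure[OF sym] ne by auto
  fix Z1 Z2 assume Z: "zclosed Z1 \<and> zclosed Z2 \<and> zclosure Y = Z1 \<union> Z2"
  have sep: "\<exists>p\<in>cpolys. (\<forall>z\<in>Z'. p z = 0) \<and> (\<exists>a\<in>Y. p a \<noteq> 0)"
    if "zclosed Z'" "Z' \<subseteq> zclosure Y" "zclosure Y \<noteq> Z'" for Z'
  proof -
    obtain x where x: "x \<in> zclosure Y" "x \<notin> Z'" using \<open>Z' \<subseteq> zclosure Y\<close> \<open>zclosure Y \<noteq> Z'\<close> by blast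
    then have "x \<in> csym" by (simp add: zclosure_def)
    then obtain p where p: "p \<in> cpolys" "\<And>z. z \<in> Z' \<Longrightarrow> p z = 0" "p x \<noteq> 0"
      using zclosed_separate[OF \<open>zclosed Z'\<close> x(2)] by metis
    moreover have "\<exists>a\<in>Y. p a \<noteq> 0" using zclosureD[OF x(1) p(1)] p(3) by blast
    ultimately show ?thesis by blast
  qed
  show "zclosure Y = Z1 \<or> zclosure Y = Z2"
  proof (rule ccontr)
    assume *: "\<not> (zclosure Y = Z1 \<or> zclosure Y = Z2)"
    have "\<exists>p\<in>cpolys. (\<forall>z\<in>Z1. p z = 0) \<and> (\<exists>a\<in>Y. p a \<noteq> 0)" by (rule sep) (use * Z in auto)
    then obtain p a where p: "p \<in> cpolys" "\<forall>z\<in>Z1. p z = 0" "a \<in> Y" "p a \<noteq> 0" by blast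
    have "\<exists>p\<in>cpolys. (\<forall>z\<in>Z2. p z = 0) \<and> (\<exists>a\<in>Y. p a \<noteq> 0)" by (rule sep) (use * Z in auto)
    then obtain q b where q: "q \<in> cpolys" "\<forall>z\<in>Z2. q z = 0" "b \<in> Y" "q b \<noteq> 0" by blast
    obtain \<gamma> where \<gamma>: "\<And>k l. (\<lambda>t. \<gamma> t $ k $ l) \<in> range poly" "\<And>t. \<gamma> t \<in> Y" "\<gamma> 0 = a" "\<gamma> 1 = b"
      using conn[OF p(3) q(3)] by blast
    have "p (\<gamma> t) * q (\<gamma> t) = 0" for t
      using \<gamma>(2)[of t] subset_zclosure[OF sym] Z p(2) q(2) by auto
    then have "(\<lambda>t. p (\<gamma> t)) = (\<lambda>t. 0) \<or> (\<lambda>t. q (\<gamma> t)) = (\<lambda>t. 0)"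
      by (intro range_poly_mult_eq_0 cpolys_curve[OF p(1)] cpolys_curve[OF q(1)] \<gamma>(1))
    then show False using p(4) q(4) \<gamma>(3,4) by (metis (no_types))
  qed
qed

lemma phi_nth_outer:
  assumes "a \<notin> {i,j}"
  shows "phi i j S $ x $ a = (if x = a then S$i$i else 0) + (\<Sum>k\<in>UNIV. Pi_mat i j S $ k $ x * S$k$a)"
proof -
  have "(\<Sum>l\<in>UNIV. \<Sum>k\<in>UNIV. Pi_mat i j S $ k $ x * S$k$l * Pi_mat i j S $ l $ a)
    = (\<Sum>l\<in>{a}. \<Sum>k\<in>UNIV. Pi_mat i j S $ k $ x * S$k$l * Pi_mat i j S $ l $ a)"
    using assms by (intro sum.mono_neutral_right) (auto simp: Pi_mat_def)
  also have "\<dots> = (\<Sum>k\<in>UNIV. Pi_mat i j S $ k $ x * S$k$a)"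
    using assms by (simp add: Pi_mat_def)
  finally show ?thesis by (simp add: phi_nth)
qed

lemma phi_nth_inner:
  assumes "a \<notin> {i,j}" "b \<notin> {i,j}"
  shows "phi i j S $ b $ a = (if b = a then S$i$i else 0) + S$b$a"
proof -
  have "(\<Sum>k\<in>UNIV. Pi_mat i j S $ k $ b * S$k$a) = (\<Sum>k\<in>{b}. Pi_mat i j S $ k $ b * S$k$a)"
    using assms by (intro sum.mono_neutral_right) (auto simp: Pi_mat_def)
  then show ?thesis using assms by (simp add: phi_nth_outer[OF assms(1)] Pi_mat_def)
qed

text \<open>When column a of the block off i and j is a unit vector, the kernel coordinate reappears
  unchanged as a matrix entry; \<open>base_param\<close> is chosen for this.\<close>

lemma phi_nth_mixed:
  assumes "i \<noteq> j" "a \<notin> {i,j}" "x \<in> {i,j}" "\<And>k. k \<notin> {i,j} \<Longrightarrow> S$k$a = (if k = a then 1 else 0)"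
  shows "phi i j S $ x $ a = S$x$a"
proof -
  have "(\<Sum>k\<in>UNIV. Pi_mat i j S $ k $ x * S$k$a) = (\<Sum>k\<in>{a}. Pi_mat i j S $ k $ x * S$k$a)"
    using assms(4) by (intro sum.mono_neutral_right) (auto simp: Pi_mat_def)
  then show ?thesis using assms by (auto simp: phi_nth_outer[OF assms(2)] Pi_mat_def)
qed

definition base_param :: "'n \<Rightarrow> 'n \<Rightarrow> 'n set \<Rightarrow> complex" where
  "base_param i j e = (if \<exists>a. a \<notin> {i,j} \<and> e = {a} then 1 else 0)"

definition phi_slice :: "'n::finite \<Rightarrow> 'n \<Rightarrow> 'n set set \<Rightarrow> (complex^'n^'n) set" where
  "phi_slice i j W = {phi i j (sm \<sigma>) |\<sigma>. \<forall>e\<in>params i j - W. \<sigma> e = base_param i j e}"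

lemma phi_sliceI:
  "(\<And>e. e \<in> params i j \<Longrightarrow> e \<notin> W \<Longrightarrow> \<sigma> e = base_param i j e) \<Longrightarrow> phi i j (sm \<sigma>) \<in> phi_slice i j W"
  unfolding phi_slice_def by blast

lemma phi_slice_derog: "i \<noteq> j \<Longrightarrow> phi_slice i j W \<subseteq> derog"
  unfolding phi_slice_def by (auto intro: derog_phi transpose_sm)

lemma zirreducible_phi_slice:
  assumes ij: "i \<noteq> j"
  shows "zirreducible (zclosure (phi_slice i j W))"
proof (rule zirreducible_zclosure)
  show "phi_slice i j W \<noteq> {}" unfolding phi_slice_def by blast
  show "phi_slice i j W \<subseteq> csym" using phi_slice_derog[OF ij] derog_csym by blast
  fix a b assume "a \<in> phi_slice i j W" "b \<in> phi_slice i j W"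
  then obtain \<sigma> \<tau> where \<sigma>: "a = phi i j (sm \<sigma>)" "\<forall>e\<in>params i j - W. \<sigma> e = base_param i j e"
    and \<tau>: "b = phi i j (sm \<tau>)" "\<forall>e\<in>params i j - W. \<tau> e = base_param i j e"
    unfolding phi_slice_def by blast
  let ?\<gamma> = "\<lambda>t. phi i j (sm (\<lambda>e. \<sigma> e + t * (\<tau> e - \<sigma> e)))"
  show "\<exists>\<gamma>. (\<forall>k l. (\<lambda>t. \<gamma> t $ k $ l) \<in> range poly) \<and> (\<forall>t. \<gamma> t \<in> phi_slice i j W) \<and> \<gamma> 0 = a \<and> \<gamma> 1 = b"
  proof (intro exI[of _ ?\<gamma>] conjI allI)
    show "(\<lambda>t. ?\<gamma> t $ k $ l) \<in> range poly" for k l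
      by (rule range_poly_phi) (simp, intro range_poly_intros)
    show "?\<gamma> t \<in> phi_slice i j W" for t
      by (rule phi_sliceI) (use \<sigma>(2) \<tau>(2) in auto)
  qed (simp_all add: \<sigma>(1) \<tau>(1))
qed

text \<open>The hypotheses prescribe an order in which each newly freed parameter is detected by a
  polynomial. A kernel coordinate is visible as an entry while the inner block is still the
  identity; an inner entry is visible while the eigenvalue is still 0; the eigenvalue comes last and
  is detected by the determinant, as all earlier points are singular.\<close>

lemma phi_slice_strict:
  assumes ij: "i \<noteq> j" and e: "e \<in> params i j" "e \<notin> W"
    and off_i: "e \<noteq> {i} \<Longrightarrow> {i} \<notin> W"
    and off_inner: "\<And>a. a \<notin> {i,j} \<Longrightarrow> e \<in> {{i,a},{j,a}} \<Longrightarrow>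
       (\<And>b c. b \<notin> {i,j} \<Longrightarrow> c \<notin> {i,j} \<Longrightarrow> {b,c} \<notin> W)"
    and all_else: "e = {i} \<Longrightarrow> params i j - {{i}} \<subseteq> W"
  shows "zclosure (phi_slice i j W) \<subset> zclosure (phi_slice i j (insert e W))"
proof -
  have base_e: "\<sigma> e = base_param i j e" if "\<forall>e\<in>params i j - W. \<sigma> e = base_param i j e" for \<sigma>
    using that e by blast
  have upd: "phi i j (sm ((base_param i j)(e := z))) \<in> phi_slice i j (insert e W)" for z
    by (rule phi_sliceI) auto
  have "\<exists>f. f \<in> cpolys \<and> (\<forall>y\<in>phi_slice i j W. f y = 0) \<and> (\<exists>y\<in>phi_slice i j (insert e W). f y \<noteq> 0)"
  proof -
    consider (last) "e = {i}" | (mixed) a x where "a \<notin> {i,j}" "x \<in> {i,j}" "e = {x,a}"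
      | (inner) a b where "a \<notin> {i,j}" "b \<notin> {i,j}" "e = {a,b}"
      using params_cases[OF e(1)] by blast
    then show ?thesis
    proof cases
      case last
      note ei = this
      show ?thesis
      proof (intro exI conjI ballI)
        show "(\<lambda>y. det y) \<in> (cpolys :: (complex^'a^'a \<Rightarrow> complex) set)" by (intro cpolys_det ccoord)
        fix y assume "y \<in> phi_slice i j W"
        then obtain \<sigma> where \<sigma>: "y = phi i j (sm \<sigma>)" "\<forall>e\<in>params i j - W. \<sigma> e = base_param i j e"
          unfolding phi_slice_def by blast
        have "\<sigma> {i} = 0" using base_e[OF \<sigma>(2)] by (auto simp: ei base_param_def)
        then have "double_kernel y" using double_kernel_phi[OF ij, of "sm \<sigma>"] by (simp add: \<sigma>(1))
        then show "det y = 0" unfolding double_kernel_def det_eq_0_iff_kernel by blast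
      next
        \<comment> \<open>Eigenvalue 1 and all else 0 gives the identity matrix, which lies in the
          slice because all other parameters are free by now.\<close>
        define \<sigma> where "\<sigma> e = (if e = {i} then 1 else 0 :: complex)" for e
        have zero: "Pi_mat i j (sm \<sigma>) $ k $ a * sm \<sigma> $ k $ l * Pi_mat i j (sm \<sigma>) $ l $ b = 0" for a b k l
          by (cases "k = i") (auto simp: \<sigma>_def Pi_mat_def)
        have "phi i j (sm \<sigma>) = mat 1"
          unfolding vec_eq_iff phi_nth zero by (simp add: mat_def \<sigma>_def)
        moreover have "phi i j (sm \<sigma>) \<in> phi_slice i j (insert e W)"
          by (rule phi_sliceI) (use all_else[OF ei] ei in auto)
        ultimately show "\<exists>y\<in>phi_slice i j (insert e W). det y \<noteq> 0" by force
      qed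
    next
      case (mixed a x)
      note a = mixed(1) and x = mixed(2,3)
      have b0: "base_param i j e = 0" using a x by (auto simp: base_param_def doubleton_eq_iff)
      have val: "phi i j (sm \<sigma>) $ x $ a = \<sigma> e"
        if "\<And>b. b \<notin> {i,j} \<Longrightarrow> \<sigma> {b,a} = base_param i j {b,a}" for \<sigma>
      proof -
        have "phi i j (sm \<sigma>) $ x $ a = sm \<sigma> $ x $ a"
          by (rule phi_nth_mixed[OF ij a x(1)]) (use that a in \<open>auto simp: base_param_def doubleton_eq_iff\<close>)
        then show ?thesis using x by simp
      qed
      show ?thesis
      proof (intro exI conjI ballI)
        show "(\<lambda>y. y $ x $ a) \<in> (cpolys :: (complex^'a^'a \<Rightarrow> complex) set)" by (rule ccoord)
        fix y assume "y \<in> phi_slice i j W"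
        then obtain \<sigma> where \<sigma>: "y = phi i j (sm \<sigma>)" "\<forall>e\<in>params i j - W. \<sigma> e = base_param i j e"
          unfolding phi_slice_def by blast
        have "y $ x $ a = \<sigma> e" unfolding \<sigma>(1)
        proof (rule val)
          fix b assume b: "b \<notin> {i,j}"
          have "{b,a} \<notin> W" by (rule off_inner[OF a _ b a]) (use x in auto)
          then show "\<sigma> {b,a} = base_param i j {b,a}" using \<sigma>(2) params_mem(4)[OF ij b a] by blast
        qed
        then show "y $ x $ a = 0" using base_e[OF \<sigma>(2)] b0 by simp
      next
        have "phi i j (sm ((base_param i j)(e := 1))) $ x $ a = ((base_param i j)(e := 1)) e"
          by (rule val) (use x a in \<open>auto simp: doubleton_eq_iff\<close>)
        then show "\<exists>y\<in>phi_slice i j (insert e W). y $ x $ a \<noteq> 0"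
          by (intro bexI[OF _ upd[of 1]]) simp
      qed
    next
      case (inner a b)
      note ab = this
      then have ei: "e \<noteq> {i}" by auto
      show ?thesis
      proof (intro exI conjI ballI)
        show "(\<lambda>y. y $ a $ b - base_param i j e) \<in> (cpolys :: (complex^'a^'a \<Rightarrow> complex) set)"
          by (intro cpolys_intros)
        fix y assume "y \<in> phi_slice i j W"
        then obtain \<sigma> where \<sigma>: "y = phi i j (sm \<sigma>)" "\<forall>e\<in>params i j - W. \<sigma> e = base_param i j e"
          unfolding phi_slice_def by blast
        have "\<sigma> {i} = 0" using \<sigma>(2) off_i[OF ei] params_mem(1)[OF ij] by (auto simp: base_param_def)
        then show "y $ a $ b - base_param i j e = 0"
          using base_e[OF \<sigma>(2)] ab by (simp add: \<sigma>(1) phi_nth_inner)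
      next
        have i0: "((base_param i j)(e := z)) {i} = 0" for z using ei by (auto simp: base_param_def)
        have "phi i j (sm ((base_param i j)(e := z))) $ a $ b = z" for z
          unfolding phi_nth_inner[OF ab(2,1)] sm_nth insert_absorb2 i0 by (simp add: ab(3))
        then show "\<exists>y\<in>phi_slice i j (insert e W). y $ a $ b - base_param i j e \<noteq> 0"
          by (intro bexI[OF _ upd[of "base_param i j e + 1"]]) simp
      qed
    qed
  qed
  then obtain f y where f: "f \<in> cpolys" "\<forall>y\<in>phi_slice i j W. f y = 0"
    "y \<in> phi_slice i j (insert e W)" "f y \<noteq> 0" by blast
  have "phi_slice i j W \<subseteq> phi_slice i j (insert e W)" unfolding phi_slice_def by blast
  then have "zclosure (phi_slice i j W) \<subseteq> zclosure (phi_slice i j (insert e W))" by (rule zclosure_mono)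
  moreover have "y \<in> zclosure (phi_slice i j (insert e W))"
    using subset_zclosure phi_slice_derog[OF ij] derog_csym f(3) by blast
  moreover have "y \<notin> zclosure (phi_slice i j W)" using zclosureD[OF _ f(1)] f(2,4) by blast
  ultimately show ?thesis by blast
qed

lemma phi_slice_chain:
  fixes i j :: "'n::finite"
  assumes ij: "i \<noteq> j"
  obtains c :: "nat \<Rightarrow> (complex^'n^'n) set" where
    "\<And>m. zirreducible (c m)" "\<And>m. m < dimX TYPE('n) \<Longrightarrow> c m \<subset> c (Suc m)"
    "c (dimX TYPE('n)) = zclosure (phi_slice i j (params i j))"
proof -
  define M where "M = {e \<in> params i j. \<exists>a. a \<notin> {i,j} \<and> e \<in> {{i,a},{j,a}}}"
  define I where "I = {e \<in> params i j. \<exists>a b. a \<notin> {i,j} \<and> b \<notin> {i,j} \<and> e = {a,b}}"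
  obtain ms where ms: "set ms = M" "distinct ms" using finite_distinct_list[of M] by auto
  obtain ns where ns: "set ns = I" "distinct ns" using finite_distinct_list[of I] by auto
  \<comment> \<open>Kernel coordinates, inner block, eigenvalue: the order that
    \<open>phi_slice_strict\<close> requires.\<close>
  define xs where "xs = ms @ ns @ [{i}]"
  have M: "e \<inter> {i,j} \<noteq> {} \<and> \<not> e \<subseteq> {i,j}" if "e \<in> M" for e using that unfolding M_def by blast
  have I: "e \<inter> {i,j} = {}" if "e \<in> I" for e using that unfolding I_def by blast
  have "M \<inter> I = {}" using M I by blast
  moreover have "{i} \<notin> M" using M[of "{i}"] by blast
  moreover have "{i} \<notin> I" using I[of "{i}"] by blast
  ultimately have disj: "M \<inter> I = {}" "{i} \<notin> M" "{i} \<notin> I" by blast+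
  have set_xs: "set xs = params i j"
  proof
    show "set xs \<subseteq> params i j"
      using params_mem(1)[OF ij] by (simp add: xs_def ms ns M_def I_def)
    show "params i j \<subseteq> set xs"
    proof
      fix e assume e: "e \<in> params i j"
      from params_cases[OF e] have "e = {i} \<or> e \<in> M \<or> e \<in> I" using e unfolding M_def I_def by blast
      then show "e \<in> set xs" by (auto simp: xs_def ms ns)
    qed
  qed
  have dist: "distinct xs" using disj by (auto simp: xs_def ms ns)
  have len: "length xs = dimX TYPE('n)"
    using distinct_card[OF dist] card_params[OF ij] by (simp add: set_xs)
  show ?thesis
  proof (rule that[of "\<lambda>m. zclosure (phi_slice i j (set (take m xs)))"])
    show "zirreducible (zclosure (phi_slice i j (set (take m xs))))" for m
      by (rule zirreducible_phi_slice[OF ij])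
    show "zclosure (phi_slice i j (set (take (dimX TYPE('n)) xs))) = zclosure (phi_slice i j (params i j))"
      by (simp flip: len add: set_xs)
    fix m assume "m < dimX TYPE('n)"
    then have m: "m < length xs" by (simp add: len)
    have tk: "set (take (Suc m) xs) = insert (xs ! m) (set (take m xs))"
      using m by (simp add: take_Suc_conv_app_nth)
    have notin: "xs ! m \<notin> set (take m xs)"
      using dist m by (metis distinct_take take_Suc_conv_app_nth distinct_append disjoint_iff list.set_intros(1))
    have pos: "m < length ms" if "xs ! m \<in> M"
    proof (rule ccontr)
      assume "\<not> m < length ms"
      then have "xs ! m \<in> set (ns @ [{i}])"
        using m by (auto simp: xs_def nth_append intro!: nth_mem)
      then show False using that disj by (auto simp: ns)
    qed
    have pos': "m < length ms + length ns" if "xs ! m \<noteq> {i}"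
    proof (rule ccontr)
      assume "\<not> m < length ms + length ns"
      then have "m = length ms + length ns" using m by (simp add: xs_def)
      then show False using that by (simp add: xs_def nth_append)
    qed
    show "zclosure (phi_slice i j (set (take m xs))) \<subset> zclosure (phi_slice i j (set (take (Suc m) xs)))"
      unfolding tk
    proof (rule phi_slice_strict[OF ij _ notin])
      show "xs ! m \<in> params i j" using m set_xs nth_mem by blast
      show "{i} \<notin> set (take m xs)" if "xs ! m \<noteq> {i}"
      proof -
        have "take m xs = take m (ms @ ns)" using pos'[OF that] by (simp add: xs_def)
        then have "set (take m xs) \<subseteq> M \<union> I" using set_take_subset[of m "ms @ ns"] by (simp add: ms ns)
        then show ?thesis using disj by blast
      qed
      show "{b,c} \<notin> set (take m xs)"
        if "a \<notin> {i,j}" "xs ! m \<in> {{i,a},{j,a}}" "b \<notin> {i,j}" "c \<notin> {i,j}" for a b c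
      proof -
        have "xs ! m \<in> M" using that(1,2) m set_xs nth_mem unfolding M_def by blast
        then have "take m xs = take m ms" using pos by (simp add: xs_def)
        then have "set (take m xs) \<subseteq> M" using set_take_subset[of m ms] by (simp add: ms)
        moreover have "{b,c} \<notin> M" using M[of "{b,c}"] that(3,4) by blast
        ultimately show ?thesis by blast
      qed
      show "params i j - {{i}} \<subseteq> set (take m xs)" if "xs ! m = {i}"
      proof -
        have "m = length ms + length ns"
          using that m dist nth_eq_iff_index_eq[OF dist m, of "length ms + length ns"]
          by (simp add: xs_def nth_append)
        then have "take m xs = ms @ ns" by (simp add: xs_def)
        then show ?thesis using set_xs by (auto simp: xs_def)
      qed
    qed
  qed
qed

lemma zdim_le:
  fixes Z :: "(complex^'n^'n) set"
  assumes "Z \<subseteq> XC" "\<forall>i\<le>k. zirreducible (c i) \<and> c i \<subseteq> Z" "\<forall>i<k. c i \<subset> c (Suc i)"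
  shows "k \<le> dimX TYPE('n)"
  by (rule chain_length_bound[of k c]) (use assms in auto)

text \<open>Each point of \<open>derog\<close> is a value of some chart. The closure of that chart
  is irreducible and tops a chain of length \<open>dimX\<close>; \<open>chain_length_bound\<close>
  gives the other inequality.\<close>

lemma zlocdim_derog:
  fixes x :: "complex^'n^'n"
  assumes "x \<in> derog"
  shows "zlocdim XC x = dimX TYPE('n)"
proof -
  let ?N = "dimX TYPE('n)"
  define ch where "ch Z = {k. \<exists>c :: nat \<Rightarrow> (complex^'n^'n) set.
       (\<forall>i\<le>k. zirreducible (c i) \<and> c i \<subseteq> Z) \<and> (\<forall>i<k. c i \<subset> c (Suc i))}" for Z
  have bound: "k \<le> ?N" if "k \<in> ch Z" "Z \<subseteq> XC" for k and Z :: "(complex^'n^'n) set"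
    using that zdim_le unfolding ch_def by blast
  have zdim_bound: "zdim Z \<le> ?N" if "zirreducible Z" "Z \<subseteq> XC" for Z :: "(complex^'n^'n) set"
  proof -
    \<comment> \<open>\<open>Z\<close> alone is a chain of length 0. Nonemptiness and the bound are
      what make \<open>Sup\<close> on naturals a maximum.\<close>
    have "0 \<in> ch Z" using that unfolding ch_def by auto
    then have "Sup (ch Z) \<le> ?N" using bound[OF _ that(2)] by (intro cSup_least) auto
    then show ?thesis by (simp add: zdim_def ch_def)
  qed
  obtain i j S where ij: "i \<noteq> j" and S: "transpose S = S" "x = phi i j S"
    using derog_phi_exhaust[OF assms] by blast
  obtain \<sigma> where \<sigma>: "S = sm \<sigma>" using sm_exhaust[OF S(1)] by blast
  obtain c where c: "\<And>m. zirreducible (c m)" "\<And>m. m < ?N \<Longrightarrow> c m \<subset> c (Suc m)"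
    "c ?N = zclosure (phi_slice i j (params i j))" using phi_slice_chain[OF ij] by metis
  define Z where "Z = zclosure (phi_slice i j (params i j))"
  have Z: "Z \<subseteq> XC" unfolding Z_def XC_eq by (rule zclosure_mono[OF phi_slice_derog[OF ij]])
  have "x \<in> phi_slice i j (params i j)" unfolding phi_slice_def S \<sigma> by auto
  then have xZ: "x \<in> Z" using subset_zclosure phi_slice_derog[OF ij] derog_csym unfolding Z_def by blast
  have Zirr: "zirreducible Z" unfolding Z_def by (rule zirreducible_phi_slice[OF ij])
  have sub: "c m \<subseteq> c (m + d)" if "m + d \<le> ?N" for m d
    using that
  proof (induction d)
    case (Suc d)
    then show ?case using c(2)[of "m + d"] by auto
  qed simp
  have "c m \<subseteq> Z" if "m \<le> ?N" for m using sub[of m "?N - m"] that by (simp add: c(3) Z_def)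
  then have "?N \<in> ch Z" unfolding ch_def using c(1,2) by (intro CollectI exI[of _ c]) blast
  then have "?N \<le> Sup (ch Z)" using bound[OF _ Z] by (intro cSup_upper bdd_aboveI) auto
  then have zZ: "zdim Z = ?N" using zdim_bound[OF Zirr Z] by (simp add: zdim_def ch_def)
  show ?thesis unfolding zlocdim_def
  proof (rule cSup_eq_maximum)
    show "?N \<in> {zdim Z |Z. zirreducible Z \<and> Z \<subseteq> XC \<and> x \<in> Z}" using zZ[symmetric] Zirr Z xZ by blast
    show "d \<le> ?N" if "d \<in> {zdim Z |Z. zirreducible Z \<and> Z \<subseteq> XC \<and> x \<in> Z}" for d
      using that zdim_bound by blast
  qed
qed

section \<open>Smooth points\<close>

lemma dim_supported:
  fixes E :: "'k::finite set"
  shows "dim {\<sigma>::complex^'k. \<forall>e. e \<notin> E \<longrightarrow> \<sigma>$e = 0} = 2 * card E"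
proof -
  define d :: "(complex^'k) set" where "d = (\<lambda>(e,b). axis e b) ` (E \<times> Basis)"
  have inj: "inj_on (\<lambda>(e,b). axis e b :: complex^'k) (E \<times> Basis)"
    by (auto simp: inj_on_def axis_eq_axis nonzero_Basis)
  have "card d = card E * 2"
    unfolding d_def by (simp add: card_image[OF inj] card_cartesian_product)
  moreover have "d \<subseteq> Basis" by (auto simp: d_def Basis_vec_def)
  then have "dim {x::complex^'k. \<forall>i\<in>Basis. i \<notin> d \<longrightarrow> x \<bullet> i = 0} = card d" by (rule dim_substandard)
  moreover have "{x::complex^'k. \<forall>i\<in>Basis. i \<notin> d \<longrightarrow> x \<bullet> i = 0} = {\<sigma>. \<forall>e. e \<notin> E \<longrightarrow> \<sigma>$e = 0}"
  proof -
    have "axis e b \<in> d \<longleftrightarrow> e \<in> E" if "b \<in> Basis" for e and b :: complex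
      using that by (auto simp: d_def axis_eq_axis nonzero_Basis)
    then have "(\<forall>i\<in>Basis. i \<notin> d \<longrightarrow> x \<bullet> i = 0) \<longleftrightarrow> (\<forall>e. e \<notin> E \<longrightarrow> (\<forall>b\<in>Basis. x$e \<bullet> b = 0))" for x :: "complex^'k"
      by (auto simp: Basis_vec_def inner_axis)
    then show ?thesis by (simp add: euclidean_all_zero_iff)
  qed
  ultimately show ?thesis by simp
qed

text \<open>The equations v_ii = v_jj and v_ij = 0 leave exactly the entries indexed by
  \<open>params i j\<close>, so tangent space and chart are counted by the same set. The factor 2
  passes from complex to real dimension.\<close>

lemma dim_ztangent_diag:
  fixes m :: "complex^'n" and C :: "complex^'n^'n"
  assumes C: "transpose C ** C = mat 1" and ij: "i \<noteq> j" "m$i = m$j"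
    and simple: "\<And>k l. k \<noteq> l \<Longrightarrow> m$k = m$l \<Longrightarrow> {k,l} = {i,j}"
  shows "dim (ztangent XC (transpose C ** dmat m ** C)) = 2 * dimX TYPE('n)"
proof -
  have C': "C ** transpose C = mat 1" using C matrix_left_right_inverse by blast
  let ?V = "{v \<in> csym. v$i$i = v$j$j \<and> v$i$j = 0} :: (complex^'n^'n) set"
  have tanM: "ztangent XC (dmat m) = ?V" by (rule ztangent_diag[OF ij simple])
  let ?conj = "\<lambda>v. transpose C ** v ** C"
  have tan: "ztangent XC (?conj (dmat m)) = ?conj ` ?V"
  proof
    show "?conj ` ?V \<subseteq> ztangent XC (?conj (dmat m))"
      using ztangent_conj[OF C] tanM by blast
    show "ztangent XC (?conj (dmat m)) \<subseteq> ?conj ` ?V"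
    proof
      fix v assume "v \<in> ztangent XC (?conj (dmat m))"
      then have "C ** v ** transpose C \<in> ztangent XC (C ** ?conj (dmat m) ** transpose C)"
        using ztangent_conj[of "transpose C" v] C' by simp
      also have "C ** ?conj (dmat m) ** transpose C = dmat m"
        by (metis C' matrix_mul_assoc matrix_mul_lid matrix_mul_rid)
      finally have "C ** v ** transpose C \<in> ?V" by (simp only: tanM)
      moreover have "v = ?conj (C ** v ** transpose C)"
        by (metis C matrix_mul_assoc matrix_mul_lid matrix_mul_rid)
      ultimately show "v \<in> ?conj ` ?V" by blast
    qed
  qed
  define L :: "complex^('n set) \<Rightarrow> complex^'n^'n" where
    "L \<sigma> = (\<chi> a b. if {a,b} = {i,j} then 0 else if {a,b} = {j} then \<sigma>${i} else \<sigma>${a,b})" for \<sigma>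
  let ?U = "{\<sigma>::complex^('n set). \<forall>e. e \<notin> params i j \<longrightarrow> \<sigma>$e = 0}"
  have LU: "L ` ?U = ?V"
  proof
    show "L ` ?U \<subseteq> ?V" using ij by (auto simp: L_def csym_def vec_eq_iff insert_commute doubleton_eq_iff)
    show "?V \<subseteq> L ` ?U"
    proof
      fix v assume v: "v \<in> ?V"
      then obtain \<tau> where \<tau>: "v = sm \<tau>" using sm_exhaust by (auto simp: csym_def)
      define \<sigma> :: "complex^('n set)" where "\<sigma> = (\<chi> e. if e \<in> params i j then \<tau> e else 0)"
      have "v$a$b = L \<sigma> $ a $ b" for a b
      proof -
        have "{a,b} = {i,j} \<or> {a,b} = {j} \<or> {a,b} \<in> params i j" by (auto simp: params_def)
        moreover have "\<tau> {i,j} = 0" "\<tau> {i} = \<tau> {j}" using v by (simp_all add: \<tau>)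
        ultimately show ?thesis
          using params_mem(1)[OF ij(1)] by (auto simp: \<tau> L_def \<sigma>_def params_def)
      qed
      then have "v = L \<sigma>" by (simp add: vec_eq_iff)
      then show "v \<in> L ` ?U" by (auto simp: \<sigma>_def)
    qed
  qed
  have lin: "linear (\<lambda>\<sigma>. ?conj (L \<sigma>))"
  proof (rule linearI)
    have "L (x + y) = L x + L y" for x y by (simp add: L_def vec_eq_iff)
    then show "?conj (L (x + y)) = ?conj (L x) + ?conj (L y)" for x y
      by (simp add: matrix_add_ldistrib matrix_add_rdistrib)
    have "L (r *\<^sub>R x) = r *\<^sub>R L x" for r x by (simp add: L_def vec_eq_iff)
    moreover have "?conj (r *\<^sub>R v) = r *\<^sub>R ?conj v" for r v
      by (simp add: vec_eq_iff matrix_matrix_mult_nth scaleR_sum_right sum_distrib_right)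
    ultimately show "?conj (L (r *\<^sub>R x)) = r *\<^sub>R ?conj (L x)" for r x by simp
  qed
  have "inj_on (\<lambda>\<sigma>. ?conj (L \<sigma>)) ?U"
  proof (rule inj_onI)
    fix x y assume x: "x \<in> ?U" and y: "y \<in> ?U" and eq: "?conj (L x) = ?conj (L y)"
    have Lxy: "L x = L y" using eq by (metis C' matrix_mul_assoc matrix_mul_lid matrix_mul_rid)
    have "x$e = y$e" for e
    proof (cases "e \<in> params i j")
      case True
      then obtain a b where e: "e = {a,b}" "{a,b} \<noteq> {j}" "{a,b} \<noteq> {i,j}" by (auto simp: params_def)
      have "L x $ a $ b = L y $ a $ b" by (simp add: Lxy)
      then show ?thesis using e(2,3) unfolding e(1) L_def by (auto split: if_splits)
    qed (use x y in auto)
    then show "x = y" by (simp add: vec_eq_iff)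
  qed
  moreover have "span ?U = ?U"
    by (rule real_vector.span_eq_iff[THEN iffD2]) (auto simp: subspace_def)
  ultimately have "dim ((\<lambda>\<sigma>. ?conj (L \<sigma>)) ` ?U) = dim ?U"
    by (intro dim_image_eq lin) (simp only:)
  moreover have "(\<lambda>\<sigma>. ?conj (L \<sigma>)) ` ?U = ztangent XC (?conj (dmat m))"
    unfolding tan LU[symmetric] by (rule image_image[symmetric])
  ultimately show ?thesis by (simp add: dim_supported card_params[OF ij(1)])
qed

section \<open>Generic symmetric matrices\<close>

text \<open>On tensors antisymmetric in the first two slots, half of \<open>gen_op A\<close> is
  \<open>A \<otimes> 1 \<otimes> 1 + 1 \<otimes> A \<otimes> 1 - 2 (1 \<otimes> 1 \<otimes> A)\<close>, with eigenvalues \<open>l i + l j - 2 * l k\<close> for \<open>i \<noteq> j\<close>; the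
  last two terms make the operator injective on symmetric tensors.\<close>

definition gen_op :: "'a::field^'n^'n \<Rightarrow> 'a^('n \<times> 'n \<times> 'n) \<Rightarrow> 'a^('n \<times> 'n \<times> 'n)" where
  "gen_op A Y = (\<chi> p. case p of (a, b, c) \<Rightarrow>
      (\<Sum>d\<in>UNIV. A$a$d * (Y$(d,b,c) - Y$(b,d,c))) + (\<Sum>d\<in>UNIV. A$b$d * (Y$(a,d,c) - Y$(d,a,c)))
      - 2 * (\<Sum>d\<in>UNIV. A$c$d * (Y$(a,b,d) - Y$(b,a,d))) + Y$(a,b,c) + Y$(b,a,c))"

lemma gen_op_nth: "gen_op A Y $ (a,b,c) =
      (\<Sum>d\<in>UNIV. A$a$d * (Y$(d,b,c) - Y$(b,d,c))) + (\<Sum>d\<in>UNIV. A$b$d * (Y$(a,d,c) - Y$(d,a,c)))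
      - 2 * (\<Sum>d\<in>UNIV. A$c$d * (Y$(a,b,d) - Y$(b,a,d))) + Y$(a,b,c) + Y$(b,a,c)"
  by (simp add: gen_op_def)

definition gen_poly :: "'a::field^'n^'n \<Rightarrow> 'a" where
  "gen_poly A = det (matrix (gen_op A))"

lemma linear_gen_op: "Vector_Spaces.linear (*s) (*s) (gen_op A)"
  unfolding Vector_Spaces.linear_iff
proof (intro conjI allI)
  show "gen_op A (x + y) = gen_op A x + gen_op A y" for x y
    by (simp add: vec_eq_iff gen_op_nth split_paired_all algebra_simps sum.distrib sum_subtractf)
  show "gen_op A (r *s x) = r *s gen_op A x" for r x
    by (simp add: vec_eq_iff gen_op_nth split_paired_all algebra_simps sum_distrib_left sum_subtractf)
qed (rule vec.vector_space_axioms)+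

lemma gen_poly_nonzero_iff: "gen_poly A \<noteq> 0 \<longleftrightarrow> (\<forall>Y. gen_op A Y = 0 \<longrightarrow> Y = 0)"
  unfolding gen_poly_def using det_eq_0_iff_kernel[of "matrix (gen_op A)"] matrix_works[OF linear_gen_op[of A]] by auto

lemma cpolys_gen_poly: "(gen_poly :: complex^'n^'n \<Rightarrow> complex) \<in> cpolys"
proof -
  have "(\<lambda>A::complex^'n^'n. matrix (gen_op A) $ p $ q) \<in> cpolys" for p q :: "'n \<times> 'n \<times> 'n"
    by (cases p) (simp add: matrix_def gen_op_nth, intro cpolys_intros)
  then have "(\<lambda>A::complex^'n^'n. det (matrix (gen_op A))) \<in> cpolys" by (rule cpolys_det)
  then show ?thesis by (simp add: gen_poly_def[abs_def])
qed

text \<open>The tensor (v wedge w) tensor u is killed by \<open>gen_op A\<close>: its eigenvalue is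
  0 by \<open>eq\<close>, and the \<kappa> term drops out since v wedge v = 0. Allowing \<kappa>
  lets one polynomial exclude Jordan blocks along with coincidences of eigenvalues.\<close>

lemma gen_poly_wedge:
  fixes A :: "'a::field_char_0^'n^'n"
  assumes A: "gen_poly A \<noteq> 0"
    and v: "A *v v = \<rho> *s v" and w: "A *v w = \<mu> *s w + \<kappa> *s v" and u: "A *v u = \<nu> *s u"
    and eq: "\<rho> + \<mu> = 2 * \<nu>" and nz: "u \<noteq> 0" "v \<noteq> 0"
  shows "\<exists>c. w = c *s v"
proof -
  define Y :: "'a^('n \<times> 'n \<times> 'n)" where "Y = (\<chi> p. case p of (a,b,c) \<Rightarrow> (v$a * w$b - w$a * v$b) * u$c)"
  have Y: "Y $ (a,b,c) = (v$a * w$b - w$a * v$b) * u$c" for a b c by (simp add: Y_def)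
  have ev: "(\<Sum>d\<in>UNIV. A$a$d * x$d) = (A *v x)$a" for a x by (simp add: matrix_vector_mult_nth)
  have "gen_op A Y $ (a,b,c) = 0" for a b c
  proof -
    have anti: "Y $ (x,y,z) - Y $ (y,x,z) = 2 * Y $ (x,y,z)" for x y z by (simp add: Y algebra_simps)
    have s1: "(\<Sum>d\<in>UNIV. A$a$d * (Y$(d,b,c) - Y$(b,d,c))) = 2 * ((A *v v)$a * w$b - (A *v w)$a * v$b) * u$c"
      unfolding anti Y ev[symmetric] by (simp add: algebra_simps sum_subtractf sum_distrib_left)
    have s2: "(\<Sum>d\<in>UNIV. A$b$d * (Y$(a,d,c) - Y$(d,a,c))) = 2 * (v$a * (A *v w)$b - w$a * (A *v v)$b) * u$c"
      unfolding anti Y ev[symmetric] by (simp add: algebra_simps sum_subtractf sum_distrib_left)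
    have s3: "(\<Sum>d\<in>UNIV. A$c$d * (Y$(a,b,d) - Y$(b,a,d))) = 2 * (v$a * w$b - w$a * v$b) * (A *v u)$c"
      unfolding anti Y ev[symmetric] by (simp add: algebra_simps sum_subtractf sum_distrib_left)
    have "gen_op A Y $ (a,b,c) = 2 * (\<rho> + \<mu> - 2 * \<nu>) * (v$a * w$b - w$a * v$b) * u$c"
      unfolding gen_op_nth s1 s2 s3 v w u by (simp add: Y algebra_simps)
    then show ?thesis using eq by simp
  qed
  then have "gen_op A Y = 0" by (simp add: vec_eq_iff split_paired_all)
  then have Y0: "Y = 0" using A gen_poly_nonzero_iff by blast
  obtain i where i: "v$i \<noteq> 0" using nz(2) by (auto simp: vec_eq_iff)
  obtain k where k: "u$k \<noteq> 0" using nz(1) by (auto simp: vec_eq_iff)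
  have "v$i * w$b = w$i * v$b" for b
    using Y[of i b k] Y0 k by simp
  then have "w = (w$i / v$i) *s v" using i by (simp add: vec_eq_iff field_simps)
  then show ?thesis by blast
qed

text \<open>An isotropic v is a left kernel vector of B = A - \<rho> with column i replaced by v. A
  right kernel vector then yields z' with z'_i = 0 and B z' a multiple of v, and
  \<open>gen_poly_wedge\<close> with u = v makes z' a multiple of v, hence 0.\<close>

lemma eigenvector_not_isotropic:
  fixes A :: "'a::field_char_0^'n^'n"
  assumes A: "gen_poly A \<noteq> 0" "transpose A = A" and v: "A *v v = \<rho> *s v" "v \<noteq> 0"
  shows "(\<Sum>a\<in>UNIV. v$a * v$a) \<noteq> 0"
proof
  assume iso: "(\<Sum>a\<in>UNIV. v$a * v$a) = 0"
  obtain i where i: "v$i \<noteq> 0" using v(2) by (auto simp: vec_eq_iff)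
  define B where "B = A - mat \<rho>"
  have Bs: "B$a$b = B$b$a" for a b
  proof -
    have "transpose B = B" using A(2) by (simp add: B_def transpose_diff)
    then show ?thesis by (metis transpose_nth)
  qed
  have Bv: "B *v v = 0" using v(1) by (simp add: B_def matrix_vector_mult_diff_rdistrib mat_mult_vec)
  let ?M = "\<chi> a b. if b = i then v$a else B$a$b"
  have "(\<Sum>l\<in>UNIV. v$l * ?M$l$k) = 0" for k
  proof (cases "k = i")
    case False
    have "(\<Sum>l\<in>UNIV. v$l * B$l$k) = (B *v v)$k"
      by (simp add: matrix_vector_mult_nth Bs[of k] mult.commute)
    then show ?thesis using False Bv by simp
  qed (simp add: iso)
  then have "det ?M = 0" by (rule det_eq_0_if_left_kernel[OF v(2)])
  then obtain z where z: "z \<noteq> 0" "?M *v z = 0" using det_eq_0_iff_kernel by blast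
  define z' where "z' = (\<chi> b. if b = i then 0 else z$b)"
  have Bz: "B *v z' = - (z$i) *s v" unfolding z'_def by (rule column_replace_kernel[OF z(2)])
  then have "A *v z' = \<rho> *s z' + (- (z$i)) *s v"
    by (simp add: B_def matrix_vector_mult_diff_rdistrib mat_mult_vec algebra_simps)
  from gen_poly_wedge[OF A(1) v(1) this v(1)] v(2) obtain c where c: "z' = c *s v" by auto
  then have "z'$i = c * v$i" by simp
  then have "c = 0" using i by (simp add: z'_def)
  then have z'0: "z' = 0" using c by simp
  then have "- (z$i) *s v = 0" using Bz by simp
  then have "(- (z$i) *s v)$i = 0" by (simp only: zero_index)
  then have "z$i = 0" using i by simp
  then have "z = 0" using z'0 by (simp add: z'_def vec_eq_iff) metis
  then show False using z(1) by simp
qed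

section \<open>Polynomials in a matrix acting on vectors, and eigenvectors in invariant sets\<close>

definition pact :: "'a::field^'n^'n \<Rightarrow> 'a poly \<Rightarrow> 'a^'n \<Rightarrow> 'a^'n" where
  "pact A p w = fold_coeffs (\<lambda>c v. c *s w + A *v v) p 0"

lemma pact_0 [simp]: "pact A 0 w = 0"
  by (simp add: pact_def)

lemma pact_pCons: "pact A (pCons c p) w = c *s w + A *v pact A p w"
  unfolding pact_def by (cases "c = 0 \<and> p = 0") auto

lemma pact_add: "pact A (p + q) w = pact A p w + pact A q w"
  by (induction p q rule: poly_induct2)
     (simp_all add: pact_pCons vector_sadd_rdistrib matrix_vector_right_distrib add_ac)

lemma pact_smult: "pact A (smult r p) w = r *s pact A p w"
  by (induction p) (simp_all add: pact_pCons vector_ssub_ldistrib vector_add_ldistrib vector_smult_assoc vector_scalar_commute)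

lemma pact_commute: "pact A p (A *v w - r *s w) = A *v pact A p w - r *s pact A p w"
proof (induction p)
  case (pCons c p)
  show ?case
    unfolding pact_pCons pCons.IH matrix_vector_right_distrib matrix_vector_mult_diff_distrib vector_scalar_commute
    by (simp add: vec_eq_iff algebra_simps)
qed simp

lemma pact_linear_factor: "pact A ([:-r, 1:] * p) w = pact A p (A *v w - r *s w)"
proof -
  have "[:-r, 1:] * p = smult (-r) p + pCons 0 p" by simp
  then show ?thesis
    by (simp only: pact_add pact_smult pact_pCons pact_commute) (simp add: vec_eq_iff)
qed

lemma pact_monom: "pact A (monom c k) w = c *s ((\<lambda>v. A *v v) ^^ k) w"
  by (induction k) (simp_all add: monom_0 monom_Suc pact_pCons vector_scalar_commute)

lemma pact_sum: "pact A (\<Sum>k\<in>K. f k) w = (\<Sum>k\<in>K. pact A (f k) w)"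
  by (induction K rule: infinite_finite_induct) (simp_all add: pact_add)

text \<open>Split off a root r of p: either w is an eigenvector, or A w - r w is a nonzero element
  of W annihilated by a polynomial of smaller degree.\<close>

lemma eigenvector_of_pact:
  fixes A :: "complex^'n^'n"
  assumes "p \<noteq> 0" "pact A p w = 0" "w \<noteq> 0" "w \<in> W" "\<And>r v. v \<in> W \<Longrightarrow> A *v v - r *s v \<in> W"
  shows "\<exists>v\<in>W. v \<noteq> 0 \<and> (\<exists>\<rho>. A *v v = \<rho> *s v)"
  using assms(1-4)
proof (induction "degree p" arbitrary: p w)
  case 0
  then obtain c where "p = [:c:]" by (metis degree_eq_zeroE)
  then show ?case using 0 by (simp add: pact_pCons)
next
  case (Suc d)
  have "\<not> constant (poly p)" using Suc.hyps(2) by (simp add: constant_degree)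
  then obtain r where "poly p r = 0" using fundamental_theorem_of_algebra by blast
  then obtain q where q: "p = [:-r, 1:] * q" by (auto simp: poly_eq_0_iff_dvd)
  have q0: "q \<noteq> 0" using Suc.prems(1) q by auto
  have "degree p = Suc (degree q)" unfolding q using q0 by (subst degree_mult_eq) auto
  then have d: "d = degree q" using Suc.hyps(2) by simp
  have act: "pact A q (A *v w - r *s w) = 0" using Suc.prems(2) unfolding q pact_linear_factor .
  show ?case
  proof (cases "A *v w - r *s w = 0")
    case True
    then have "A *v w = r *s w" by simp
    then show ?thesis using Suc.prems by blast
  next
    case False
    then show ?thesis using Suc.hyps(1)[OF d q0 act False assms(5)[OF Suc.prems(4)]] by blast
  qed
qed

text \<open>The n + 1 vectors w, A w, ..., A^n w are dependent, which gives a nonzero polynomial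
  annihilating w.\<close>

lemma eigenvector_in_invariant:
  fixes A :: "complex^'n^'n"
  assumes "w \<noteq> 0" "w \<in> W" "\<And>r v. v \<in> W \<Longrightarrow> A *v v - r *s v \<in> W"
  shows "\<exists>v\<in>W. v \<noteq> 0 \<and> (\<exists>\<rho>. A *v v = \<rho> *s v)"
proof -
  obtain c where c: "\<exists>k\<in>{..CARD('n)}. c k \<noteq> 0"
    "\<forall>a\<in>UNIV. (\<Sum>k\<in>{..CARD('n)}. c k * (((\<lambda>v. A *v v) ^^ k) w) $ a) = 0"
    using linear_relation[of "UNIV :: 'n set" "{..CARD('n)}" "\<lambda>k a. (((\<lambda>v. A *v v) ^^ k) w) $ a"] by auto
  define p where "p = (\<Sum>k\<le>CARD('n). monom (c k) k)"
  have "coeff p k = c k" if "k \<le> CARD('n)" for k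
    using that by (simp add: p_def coeff_sum)
  then have "p \<noteq> 0" using c(1) by auto
  moreover have "pact A p w = 0"
    using c(2) by (simp add: p_def pact_sum pact_monom vec_eq_iff)
  ultimately show ?thesis using assms by (rule eigenvector_of_pact)
qed

text \<open>Gram-Schmidt for the bilinear form without conjugation. The orthogonal complement of the
  eigenvectors found so far is nonzero and invariant by symmetry, so it contains an eigenvector,
  which can be normalised because it is not isotropic.\<close>

lemma generic_orthonormal_eigenvectors:
  fixes A :: "complex^'n^'n" and F :: "'n set"
  assumes A: "gen_poly A \<noteq> 0" "transpose A = A"
  shows "\<exists>v l. (\<forall>a\<in>F. A *v v a = l a *s v a) \<and>
     (\<forall>a\<in>F. \<forall>b\<in>F. (\<Sum>k\<in>UNIV. v a $ k * v b $ k) = (if a = b then 1 else 0))"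
  using finite[of F]
proof (induction F rule: finite_induct)
  case empty
  show ?case by simp
next
  case (insert x F)
  then obtain v l where v: "\<And>a. a \<in> F \<Longrightarrow> A *v v a = l a *s v a"
    and on: "\<And>a b. a \<in> F \<Longrightarrow> b \<in> F \<Longrightarrow> (\<Sum>k\<in>UNIV. v a $ k * v b $ k) = (if a = b then 1 else 0)"
    by blast
  define W where "W = {w. \<forall>a\<in>F. (\<Sum>k\<in>UNIV. v a $ k * w$k) = 0}"
  \<comment> \<open>Row \<open>x\<close> is zero since x lies outside F, so M is singular; its
    kernel lies in W.\<close>
  define M where "M = (\<chi> a k. if a \<in> F then v a $ k else 0)"
  have "det M = 0"
  proof (rule det_eq_0_if_left_kernel)
    show "(axis x 1 :: complex^'n) \<noteq> 0" by (simp add: axis_eq_0_iff)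
    show "(\<Sum>l\<in>UNIV. (axis x 1 :: complex^'n)$l * M$l$k) = 0" for k
      using insert.hyps by (intro sum.neutral) (auto simp: axis_def M_def)
  qed
  then obtain w where w: "w \<noteq> 0" "M *v w = 0" using det_eq_0_iff_kernel by blast
  have "(\<Sum>k\<in>UNIV. v a $ k * w$k) = (M *v w) $ a" if "a \<in> F" for a
    using that by (simp add: M_def matrix_vector_mult_nth)
  then have wW: "w \<in> W" using w(2) by (simp add: W_def)
  have inv: "A *v y - r *s y \<in> W" if "y \<in> W" for r y
  proof -
    have "(\<Sum>k\<in>UNIV. v a $ k * (A *v y - r *s y)$k) = 0" if a: "a \<in> F" for a
    proof -
      have y0: "(\<Sum>k\<in>UNIV. v a $ k * y$k) = 0" using \<open>y \<in> W\<close> a by (simp add: W_def)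
      have "(\<Sum>k\<in>UNIV. v a $ k * (A *v y)$k) = (\<Sum>k\<in>UNIV. y$k * (l a *s v a)$k)"
        unfolding v[OF a, symmetric] by (rule sum_symmetric_swap[OF A(2)])
      also have "\<dots> = l a * (\<Sum>k\<in>UNIV. v a $ k * y$k)" by (simp add: sum_distrib_left mult_ac)
      finally have "(\<Sum>k\<in>UNIV. v a $ k * (A *v y)$k) = 0" using y0 by simp
      moreover have "(\<Sum>k\<in>UNIV. v a $ k * (r * y$k)) = r * (\<Sum>k\<in>UNIV. v a $ k * y$k)"
        by (simp add: sum_distrib_left mult_ac)
      ultimately show ?thesis using y0 by (simp add: right_diff_distrib sum_subtractf)
    qed
    then show ?thesis by (simp add: W_def)
  qed
  obtain y \<rho> where y: "y \<in> W" "y \<noteq> 0" "A *v y = \<rho> *s y"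
    using eigenvector_in_invariant[OF w(1) wW inv] by blast
  define s where "s = (\<Sum>a\<in>UNIV. y$a * y$a)"
  have s: "s \<noteq> 0" unfolding s_def by (rule eigenvector_not_isotropic[OF A y(3,2)])
  define r where "r = 1 / csqrt s"
  have r: "r\<^sup>2 * s = 1" using s by (simp add: r_def power_divide)
  define u where "u = r *s y"
  have Au: "A *v u = \<rho> *s u" using y(3) by (simp add: u_def vector_scalar_commute vector_smult_assoc mult.commute)
  have uu: "(\<Sum>k\<in>UNIV. u$k * u$k) = 1"
  proof -
    have "(\<Sum>k\<in>UNIV. u$k * u$k) = r\<^sup>2 * s"
      by (simp add: u_def s_def sum_distrib_left power2_eq_square mult_ac)
    then show ?thesis by (simp only: r)
  qed
  have vu: "(\<Sum>k\<in>UNIV. v a $ k * u$k) = 0" if "a \<in> F" for a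
  proof -
    have "(\<Sum>k\<in>UNIV. v a $ k * u$k) = r * (\<Sum>k\<in>UNIV. v a $ k * y$k)"
      by (simp add: u_def sum_distrib_left mult_ac)
    then show ?thesis using y(1) that by (simp add: W_def)
  qed
  have uv: "(\<Sum>k\<in>UNIV. u$k * v a $ k) = 0" if "a \<in> F" for a
    using vu[OF that] by (simp add: mult.commute)
  have "x \<notin> F" by (rule insert.hyps)
  then show ?case
    by (intro exI[of _ "v(x := u)"] exI[of _ "l(x := \<rho>)"]) (auto simp: v on Au uu vu uv)
qed

lemma generic_diagonalization:
  fixes A :: "complex^'n^'n"
  assumes "gen_poly A \<noteq> 0" "transpose A = A"
  obtains C :: "complex^'n^'n" and l where "transpose C ** C = mat 1" "A = transpose C ** dmat l ** C"
proof -
  obtain v :: "'n \<Rightarrow> complex^'n" and l where v: "\<And>a. A *v v a = l a *s v a"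
    and on: "\<And>a b. (\<Sum>k\<in>UNIV. v a $ k * v b $ k) = (if a = b then 1 else 0)"
    using generic_orthonormal_eigenvectors[OF assms, of UNIV] by blast
  define C where "C = (\<chi> a k. v a $ k)"
  have "C ** transpose C = mat 1"
    by (simp add: vec_eq_iff C_def matrix_matrix_mult_nth mat_def on)
  then have C: "transpose C ** C = mat 1" using matrix_left_right_inverse by blast
  have "A ** transpose C = transpose C ** dmat (\<chi> a. l a)"
  proof -
    have "(A ** transpose C) $ i $ a = (A *v v a) $ i" for i a
      by (simp add: matrix_matrix_mult_nth matrix_vector_mult_nth C_def)
    moreover have "(transpose C ** dmat (\<chi> a. l a)) $ i $ a = l a * v a $ i" for i a
      unfolding mult_dmat_nth by (simp add: C_def mult.commute)
    ultimately show ?thesis by (simp add: vec_eq_iff v)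
  qed
  then have "A ** transpose C ** C = transpose C ** dmat (\<chi> a. l a) ** C" by simp
  then show ?thesis using that[OF C] by (simp add: C flip: matrix_mul_assoc)
qed

text \<open>The rows of C are eigenvectors, to which \<open>gen_poly_wedge\<close> applies. For k in
  {i,j} the conclusion separates two eigenvalues; for other k it keeps their average off the
  spectrum.\<close>

lemma generic_eigenvalues:
  fixes C :: "complex^'n^'n"
  assumes gen: "gen_poly (transpose C ** dmat l ** C) \<noteq> 0" and C: "transpose C ** C = mat 1" and ij: "i \<noteq> j"
  shows "l$i + l$j \<noteq> 2 * l$k"
proof
  assume eq: "l$i + l$j = 2 * l$k"
  have C': "C ** transpose C = mat 1" using C matrix_left_right_inverse by blast
  define v where "v a = (\<chi> k. C$a$k)" for a
  have Cv: "C *v v a = axis a 1" for a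
    using C' by (auto simp: vec_eq_iff matrix_vector_mult_nth matrix_matrix_mult_nth v_def axis_def mat_def)
  have "transpose C *v (l$a *s axis a 1) = l$a *s v a" for a
    by (simp add: vec_eq_iff vector_matrix_mult_def v_def axis_def if_distrib [where f="\<lambda>x. _ * x"]
        if_distrib [where f="\<lambda>x. x * _"] cong: if_cong)
  moreover have "dmat l *v axis a 1 = l$a *s axis a 1" for a
    by (simp add: vec_eq_iff dmat_mult_vec_nth axis_def)
  ultimately have ev: "(transpose C ** dmat l ** C) *v v a = l$a *s v a" for a
    by (simp add: Cv flip: matrix_vector_mul_assoc del: transpose_matrix_vector)
  have nz: "v a \<noteq> 0" for a using Cv[of a] by (auto simp: axis_eq_0_iff)
  have "(transpose C ** dmat l ** C) *v v j = l$j *s v j + 0 *s v i" by (simp add: ev)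
  from gen_poly_wedge[OF gen ev[of i] this ev[of k] eq nz nz] obtain c where "v j = c *s v i" by blast
  then have "C *v v j = c *s (C *v v i)" by (simp add: vector_scalar_commute)
  then have "(axis j 1 :: complex^'n) $ j = (c *s axis i 1) $ j" by (simp add: Cv)
  then show False using ij by (simp add: axis_def)
qed

section \<open>Existence of a generic real matrix\<close>

lemma gen_poly_dmat:
  fixes b :: "'a::field_char_0^'n"
  assumes "\<And>i j k. i \<noteq> j \<Longrightarrow> b$i + b$j \<noteq> 2 * b$k"
  shows "gen_poly (dmat b) \<noteq> 0"
  unfolding gen_poly_nonzero_iff
proof (intro allI impI)
  fix Y assume Y: "gen_op (dmat b) Y = 0"
  have sel: "(\<Sum>d\<in>UNIV. dmat b $ a $ d * f d) = b$a * f a" for a f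
    by (simp add: dmat_nth if_distrib [where f="\<lambda>x. x * _"] cong: if_cong)
  have eq: "(b$x + b$y - 2 * b$z) * (Y$(x,y,z) - Y$(y,x,z)) + (Y$(x,y,z) + Y$(y,x,z)) = 0" for x y z
  proof -
    have "gen_op (dmat b) Y $ (x,y,z) = 0" using Y by simp
    then show ?thesis unfolding gen_op_nth sel by (simp add: algebra_simps)
  qed
  have "Y$(x,y,z) = 0" for x y z
  proof -
    \<comment> \<open>Exchanging x and y negates the antisymmetric part of the equation, so the sum
      of both equations isolates the symmetric part of Y.\<close>
    have "2 * (Y$(x,y,z) + Y$(y,x,z)) = 0"
      using arg_cong2[OF eq[of x y z] eq[of y x z], of "(+)"] by (simp add: algebra_simps)
    then have sum0: "Y$(x,y,z) + Y$(y,x,z) = 0" unfolding mult_eq_0_iff by simp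
    show ?thesis
    proof (cases "x = y")
      case True
      then have "2 * Y$(x,y,z) = 0" using sum0 by simp
      then show ?thesis by simp
    next
      case False
      then have "b$x + b$y - 2 * b$z \<noteq> 0" using assms by simp
      then have "Y$(x,y,z) - Y$(y,x,z) = 0" using eq[of x y z] sum0 by simp
      then have "2 * Y$(x,y,z) = 0" using sum0 by (simp add: algebra_simps)
      then show ?thesis by simp
    qed
  qed
  then show "Y = 0" by (simp add: vec_eq_iff split_paired_all)
qed

text \<open>If c < b, then 3^b alone is at least three times 3^c; otherwise 2 times 3^c is at least
  2 times 3^b, more than the left-hand side.\<close>

lemma powers_of_3_no_midpoint:
  fixes a b c :: nat
  assumes "a < b"
  shows "(3::real) ^ a + 3 ^ b \<noteq> 2 * 3 ^ c"
proof (cases "c < b")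
  case True
  then have "(3::real) * 3 ^ c \<le> 3 ^ b"
    using power_increasing[of "Suc c" b "3::real"] by simp
  moreover have "(0::real) < 3 ^ c" "(0::real) < 3 ^ a" by simp_all
  ultimately show ?thesis by linarith
next
  case False
  then have "(3::real) ^ b \<le> 3 ^ c" by (intro power_increasing) auto
  moreover have "(3::real) ^ a < 3 ^ b" using assms by (intro power_strict_increasing) auto
  ultimately show ?thesis by linarith
qed

lemma gen_poly_real_nonzero: "\<exists>B\<in>rsym. gen_poly (cembed (B :: real^'n^'n)) \<noteq> 0"
proof -
  obtain f :: "'n \<Rightarrow> nat" where f: "inj f" using finite_imp_inj_to_nat_seg[OF finite, of "UNIV::'n set"] by blast
  define b :: "real^'n" where "b = (\<chi> k. 3 ^ f k)"
  have b: "b$i + b$j \<noteq> 2 * b$k" if "i \<noteq> j" for i j k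
  proof -
    have "f i \<noteq> f j" using f that by (simp add: inj_eq)
    then consider "f i < f j" | "f j < f i" by linarith
    then show ?thesis
      using powers_of_3_no_midpoint[of "f i" "f j" "f k"] powers_of_3_no_midpoint[of "f j" "f i" "f k"]
      by cases (simp_all add: b_def add.commute)
  qed
  have e: "cembed (dmat b) = dmat (\<chi> k. of_real (b$k))" by (simp add: vec_eq_iff cembed_def dmat_nth)
  have "gen_poly (cembed (dmat b)) \<noteq> 0" unfolding e
  proof (rule gen_poly_dmat)
    fix i j k :: 'n assume "i \<noteq> j"
    then have "complex_of_real (b$i + b$j) \<noteq> of_real (2 * b$k)" using b unfolding of_real_eq_iff by blast
    then show "(\<chi> k. complex_of_real (b$k)) $ i + (\<chi> k. complex_of_real (b$k)) $ j \<noteq> 2 * (\<chi> k. complex_of_real (b$k)) $ k"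
      by simp
  qed
  moreover have "dmat b \<in> rsym" by (simp add: rsym_def transpose_dmat)
  ultimately show ?thesis by blast
qed

section \<open>The set of critical points\<close>

lemma ED_critical_eq:
  fixes C :: "complex^'n^'n"
  assumes gen: "gen_poly (transpose C ** dmat l ** C) \<noteq> 0" and C: "transpose C ** C = mat 1"
  shows "ED_critical (transpose C ** dmat l ** C) = {transpose C ** dmat (lam l i j) ** C | i j. i \<noteq> j}"
proof
  have mid: "l$i + l$j \<noteq> 2 * l$k" if "i \<noteq> j" for i j k by (rule generic_eigenvalues[OF gen C that])
  have inj: "l$a \<noteq> l$b" if "a \<noteq> b" for a b using mid[OF that, of a] by auto
  show "ED_critical (transpose C ** dmat l ** C) \<subseteq> {transpose C ** dmat (lam l i j) ** C | i j. i \<noteq> j}"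
    using ED_critical_subset[OF C inj] by blast
  show "{transpose C ** dmat (lam l i j) ** C | i j. i \<noteq> j} \<subseteq> ED_critical (transpose C ** dmat l ** C)"
  proof clarify
    fix i j :: 'n assume ij: "i \<noteq> j"
    define m where "m = lam l i j"
    have mi: "m$i = (l$i + l$j) / 2" "m$j = (l$i + l$j) / 2" by (simp_all add: m_def lam_def)
    have mk: "m$k = l$k" if "k \<notin> {i,j}" for k using that by (simp add: m_def lam_def)
    \<comment> \<open>Hence m has no coincidence besides m_i = m_j, which is what the tangent space
      computation and smoothness need.\<close>
    have off: "(l$i + l$j) / 2 \<noteq> l$k" for k using mid[OF ij, of k] by (simp add: field_simps)
    have mij: "m$i = m$j" by (simp add: mi)
    have simple: "{k,n} = {i,j}" if "k \<noteq> n" "m$k = m$n" for k n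
    proof -
      have "m$k = (if k \<in> {i,j} then (l$i + l$j) / 2 else l$k)" for k using mi mk by auto
      then show ?thesis using that off[of k] off[of n] inj[OF that(1)] by (auto split: if_splits)
    qed
    let ?x = "transpose C ** dmat m ** C"
    have xd: "?x \<in> derog" by (rule derog_conj[OF C dmat_derog[OF ij mij]])
    have "?x \<in> zsmooth XC"
      unfolding zsmooth_def using xd derog_subset_XC dim_ztangent_diag[OF C ij mij simple] zlocdim_derog[OF xd] by auto
    moreover have "bilin (transpose C ** dmat l ** C - ?x) v = 0" if v: "v \<in> ztangent XC ?x" for v
    proof -
      have C': "C ** transpose C = mat 1" using C matrix_left_right_inverse by blast
      define v' where "v' = C ** v ** transpose C"
      have vv: "v = transpose C ** v' ** C"
        by (metis C v'_def matrix_mul_assoc matrix_mul_lid matrix_mul_rid)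
      have "v' \<in> ztangent XC (C ** ?x ** transpose C)"
        using ztangent_conj[of "transpose C" v] C' v by (simp add: v'_def)
      moreover have cancel: "C ** (transpose C ** D ** C) ** transpose C = D" for D
        by (metis C' matrix_mul_assoc matrix_mul_lid matrix_mul_rid)
      ultimately have v': "v'$i$i = v'$j$j" using ztangent_diag[OF ij mij simple] by simp
      have "bilin (transpose C ** dmat l ** C - ?x) v = bilin (transpose C ** (dmat l - dmat m) ** C) v"
        by (simp add: matrix_sub_ldistrib matrix_sub_rdistrib)
      also have "\<dots> = bilin (dmat l - dmat m) v'" unfolding vv bilin_conj[OF C] cancel ..
      also have "dmat l - dmat m = dmat (l - m)" by (simp add: vec_eq_iff dmat_nth)
      also have "bilin (dmat (l - m)) v' = (\<Sum>k\<in>UNIV. (l - m)$k * v'$k$k)"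
        by (simp add: bilin_trace trace_def transpose_dmat dmat_mult_nth)
      \<comment> \<open>l - m is supported on i and j with opposite values there, while v'_ii =
        v'_jj.\<close>
      also have "\<dots> = (\<Sum>k\<in>{i,j}. (l - m)$k * v'$k$k)"
        by (rule sum.mono_neutral_right) (use mk in auto)
      also have "\<dots> = 0" using ij by (simp add: mi v' field_simps)
      finally show ?thesis .
    qed
    ultimately show "transpose C ** dmat (lam l i j) ** C \<in> ED_critical (transpose C ** dmat l ** C)"
      by (simp add: ED_critical_def m_def)
  qed
qed

lemma card_ED_critical:
  fixes A :: "complex^'n^'n"
  assumes gen: "gen_poly A \<noteq> 0" and A: "A \<in> csym"
  shows "finite (ED_critical A) \<and> card (ED_critical A) = CARD('n) choose 2"
proof -
  obtain C :: "complex^'n^'n" and l where C: "transpose C ** C = mat 1" and AC: "A = transpose C ** dmat l ** C"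
    by (rule generic_diagonalization[OF gen]) (use A in \<open>simp add: csym_def\<close>)
  have C': "C ** transpose C = mat 1" using C matrix_left_right_inverse by blast
  have mid: "l$i + l$j \<noteq> 2 * l$k" if "i \<noteq> j" for i j k
    by (rule generic_eigenvalues[OF gen[unfolded AC] C that])
  \<comment> \<open>Indexing by two-element sets identifies (i,j) with (j,i), which give the same
    point.\<close>
  define pt where "pt e = transpose C ** dmat (\<chi> k. if k \<in> e then (\<Sum>a\<in>e. l$a) / 2 else l$k) ** C" for e
  have pt: "pt {i,j} = transpose C ** dmat (lam l i j) ** C" if "i \<noteq> j" for i j
  proof -
    have s: "(\<Sum>a\<in>{i,j}. l$a) = l$i + l$j" using that by simp
    show ?thesis unfolding pt_def lam_def s by simp
  qed
  have "ED_critical A = pt ` {e. card e = 2}"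
  proof -
    have "{transpose C ** dmat (lam l i j) ** C | i j. i \<noteq> j} = pt ` {e. card e = 2}"
    proof (intro equalityI subsetI)
      fix x assume "x \<in> {transpose C ** dmat (lam l i j) ** C | i j. i \<noteq> j}"
      then obtain i j where "i \<noteq> j" "x = pt {i,j}" using pt by auto
      then show "x \<in> pt ` {e. card e = 2}" by (intro image_eqI[of _ _ "{i,j}"]) simp_all
    next
      fix x assume "x \<in> pt ` {e. card e = 2}"
      then obtain e where e: "x = pt e" "card e = 2" by blast
      then obtain i j where "e = {i,j}" "i \<noteq> j" unfolding card_2_iff by blast
      then show "x \<in> {transpose C ** dmat (lam l i j) ** C | i j. i \<noteq> j}" using e pt by blast
    qed
    then show ?thesis unfolding AC ED_critical_eq[OF gen[unfolded AC] C] .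
  qed
  moreover have "inj_on pt {e. card e = 2}"
  proof (rule inj_on_inverseI)
    fix e :: "'n set" assume "e \<in> {e. card e = 2}"
    then obtain i j where e: "e = {i,j}" "i \<noteq> j" by (auto simp: card_2_iff)
    have "C ** pt e ** transpose C = dmat (lam l i j)"
      unfolding e(1) pt[OF e(2)] by (metis C' matrix_mul_assoc matrix_mul_lid matrix_mul_rid)
    moreover have "(l$i + l$j) / 2 \<noteq> l$k" for k using mid[OF e(2), of k] by (simp add: field_simps)
    \<comment> \<open>The set is recovered as the diagonal positions changed by the
      averaging.\<close>
    ultimately show "{k. (C ** pt e ** transpose C) $ k $ k \<noteq> l$k} = e"
      by (auto simp: e(1) dmat_nth lam_def)
  qed
  moreover have "card {e::'n set. card e = 2} = CARD('n) choose 2"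
    using n_subsets[of "UNIV::'n set" 2] by simp
  ultimately show ?thesis by (simp add: card_image)
qed

section \<open>Genericity over the reals, and uniqueness of the generic count\<close>

lemma cpolys_real_imag:
  assumes "q \<in> cpolys"
  shows "\<exists>r\<in>rpolys. \<exists>s\<in>rpolys. \<forall>A. q (cembed A) = Complex (r A) (s A)"
  using assms
proof induction
  case (cconst c)
  show ?case
  proof (rule bexI, rule bexI)
    show "\<forall>A. c = Complex (Re c) (Im c)" by simp
  qed (rule rconst)+
next
  case (ccoord i j)
  show ?case
  proof (rule bexI, rule bexI)
    show "\<forall>A. cembed A $ i $ j = Complex (A$i$j) 0" by (simp add: cembed_def complex_eq_iff)
  qed (rule rcoord rconst)+
next
  case (cadd p q)
  then obtain r s r' s' where rs: "r \<in> rpolys" "s \<in> rpolys" "r' \<in> rpolys" "s' \<in> rpolys"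
    "\<And>A. p (cembed A) = Complex (r A) (s A)" "\<And>A. q (cembed A) = Complex (r' A) (s' A)" by blast
  show ?case
  proof (rule bexI, rule bexI)
    show "\<forall>A. p (cembed A) + q (cembed A) = Complex (r A + r' A) (s A + s' A)" by (simp add: rs(5,6) complex_eq_iff)
  qed (intro radd rs(1-4))+
next
  case (cmult p q)
  then obtain r s r' s' where rs: "r \<in> rpolys" "s \<in> rpolys" "r' \<in> rpolys" "s' \<in> rpolys"
    "\<And>A. p (cembed A) = Complex (r A) (s A)" "\<And>A. q (cembed A) = Complex (r' A) (s' A)" by blast
  show ?case
  proof (rule bexI, rule bexI)
    show "\<forall>A. p (cembed A) * q (cembed A)
        = Complex (r A * r' A + (-1) * (s A * s' A)) (r A * s' A + s A * r' A)"
      by (simp add: rs(5,6) complex_eq_iff)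
  qed (intro radd rmult rconst rs(1-4))+
qed

text \<open>Two nonempty Zariski open sets of symmetric matrices meet, because the product of q and
  q' is not identically 0 on the line through B and B'. This makes the number selected by
  \<open>THE\<close> unique.\<close>

lemma generic_common_point:
  assumes "q \<in> cpolys" "B \<in> csym" "q B \<noteq> 0" "q' \<in> cpolys" "B' \<in> csym" "q' B' \<noteq> 0"
  shows "\<exists>A\<in>csym. q A \<noteq> 0 \<and> q' A \<noteq> 0"
proof (rule ccontr)
  assume *: "\<not> ?thesis"
  define \<gamma> where "\<gamma> t = B + cscale t (B' - B)" for t
  have sym: "\<gamma> t \<in> csym" for t
  proof -
    have "B$a$b = B$b$a" "B'$a$b = B'$b$a" for a b
      using assms(2,5) by (auto simp: csym_def) (metis transpose_nth)+
    then show ?thesis by (simp add: csym_def \<gamma>_def vec_eq_iff)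
  qed
  have line: "(\<lambda>t. \<gamma> t $ a $ b) \<in> range poly" for a b
    unfolding \<gamma>_def by (simp, intro range_poly_intros)
  have "q (\<gamma> t) * q' (\<gamma> t) = 0" for t using * sym[of t] by auto
  then have "(\<lambda>t. q (\<gamma> t)) = (\<lambda>t. 0) \<or> (\<lambda>t. q' (\<gamma> t)) = (\<lambda>t. 0)"
    by (intro range_poly_mult_eq_0 cpolys_curve[OF assms(1)] cpolys_curve[OF assms(4)] line)
  moreover have "\<gamma> 0 = B" "\<gamma> 1 = B'" by (simp_all add: \<gamma>_def vec_eq_iff)
  ultimately show False using assms(3,6) by (metis (no_types))
qed

lemma cembed_mult: "cembed (A ** B) = cembed A ** cembed B"
  by (simp add: vec_eq_iff cembed_def matrix_matrix_mult_nth)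

lemma cembed_transpose: "cembed (transpose A) = transpose (cembed A)"
  by (simp add: vec_eq_iff cembed_def)

lemma EDdeg_CDelta_eq: "EDdeg_CDelta TYPE('n::finite) = CARD('n) choose 2"
  unfolding EDdeg_CDelta_def
proof (rule the_equality)
  obtain B :: "real^'n^'n" where B: "B \<in> rsym" "gen_poly (cembed B) \<noteq> 0" using gen_poly_real_nonzero by blast
  have cB: "cembed B \<in> csym" using B(1) by (simp add: rsym_def csym_def flip: cembed_transpose)
  show "\<exists>q\<in>(cpolys :: (complex^'n^'n \<Rightarrow> complex) set). (\<exists>B\<in>csym. q B \<noteq> 0) \<and>
      (\<forall>A\<in>csym. q A \<noteq> 0 \<longrightarrow> finite (ED_critical A) \<and> card (ED_critical A) = CARD('n) choose 2)"
    using cpolys_gen_poly B(2) cB card_ED_critical by (intro bexI[of _ gen_poly]) auto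
  fix d assume "\<exists>q\<in>(cpolys :: (complex^'n^'n \<Rightarrow> complex) set). (\<exists>B\<in>csym. q B \<noteq> 0) \<and>
      (\<forall>A\<in>csym. q A \<noteq> 0 \<longrightarrow> finite (ED_critical A) \<and> card (ED_critical A) = d)"
  then obtain q B' where q: "q \<in> cpolys" "B' \<in> csym" "q B' \<noteq> 0"
    "\<And>A::complex^'n^'n. A \<in> csym \<Longrightarrow> q A \<noteq> 0 \<Longrightarrow> card (ED_critical A) = d" by blast
  obtain A where "A \<in> csym" "q A \<noteq> 0" "gen_poly A \<noteq> 0"
    using generic_common_point[OF q(1-3) cpolys_gen_poly cB B(2)] by blast
  then show "d = CARD('n) choose 2" using q(4) card_ED_critical by metis
qed

lemma ED_critical_real:
  fixes C :: "real^'n^'n"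
  assumes gen: "gen_poly (cembed A) \<noteq> 0" and C: "orthogonal_matrix C" and A: "A = transpose C ** diag_mat l ** C"
  shows "ED_critical (cembed A) = {cembed (transpose C ** Lam_ij l i j ** C) | i j. i \<noteq> j}"
proof -
  define cl :: "complex^'n" where "cl = (\<chi> k. of_real (l$k))"
  have d: "cembed (diag_mat l) = dmat cl" by (simp add: vec_eq_iff cembed_def diag_mat_def dmat_nth cl_def)
  have L: "cembed (Lam_ij l i j) = dmat (lam cl i j)" for i j
    by (simp add: vec_eq_iff cembed_def Lam_ij_def diag_mat_def dmat_nth lam_def cl_def)
  have "transpose (cembed C) ** cembed C = cembed (transpose C ** C)"
    by (simp add: cembed_mult cembed_transpose)
  also have "\<dots> = mat 1" using C by (simp add: orthogonal_matrix vec_eq_iff cembed_def mat_def)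
  finally have C1: "transpose (cembed C) ** cembed C = mat 1" .
  have cA: "cembed A = transpose (cembed C) ** dmat cl ** cembed C"
    by (simp add: A cembed_mult cembed_transpose d)
  show ?thesis
    using ED_critical_eq[OF gen[unfolded cA] C1] by (simp add: cA cembed_mult cembed_transpose L)
qed

theorem theorem1p5:
  shows "(\<exists>p\<in>(rpolys :: (real^'n^'n \<Rightarrow> real) set).
            (\<exists>B\<in>rsym. p B \<noteq> 0) \<and>
            (\<forall>A\<in>rsym. p A \<noteq> 0 \<longrightarrow>
               (\<forall>(C::real^'n^'n) (l::real^'n).
                   orthogonal_matrix C \<and> A = transpose C ** diag_mat l ** C \<longrightarrow>
                   ED_critical (cembed A) =
                     {cembed (transpose C ** Lam_ij l i j ** C) | i j. i \<noteq> j}) \<and>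
               finite (ED_critical (cembed A)) \<and>
               card (ED_critical (cembed A)) = CARD('n) choose 2))
         \<and> EDdeg_CDelta TYPE('n) = CARD('n) choose 2"
proof
  obtain r s :: "real^'n^'n \<Rightarrow> real" where rs: "r \<in> rpolys" "s \<in> rpolys"
    "\<And>A. gen_poly (cembed A) = Complex (r A) (s A)"
    using cpolys_real_imag[OF cpolys_gen_poly] by blast
  \<comment> \<open>The squared modulus of \<open>gen_poly\<close>: a real polynomial with the same
    zeros on real matrices.\<close>
  define p where "p A = r A * r A + s A * s A" for A
  have p_poly: "p \<in> rpolys" unfolding p_def[abs_def] by (intro radd rmult rs)
  have p: "p A \<noteq> 0 \<longleftrightarrow> gen_poly (cembed A) \<noteq> 0" for A
    by (simp add: p_def rs(3) complex_eq_iff)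
  have sym: "cembed A \<in> csym" if "A \<in> rsym" for A :: "real^'n^'n"
    using that by (simp add: rsym_def csym_def flip: cembed_transpose)
  show "\<exists>p\<in>(rpolys :: (real^'n^'n \<Rightarrow> real) set).
            (\<exists>B\<in>rsym. p B \<noteq> 0) \<and>
            (\<forall>A\<in>rsym. p A \<noteq> 0 \<longrightarrow>
               (\<forall>(C::real^'n^'n) (l::real^'n).
                   orthogonal_matrix C \<and> A = transpose C ** diag_mat l ** C \<longrightarrow>
                   ED_critical (cembed A) =
                     {cembed (transpose C ** Lam_ij l i j ** C) | i j. i \<noteq> j}) \<and>
               finite (ED_critical (cembed A)) \<and>
               card (ED_critical (cembed A)) = CARD('n) choose 2)"
  proof (intro bexI[of _ p] conjI ballI impI allI)
    show "\<exists>B\<in>rsym. p B \<noteq> 0" using gen_poly_real_nonzero p by blast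
    fix A :: "real^'n^'n" assume A: "A \<in> rsym" "p A \<noteq> 0"
    then have gen: "gen_poly (cembed A) \<noteq> 0" using p by blast
    show "finite (ED_critical (cembed A))" "card (ED_critical (cembed A)) = CARD('n) choose 2"
      using card_ED_critical[OF gen sym[OF A(1)]] by simp_all
    fix C :: "real^'n^'n" and l
    assume "orthogonal_matrix C \<and> A = transpose C ** diag_mat l ** C"
    then show "ED_critical (cembed A) = {cembed (transpose C ** Lam_ij l i j ** C) | i j. i \<noteq> j}"
      using ED_critical_real[OF gen] by blast
  qed (rule p_poly)
qed (rule EDdeg_CDelta_eq)

end
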